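(* Let $f : (X,M) \to (Y,N)$ be a morphism of primed ringed spaces. Then there is a unique morphism of locally ringed spaces $\overline{f} : (X,M)^{\mathrm{loc}} \to (Y,N)^{\mathrm{loc}}$ such that $\pi_{(Y,N)} \circ \overline{f} = f \circ \pi_{(X,M)}$ as morphisms of ringed spaces $(X,M)^{\mathrm{loc}} \to Y$. The assignments $(X,M) \mapsto (X,M)^{\mathrm{loc}}$, $f \mapsto \overline{f}$ define a functor $\mathbf{PRS} \to \mathbf{LRS}$ which retracts the inclusion functor $\mathcal{M} : \mathbf{LRS} \to \mathbf{PRS}$ (that is, its composition with $\mathcal{M}$ is naturally isomorphic to the identity of $\mathbf{LRS}$) and is right adjoint to $\mathcal{M}$: for every locally ringed space $Y$ and every primed ringed space $(X,M)$ there is a natural bijection $$\mathrm{Hom}_{\mathbf{LRS}}(Y,(X,M)^{\mathrm{loc}}) = \mathrm{Hom}_{\mathbf{PRS}}((Y,\mathcal{M}_Y),(X,M)).$$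
   Context: Rings are commutative with $1$. $\mathbf{RS}$ is the category of ringed spaces; a morphism $f : X \to Y$ consists of a continuous map and a map of sheaves of rings $f^\sharp : f^{-1}\mathcal{O}_Y \to \mathcal{O}_X$, with stalks $f_x : \mathcal{O}_{Y,f(x)} \to \mathcal{O}_{X,x}$. $\mathbf{LRS}$ is the category of locally ringed spaces, with morphisms the $\mathbf{RS}$ morphisms whose stalks are local. Primed ringed spaces. A prime system $M$ on a ringed space $X$ is an assignment, to each $x \in X$, of a subset $M_x \subseteq \mathrm{Spec}\, \mathcal{O}_{X,x}$. A primed ringed space $(X,M)$ is a ringed space with a prime system. A morphism $f : (X,M) \to (Y,N)$ in the category $\mathbf{PRS}$ of primed ringed spaces is a morphism of ringed spaces $f : X \to Y$ such that $f_x^{-1}(z) \in N_{f(x)}$ for all $x \in X$, $z \in M_x$. For a locally ringed space $X$, the local prime system $\mathcal{M}_X$ is $\mathcal{M}_{X,x} := \{\mathfrak{m}_x\}$, where $\mathfrak m_x$ is the maximal ideal of $\mathcal O_{X,x}$. The functor $\mathcal{M} : \mathbf{LRS} \to \mathbf{PRS}$, $X \mapsto (X,\mathcal{M}_X)$, is fully faithful. Localization. For $(X,M) \in \mathbf{PRS}$, the locally ringed space $X^{\mathrm{loc}} = (X,M)^{\mathrm{loc}}$ is defined as follows. Its set of points is $\{(x,z) : x \in X,\ z \in M_x\}$. For $U \subseteq X$ open and $s \in \mathcal{O}_X(U)$ put $\mathrm{U}(U,s) := \{(x,z) \in X^{\mathrm{loc}} : x \in U,\ s_x \notin z\}$; these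 sets form a basis for the topology. For $V \subseteq X^{\mathrm{loc}}$ open, $\mathcal{O}_{X^{\mathrm{loc}}}(V)$ is the ring of those $s = (s(x,z)) \in \prod_{(x,z) \in V} (\mathcal{O}_{X,x})_z$ such that for every $(x,z) \in V$ there are a basic open neighborhood $\mathrm{U}(U,t) \subseteq V$ of $(x,z)$ and an element $a/t^n \in \mathcal{O}_X(U)_t$ with $s(x',z') = a_{x'}/t_{x'}^n$ in $(\mathcal{O}_{X,x'})_{z'}$ for all $(x',z') \in \mathrm{U}(U,t)$. The stalk at $(x,z)$ is $(\mathcal{O}_{X,x})_z$. The map $\pi = \pi_{(X,M)} : X^{\mathrm{loc}} \to X$, $(x,z) \mapsto x$, with the map of sheaves $\mathcal{O}_X \to \pi_*\mathcal{O}_{X^{\mathrm{loc}}}$ sending $s \in \mathcal{O}_X(U)$ to $((s_x)_z)_{(x,z)}$, is a morphism of ringed spaces, and is a $\mathbf{PRS}$ morphism $(X^{\mathrm{loc}},\mathcal{M}_{X^{\mathrm{loc}}}) \to (X,M)$. *)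

theory Defs
  imports "HOL-Analysis.Abstract_Topology" "HOL-Algebra.Ideal"
begin

section \<open>Ringed spaces\<close>

text \<open>
  A ringed space has points of type 'a and sections of type 'r; the sheaf is only meaningful
  on open sets, and all maps are only meaningful on the carriers.
\<close>

record ('a, 'r) rspace =
  Top :: "'a topology"
  Sec :: "'a set \<Rightarrow> 'r ring"
  Res :: "'a set \<Rightarrow> 'a set \<Rightarrow> 'r \<Rightarrow> 'r"

abbreviation points :: "('a, 'r) rspace \<Rightarrow> 'a set" where
  "points X \<equiv> topspace (Top X)"

locale ringed_space =
  fixes X :: "('a, 'r) rspace"
  assumes sections_cring: "openin (Top X) U \<Longrightarrow> cring (Sec X U)"
    and restriction_hom:
      "\<lbrakk>openin (Top X) U; openin (Top X) V; V \<subseteq> U\<rbrakk> \<Longrightarrow> Res X U V \<in> ring_hom (Sec X U) (Sec X V)"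
    and restriction_id:
      "\<lbrakk>openin (Top X) U; s \<in> carrier (Sec X U)\<rbrakk> \<Longrightarrow> Res X U U s = s"
    and restriction_trans:
      "\<lbrakk>openin (Top X) U; openin (Top X) V; openin (Top X) W; W \<subseteq> V; V \<subseteq> U; s \<in> carrier (Sec X U)\<rbrakk>
        \<Longrightarrow> Res X V W (Res X U V s) = Res X U W s"
    and separated:
      "\<lbrakk>\<And>U. U \<in> \<U> \<Longrightarrow> openin (Top X) U;
        s \<in> carrier (Sec X (\<Union>\<U>)); t \<in> carrier (Sec X (\<Union>\<U>));
        \<And>U. U \<in> \<U> \<Longrightarrow> Res X (\<Union>\<U>) U s = Res X (\<Union>\<U>) U t\<rbrakk> \<Longrightarrow> s = t"
    and gluing:
      "\<lbrakk>\<And>U. U \<in> \<U> \<Longrightarrow> openin (Top X) U;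
        \<And>U. U \<in> \<U> \<Longrightarrow> \<sigma> U \<in> carrier (Sec X U);
        \<And>U V. \<lbrakk>U \<in> \<U>; V \<in> \<U>\<rbrakk> \<Longrightarrow> Res X U (U \<inter> V) (\<sigma> U) = Res X V (U \<inter> V) (\<sigma> V)\<rbrakk>
        \<Longrightarrow> \<exists>s\<in>carrier (Sec X (\<Union>\<U>)). \<forall>U\<in>\<U>. Res X (\<Union>\<U>) U s = \<sigma> U"

subsection \<open>Stalks\<close>

type_synonym ('a, 'r) germ = "('a set \<times> 'r) set"

definition germ :: "('a, 'r) rspace \<Rightarrow> 'a \<Rightarrow> 'a set \<Rightarrow> 'r \<Rightarrow> ('a, 'r) germ" where
  "germ X x U s = {(V, t). openin (Top X) V \<and> x \<in> V \<and> t \<in> carrier (Sec X V) \<and>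
     (\<exists>W. openin (Top X) W \<and> x \<in> W \<and> W \<subseteq> U \<inter> V \<and> Res X U W s = Res X V W t)}"

text \<open>
  Germs are equivalence classes, so an operation is defined on them as the union of its results
  over all representatives: these results all coincide. The same device is used for fractions
  and for the maps induced on stalks.
\<close>

definition stalk :: "('a, 'r) rspace \<Rightarrow> 'a \<Rightarrow> ('a, 'r) germ ring" where
  "stalk X x =
    \<lparr>carrier = {germ X x U s | U s. openin (Top X) U \<and> x \<in> U \<and> s \<in> carrier (Sec X U)},
     mult = (\<lambda>A B. \<Union>(U, s)\<in>A. \<Union>(V, t)\<in>B.
       germ X x (U \<inter> V) (Res X U (U \<inter> V) s \<otimes>\<^bsub>Sec X (U \<inter> V)\<^esub> Res X V (U \<inter> V) t)),
     one = germ X x (points X) \<one>\<^bsub>Sec X (points X)\<^esub>,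
     zero = germ X x (points X) \<zero>\<^bsub>Sec X (points X)\<^esub>,
     add = (\<lambda>A B. \<Union>(U, s)\<in>A. \<Union>(V, t)\<in>B.
       germ X x (U \<inter> V) (Res X U (U \<inter> V) s \<oplus>\<^bsub>Sec X (U \<inter> V)\<^esub> Res X V (U \<inter> V) t))\<rparr>"

subsection \<open>Morphisms\<close>

text \<open>
  The sheaf map of a morphism from \<open>X\<close> to \<open>Y\<close> is given in its adjoint form
  \<open>O_Y \<rightarrow> f_* O_X\<close>, by ring homomorphisms \<open>sharp f V : O_Y(V) \<rightarrow> O_X(f^{-1} V)\<close>.
  All components are required to be extensional (undefined outside their
  domains), so that HOL equality is equality of morphisms.
\<close>

record ('a, 'r, 'b, 's) rs_map =
  pt :: "'a \<Rightarrow> 'b"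
  sharp :: "'b set \<Rightarrow> 's \<Rightarrow> 'r"

definition preim :: "('a, 'r) rspace \<Rightarrow> ('a, 'r, 'b, 's) rs_map \<Rightarrow> 'b set \<Rightarrow> 'a set" where
  "preim X f V = {x \<in> points X. pt f x \<in> V}"

definition rs_hom :: "('a, 'r) rspace \<Rightarrow> ('b, 's) rspace \<Rightarrow> ('a, 'r, 'b, 's) rs_map set" where
  "rs_hom X Y = {f.
     pt f \<in> extensional (points X) \<and>
     continuous_map (Top X) (Top Y) (pt f) \<and>
     sharp f \<in> extensional {V. openin (Top Y) V} \<and>
     (\<forall>V. openin (Top Y) V \<longrightarrow>
        sharp f V \<in> extensional (carrier (Sec Y V)) \<and>
        sharp f V \<in> ring_hom (Sec Y V) (Sec X (preim X f V))) \<and>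
     (\<forall>V W. openin (Top Y) V \<and> openin (Top Y) W \<and> W \<subseteq> V \<longrightarrow>
        (\<forall>s\<in>carrier (Sec Y V).
           sharp f W (Res Y V W s) = Res X (preim X f V) (preim X f W) (sharp f V s)))}"

definition rs_id :: "('a, 'r) rspace \<Rightarrow> ('a, 'r, 'a, 'r) rs_map" where
  "rs_id X = \<lparr>pt = (\<lambda>x\<in>points X. x),
              sharp = (\<lambda>V\<in>{V. openin (Top X) V}. \<lambda>s\<in>carrier (Sec X V). s)\<rparr>"

text \<open>\<open>rs_comp X Y Z g f\<close> is the composite of \<open>f : X \<rightarrow> Y\<close> and \<open>g : Y \<rightarrow> Z\<close>.\<close>

definition rs_comp ::
  "('a, 'r) rspace \<Rightarrow> ('b, 's) rspace \<Rightarrow> ('c, 't) rspace \<Rightarrow>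
   ('b, 's, 'c, 't) rs_map \<Rightarrow> ('a, 'r, 'b, 's) rs_map \<Rightarrow> ('a, 'r, 'c, 't) rs_map" where
  "rs_comp X Y Z g f =
    \<lparr>pt = (\<lambda>x\<in>points X. pt g (pt f x)),
     sharp = (\<lambda>W\<in>{W. openin (Top Z) W}. \<lambda>s\<in>carrier (Sec Z W).
                sharp f (preim Y g W) (sharp g W s))\<rparr>"

text \<open>\<open>stalk_map X f x\<close> is the induced map \<open>O_{Y,f(x)} \<rightarrow> O_{X,x}\<close>.\<close>

definition stalk_map ::
  "('a, 'r) rspace \<Rightarrow> ('a, 'r, 'b, 's) rs_map \<Rightarrow> 'a \<Rightarrow> ('b, 's) germ \<Rightarrow> ('a, 'r) germ" where
  "stalk_map X f x A = (\<Union>(V, s)\<in>A. germ X x (preim X f V) (sharp f V s))"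

text \<open>The inverse image under the stalk map at \<open>x\<close> of a subset of \<open>O_{X,x}\<close>.\<close>

definition stalk_vimage ::
  "('a, 'r) rspace \<Rightarrow> ('b, 's) rspace \<Rightarrow> ('a, 'r, 'b, 's) rs_map \<Rightarrow> 'a \<Rightarrow>
   ('a, 'r) germ set \<Rightarrow> ('b, 's) germ set" where
  "stalk_vimage X Y f x z = {A \<in> carrier (stalk Y (pt f x)). stalk_map X f x A \<in> z}"

section \<open>Locally ringed spaces\<close>

definition local_ring :: "('r, 'm) ring_scheme \<Rightarrow> bool" where
  "local_ring R \<longleftrightarrow> cring R \<and> (\<exists>!m. maximalideal m R)"

definition max_ideal :: "('r, 'm) ring_scheme \<Rightarrow> 'r set" where
  "max_ideal R = (THE m. maximalideal m R)"

locale locally_ringed_space = ringed_space +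
  assumes stalk_local: "x \<in> points X \<Longrightarrow> local_ring (stalk X x)"

definition lrs_hom :: "('a, 'r) rspace \<Rightarrow> ('b, 's) rspace \<Rightarrow> ('a, 'r, 'b, 's) rs_map set" where
  "lrs_hom X Y = {f \<in> rs_hom X Y. \<forall>x\<in>points X.
     stalk_vimage X Y f x (max_ideal (stalk X x)) = max_ideal (stalk Y (pt f x))}"

definition lrs_iso :: "('a, 'r) rspace \<Rightarrow> ('b, 's) rspace \<Rightarrow> ('a, 'r, 'b, 's) rs_map \<Rightarrow> bool" where
  "lrs_iso X Y f \<longleftrightarrow> f \<in> lrs_hom X Y \<and>
     (\<exists>g\<in>lrs_hom Y X. rs_comp X Y X g f = rs_id X \<and> rs_comp Y X Y f g = rs_id Y)"

section \<open>Primed ringed spaces\<close>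

type_synonym ('a, 'r) primes = "'a \<Rightarrow> ('a, 'r) germ set set"

definition Spec :: "('r, 'm) ring_scheme \<Rightarrow> 'r set set" where
  "Spec R = {p. primeideal p R}"

locale primed_ringed_space = ringed_space X
  for X :: "('a, 'r) rspace" and M :: "('a, 'r) primes" +
  assumes primes_subset_Spec: "x \<in> points X \<Longrightarrow> M x \<subseteq> Spec (stalk X x)"

definition prs_hom ::
  "('a, 'r) rspace \<Rightarrow> ('a, 'r) primes \<Rightarrow> ('b, 's) rspace \<Rightarrow> ('b, 's) primes \<Rightarrow>
   ('a, 'r, 'b, 's) rs_map set" where
  "prs_hom X M Y N = {f \<in> rs_hom X Y. \<forall>x\<in>points X. \<forall>z\<in>M x. stalk_vimage X Y f x z \<in> N (pt f x)}"

text \<open>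
  The inclusion of locally ringed spaces into primed ringed spaces sends \<open>X\<close> to \<open>X\<close> with its
  local prime system, and a morphism to itself.
\<close>

definition local_primes :: "('a, 'r) rspace \<Rightarrow> ('a, 'r) primes" where
  "local_primes X x = {max_ideal (stalk X x)}"

section \<open>Localization of rings\<close>

text \<open>The fraction \<open>a/s\<close> with respect to a multiplicative subset \<open>S\<close>, as an equivalence class.\<close>

definition fraction :: "('r, 'm) ring_scheme \<Rightarrow> 'r set \<Rightarrow> 'r \<Rightarrow> 'r \<Rightarrow> ('r \<times> 'r) set" where
  "fraction R S a s = {(b, t). b \<in> carrier R \<and> t \<in> S \<and>
     (\<exists>u\<in>S. u \<otimes>\<^bsub>R\<^esub> (t \<otimes>\<^bsub>R\<^esub> a) = u \<otimes>\<^bsub>R\<^esub> (s \<otimes>\<^bsub>R\<^esub> b))}"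

definition localization :: "('r, 'm) ring_scheme \<Rightarrow> 'r set \<Rightarrow> ('r \<times> 'r) set ring" where
  "localization R S =
    \<lparr>carrier = {fraction R S a s | a s. a \<in> carrier R \<and> s \<in> S},
     mult = (\<lambda>A B. \<Union>(a, s)\<in>A. \<Union>(b, t)\<in>B. fraction R S (a \<otimes>\<^bsub>R\<^esub> b) (s \<otimes>\<^bsub>R\<^esub> t)),
     one = fraction R S \<one>\<^bsub>R\<^esub> \<one>\<^bsub>R\<^esub>,
     zero = fraction R S \<zero>\<^bsub>R\<^esub> \<one>\<^bsub>R\<^esub>,
     add = (\<lambda>A B. \<Union>(a, s)\<in>A. \<Union>(b, t)\<in>B.
       fraction R S (t \<otimes>\<^bsub>R\<^esub> a \<oplus>\<^bsub>R\<^esub> s \<otimes>\<^bsub>R\<^esub> b) (s \<otimes>\<^bsub>R\<^esub> t))\<rparr>"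

section \<open>Localization of primed ringed spaces\<close>

type_synonym ('a, 'r) loc_point = "'a \<times> ('a, 'r) germ set"
type_synonym ('a, 'r) loc_section =
  "('a, 'r) loc_point \<Rightarrow> (('a, 'r) germ \<times> ('a, 'r) germ) set"

text \<open>The ring \<open>(O_{X,x})_z\<close> and its element \<open>a/s\<close>, for a point \<open>(x,z)\<close>.\<close>

definition loc_stalk ::
  "('a, 'r) rspace \<Rightarrow> ('a, 'r) loc_point \<Rightarrow> (('a, 'r) germ \<times> ('a, 'r) germ) set ring" where
  "loc_stalk X = (\<lambda>(x, z). localization (stalk X x) (carrier (stalk X x) - z))"

definition loc_frac ::
  "('a, 'r) rspace \<Rightarrow> ('a, 'r) loc_point \<Rightarrow> ('a, 'r) germ \<Rightarrow> ('a, 'r) germ \<Rightarrow>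
   (('a, 'r) germ \<times> ('a, 'r) germ) set" where
  "loc_frac X = (\<lambda>(x, z). fraction (stalk X x) (carrier (stalk X x) - z))"

definition loc_basic ::
  "('a, 'r) rspace \<Rightarrow> ('a, 'r) primes \<Rightarrow> 'a set \<Rightarrow> 'r \<Rightarrow> ('a, 'r) loc_point set" where
  "loc_basic X M U s = {(x, z). x \<in> U \<and> z \<in> M x \<and> germ X x U s \<notin> z}"

definition loc_topology ::
  "('a, 'r) rspace \<Rightarrow> ('a, 'r) primes \<Rightarrow> ('a, 'r) loc_point topology" where
  "loc_topology X M = topology (arbitrary union_of
     (\<lambda>B. \<exists>U s. openin (Top X) U \<and> s \<in> carrier (Sec X U) \<and> B = loc_basic X M U s))"

definition loc_sections ::
  "('a, 'r) rspace \<Rightarrow> ('a, 'r) primes \<Rightarrow> ('a, 'r) loc_point set \<Rightarrow> ('a, 'r) loc_section set" where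
  "loc_sections X M V = {\<sigma> \<in> (\<Pi>\<^sub>E p\<in>V. carrier (loc_stalk X p)).
     \<forall>p\<in>V. \<exists>U t a n. openin (Top X) U \<and> t \<in> carrier (Sec X U) \<and> a \<in> carrier (Sec X U) \<and>
       p \<in> loc_basic X M U t \<and> loc_basic X M U t \<subseteq> V \<and>
       (\<forall>(x, z)\<in>loc_basic X M U t.
          \<sigma> (x, z) = loc_frac X (x, z) (germ X x U a) (germ X x U t [^]\<^bsub>stalk X x\<^esub> (n::nat)))}"

definition loc_space ::
  "('a, 'r) rspace \<Rightarrow> ('a, 'r) primes \<Rightarrow> (('a, 'r) loc_point, ('a, 'r) loc_section) rspace" where
  "loc_space X M =
    \<lparr>Top = loc_topology X M,
     Sec = (\<lambda>V.
       \<lparr>carrier = loc_sections X M V,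
        mult = (\<lambda>\<sigma> \<tau>. \<lambda>p\<in>V. \<sigma> p \<otimes>\<^bsub>loc_stalk X p\<^esub> \<tau> p),
        one = (\<lambda>p\<in>V. \<one>\<^bsub>loc_stalk X p\<^esub>),
        zero = (\<lambda>p\<in>V. \<zero>\<^bsub>loc_stalk X p\<^esub>),
        add = (\<lambda>\<sigma> \<tau>. \<lambda>p\<in>V. \<sigma> p \<oplus>\<^bsub>loc_stalk X p\<^esub> \<tau> p)\<rparr>),
     Res = (\<lambda>V W \<sigma>. restrict \<sigma> W)\<rparr>"

definition loc_proj ::
  "('a, 'r) rspace \<Rightarrow> ('a, 'r) primes \<Rightarrow>
   (('a, 'r) loc_point, ('a, 'r) loc_section, 'a, 'r) rs_map" where
  "loc_proj X M =
    \<lparr>pt = (\<lambda>(x, z)\<in>points (loc_space X M). x),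
     sharp = (\<lambda>U\<in>{U. openin (Top X) U}. \<lambda>s\<in>carrier (Sec X U).
       \<lambda>(x, z)\<in>{p \<in> points (loc_space X M). fst p \<in> U}.
         loc_frac X (x, z) (germ X x U s) \<one>\<^bsub>stalk X x\<^esub>)\<rparr>"

text \<open>The induced morphism, specified by the universal property that determines it.\<close>

definition loc_map ::
  "('a, 'r) rspace \<Rightarrow> ('a, 'r) primes \<Rightarrow> ('b, 's) rspace \<Rightarrow> ('b, 's) primes \<Rightarrow>
   ('a, 'r, 'b, 's) rs_map \<Rightarrow>
   (('a, 'r) loc_point, ('a, 'r) loc_section, ('b, 's) loc_point, ('b, 's) loc_section) rs_map"
  where
  "loc_map X M Y N f = (THE h. h \<in> lrs_hom (loc_space X M) (loc_space Y N) \<and>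
     rs_comp (loc_space X M) (loc_space Y N) Y (loc_proj Y N) h =
     rs_comp (loc_space X M) X Y f (loc_proj X M))"

text \<open>The map of the adjunction, \<open>Hom(Y, (X,M)^loc) \<rightarrow> Hom((Y,M_Y), (X,M))\<close>.\<close>

definition loc_adj ::
  "('b, 's) rspace \<Rightarrow> ('a, 'r) rspace \<Rightarrow> ('a, 'r) primes \<Rightarrow>
   ('b, 's, ('a, 'r) loc_point, ('a, 'r) loc_section) rs_map \<Rightarrow> ('b, 's, 'a, 'r) rs_map" where
  "loc_adj Y X M g = rs_comp Y (loc_space X M) X (loc_proj X M) g"

end

theory Submission
  imports Defs
begin

text \<open>
  Everything follows from one universal property: for a locally ringed space \<open>T\<close>, a morphism
  \<open>g : (T, M_T) \<rightarrow> (X, M)\<close> of primed ringed spaces factors uniquely through \<open>\<pi>\<close> by a morphism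
  \<open>h : T \<rightarrow> (X, M)^loc\<close> of locally ringed spaces.

  On points \<open>h\<close> must be \<open>y \<mapsto> (g y, g_y^{-1}(m_y))\<close>, because the maximal ideal of the stalk at
  \<open>(x, z)\<close> pulls back to \<open>z\<close> along \<open>\<pi>\<close>. On stalks \<open>h_y\<close> must be the extension of \<open>g_y\<close> to the ring of
  fractions, because every germ of the structure sheaf is a fraction of germs pulled back along \<open>\<pi>\<close>.
  Conversely these maps on stalks carry sections to families of germs which are locally given by
  sections (a fraction \<open>a/t\<close> pulls back to \<open>g^#(a)/g^#(t)\<close> where \<open>g^#(t)\<close> is invertible), and such a
  family glues. The induced morphism of \<open>f\<close> is the factorization of \<open>f \<circ> \<pi>\<close>.
\<close>

section \<open>Rings of fractions\<close>

text \<open>Sections of the localization are families of values in rings of fractions, while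
  sections of \<open>T\<close> are abstract, so the two are compared through germs. A section is
  determined by its germs (\<open>sections_eqI\<close>), and a family of germs that is locally given
  by sections comes from one section (\<open>section_of_germs\<close>); every identity between
  sections of \<open>T\<close> thus becomes one in a stalk. Being locally ringed enters for
  \<open>T\<close> through one fact: outside the maximal ideal everything is a unit. Hence the
  elements outside the pulled back prime are exactly those that \<open>g_y\<close> makes invertible,
  which lets \<open>g_y\<close> extend to fractions, and an invertible germ stays invertible on a
  neighbourhood, which gives both the continuity of \<open>h\<close> and the local sections.
  Locality of the stalk at \<open>(x, z)\<close> comes from evaluating germs at that point, together
  with an explicit inverse for a germ whose value avoids the extension of \<open>z\<close>.
  Operations on fractions and germs are unions over representatives, so each needs a proof that all
  representatives give the same set before it can be computed.\<close>

locale fractions = cring R + submonoid S R for R (structure) and S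
begin

lemma fraction_eqI:
  assumes "a \<in> carrier R" "b \<in> carrier R" "s \<in> S" "t \<in> S" "u \<in> S"
    and "u \<otimes> (t \<otimes> a) = u \<otimes> (s \<otimes> b)"
  shows "fraction R S a s = fraction R S b t"
proof -
  have *: "fraction R S b t \<subseteq> fraction R S a s"
    if A: "a \<in> carrier R" "b \<in> carrier R" "s \<in> S" "t \<in> S" "u \<in> S"
      and eq: "u \<otimes> (t \<otimes> a) = u \<otimes> (s \<otimes> b)" for a b s t u
  proof (clarsimp simp: fraction_def)
    fix c w v
    assume B: "c \<in> carrier R" "w \<in> S" "v \<in> S" and eq': "v \<otimes> (w \<otimes> b) = v \<otimes> (t \<otimes> c)"
    have C: "s \<in> carrier R" "t \<in> carrier R" "u \<in> carrier R" "w \<in> carrier R" "v \<in> carrier R"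
      using A B by auto
    \<comment> \<open>Transitivity through \<open>b/t\<close>: besides the two witnesses
      \<open>u\<close> and \<open>v\<close>, the middle denominator \<open>t\<close> has to be part
      of the new witness, because it is eliminated between the two relations.\<close>
    have "(u \<otimes> v \<otimes> t) \<otimes> (w \<otimes> a) = (v \<otimes> w) \<otimes> (u \<otimes> (t \<otimes> a))"
      using A B C by (simp add: m_ac)
    also have "\<dots> = (u \<otimes> s) \<otimes> (v \<otimes> (w \<otimes> b))"
      unfolding eq using A B C by (simp add: m_ac)
    also have "\<dots> = (u \<otimes> v \<otimes> t) \<otimes> (s \<otimes> c)"
      unfolding eq' using A B C by (simp add: m_ac)
    finally show "\<exists>u\<in>S. u \<otimes> (w \<otimes> a) = u \<otimes> (s \<otimes> c)"
      using A B by blast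
  qed
  show ?thesis
    using *[OF assms] *[OF assms(2,1,4,3,5) assms(6)[symmetric]] by blast
qed

lemma fraction_self: "\<lbrakk>a \<in> carrier R; s \<in> S\<rbrakk> \<Longrightarrow> (a, s) \<in> fraction R S a s"
  by (auto simp: fraction_def)

lemma fraction_eq_iff:
  assumes "a \<in> carrier R" "b \<in> carrier R" "s \<in> S" "t \<in> S"
  shows "fraction R S a s = fraction R S b t \<longleftrightarrow> (\<exists>u\<in>S. u \<otimes> (t \<otimes> a) = u \<otimes> (s \<otimes> b))"
proof
  assume "fraction R S a s = fraction R S b t"
  then have "(b, t) \<in> fraction R S a s"
    using fraction_self[of b t] assms by auto
  then show "\<exists>u\<in>S. u \<otimes> (t \<otimes> a) = u \<otimes> (s \<otimes> b)"
    by (auto simp: fraction_def)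
qed (use assms fraction_eqI in blast)

lemma mem_fractionD:
  assumes "(b, t) \<in> fraction R S a s" "a \<in> carrier R" "s \<in> S"
  shows "b \<in> carrier R" "t \<in> S" "fraction R S b t = fraction R S a s"
proof -
  show "b \<in> carrier R" "t \<in> S" using assms by (auto simp: fraction_def)
  moreover obtain u where "u \<in> S" "u \<otimes> (t \<otimes> a) = u \<otimes> (s \<otimes> b)"
    using assms(1) by (auto simp: fraction_def)
  ultimately show "fraction R S b t = fraction R S a s"
    using assms by (intro fraction_eqI[symmetric])
qed

lemma fraction_cancel:
  assumes "a \<in> carrier R" "s \<in> S" "u \<in> S"
  shows "fraction R S (u \<otimes> a) (u \<otimes> s) = fraction R S a s"
  using assms by (intro fraction_eqI[where u = \<one>]) (auto simp: m_ac)

lemma fraction_in_carrier [simp]: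
  "\<lbrakk>a \<in> carrier R; s \<in> S\<rbrakk> \<Longrightarrow> fraction R S a s \<in> carrier (localization R S)"
  by (auto simp: localization_def)

lemma localization_cases:
  assumes "A \<in> carrier (localization R S)"
  obtains a s where "a \<in> carrier R" "s \<in> S" "A = fraction R S a s"
  using assms by (auto simp: localization_def)

text \<open>A union of sets that are all equal to \<open>C\<close> is \<open>C\<close> as soon as
  the index sets are nonempty, and \<open>(a, s)\<close> and \<open>(b, t)\<close> represent their
  own classes. The operations of \<open>localization\<close> are computed through this, once they
  are known to respect representatives.\<close>

lemma UN_fraction_fraction_const:
  assumes "a \<in> carrier R" "s \<in> S" "b \<in> carrier R" "t \<in> S"
    and "\<And>a' s' b' t'. \<lbrakk>a' \<in> carrier R; s' \<in> S; b' \<in> carrier R; t' \<in> S;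
      fraction R S a' s' = fraction R S a s; fraction R S b' t' = fraction R S b t\<rbrakk>
      \<Longrightarrow> F a' s' b' t' = C"
  shows "(\<Union>(a', s')\<in>fraction R S a s. \<Union>(b', t')\<in>fraction R S b t. F a' s' b' t') = C"
proof -
  have *: "F a' s' b' t' = C"
    if "(a', s') \<in> fraction R S a s" "(b', t') \<in> fraction R S b t" for a' s' b' t'
    using mem_fractionD[OF that(1)] mem_fractionD[OF that(2)] assms by blast
  show ?thesis
  proof (intro equalityI subsetI)
    fix x assume "x \<in> C"
    then have "x \<in> F a s b t" using * fraction_self assms(1-4) by metis
    then show "x \<in> (\<Union>(a', s')\<in>fraction R S a s. \<Union>(b', t')\<in>fraction R S b t. F a' s' b' t')"
      using fraction_self[OF assms(1,2)] fraction_self[OF assms(3,4)] by blast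
  qed (use * in auto)
qed

lemma fraction_mult:
  assumes "a \<in> carrier R" "s \<in> S" "b \<in> carrier R" "t \<in> S"
  shows "fraction R S a s \<otimes>\<^bsub>localization R S\<^esub> fraction R S b t = fraction R S (a \<otimes> b) (s \<otimes> t)"
proof -
  have "fraction R S (a' \<otimes> b') (s' \<otimes> t') = fraction R S (a \<otimes> b) (s \<otimes> t)"
    if A: "a' \<in> carrier R" "s' \<in> S" "b' \<in> carrier R" "t' \<in> S"
      and eqs: "fraction R S a' s' = fraction R S a s" "fraction R S b' t' = fraction R S b t"
    for a' s' b' t'
  proof -
    obtain u v where uv: "u \<in> S" "v \<in> S"
      and u: "u \<otimes> (s \<otimes> a') = u \<otimes> (s' \<otimes> a)" and v: "v \<otimes> (t \<otimes> b') = v \<otimes> (t' \<otimes> b)"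
      using eqs A assms by (auto simp: fraction_eq_iff)
    have [simp]: "s \<in> carrier R" "t \<in> carrier R" "s' \<in> carrier R" "t' \<in> carrier R"
      "u \<in> carrier R" "v \<in> carrier R" using A assms uv by auto
    have "(u \<otimes> v) \<otimes> ((s \<otimes> t) \<otimes> (a' \<otimes> b')) = (u \<otimes> (s \<otimes> a')) \<otimes> (v \<otimes> (t \<otimes> b'))"
      using A assms by (simp add: m_ac)
    also have "\<dots> = (u \<otimes> v) \<otimes> ((s' \<otimes> t') \<otimes> (a \<otimes> b))"
      unfolding u v using A assms by (simp add: m_ac)
    finally show ?thesis
      using A assms uv by (intro fraction_eqI[of _ _ _ _ "u \<otimes> v"]) auto
  qed
  then show ?thesis
    unfolding localization_def monoid.simps
    by (intro UN_fraction_fraction_const assms)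
qed

lemma fraction_add:
  assumes "a \<in> carrier R" "s \<in> S" "b \<in> carrier R" "t \<in> S"
  shows "fraction R S a s \<oplus>\<^bsub>localization R S\<^esub> fraction R S b t =
    fraction R S (t \<otimes> a \<oplus> s \<otimes> b) (s \<otimes> t)"
proof -
  have "fraction R S (t' \<otimes> a' \<oplus> s' \<otimes> b') (s' \<otimes> t') = fraction R S (t \<otimes> a \<oplus> s \<otimes> b) (s \<otimes> t)"
    if A: "a' \<in> carrier R" "s' \<in> S" "b' \<in> carrier R" "t' \<in> S"
      and eqs: "fraction R S a' s' = fraction R S a s" "fraction R S b' t' = fraction R S b t"
    for a' s' b' t'
  proof -
    obtain u v where uv: "u \<in> S" "v \<in> S"
      and u: "u \<otimes> (s \<otimes> a') = u \<otimes> (s' \<otimes> a)" and v: "v \<otimes> (t \<otimes> b') = v \<otimes> (t' \<otimes> b)"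
      using eqs A assms by (auto simp: fraction_eq_iff)
    have [simp]: "s \<in> carrier R" "t \<in> carrier R" "s' \<in> carrier R" "t' \<in> carrier R"
      "u \<in> carrier R" "v \<in> carrier R" using A assms uv by auto
    have "(u \<otimes> v) \<otimes> ((s \<otimes> t) \<otimes> (t' \<otimes> a' \<oplus> s' \<otimes> b')) =
        (u \<otimes> (s \<otimes> a')) \<otimes> (v \<otimes> (t \<otimes> t')) \<oplus> (v \<otimes> (t \<otimes> b')) \<otimes> (u \<otimes> (s \<otimes> s'))"
      using A assms by (simp add: m_ac r_distr)
    also have "\<dots> = (u \<otimes> v) \<otimes> ((s' \<otimes> t') \<otimes> (t \<otimes> a \<oplus> s \<otimes> b))"
      unfolding u v using A assms by (simp add: m_ac r_distr)
    finally show ?thesis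
      using A assms uv by (intro fraction_eqI[of _ _ _ _ "u \<otimes> v"]) auto
  qed
  then show ?thesis
    unfolding localization_def ring.simps
    by (intro UN_fraction_fraction_const assms)
qed

lemma fraction_one: "\<one>\<^bsub>localization R S\<^esub> = fraction R S \<one> \<one>"
  and fraction_zero: "\<zero>\<^bsub>localization R S\<^esub> = fraction R S \<zero> \<one>"
  by (simp_all add: localization_def)

sublocale loc: cring "localization R S"
proof (intro cringI abelian_groupI comm_monoidI)
  fix A B assume "A \<in> carrier (localization R S)" "B \<in> carrier (localization R S)"
  then obtain a s b t where "a \<in> carrier R" "s \<in> S" "A = fraction R S a s"
    "b \<in> carrier R" "t \<in> S" "B = fraction R S b t"
    by (auto elim!: localization_cases)
  then show "A \<oplus>\<^bsub>localization R S\<^esub> B \<in> carrier (localization R S)"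
    "A \<otimes>\<^bsub>localization R S\<^esub> B \<in> carrier (localization R S)"
    "A \<oplus>\<^bsub>localization R S\<^esub> B = B \<oplus>\<^bsub>localization R S\<^esub> A"
    "A \<otimes>\<^bsub>localization R S\<^esub> B = B \<otimes>\<^bsub>localization R S\<^esub> A"
    by (simp_all add: fraction_add fraction_mult m_ac a_ac)
next
  fix A B C assume "A \<in> carrier (localization R S)" "B \<in> carrier (localization R S)"
    "C \<in> carrier (localization R S)"
  then obtain a s b t c u where *: "a \<in> carrier R" "s \<in> S" "A = fraction R S a s"
    "b \<in> carrier R" "t \<in> S" "B = fraction R S b t" "c \<in> carrier R" "u \<in> S" "C = fraction R S c u"
    by (auto elim!: localization_cases)
  then show "A \<oplus>\<^bsub>localization R S\<^esub> B \<oplus>\<^bsub>localization R S\<^esub> C = A \<oplus>\<^bsub>localization R S\<^esub> (B \<oplus>\<^bsub>localization R S\<^esub> C)"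
    "A \<otimes>\<^bsub>localization R S\<^esub> B \<otimes>\<^bsub>localization R S\<^esub> C = A \<otimes>\<^bsub>localization R S\<^esub> (B \<otimes>\<^bsub>localization R S\<^esub> C)"
    by (simp_all add: fraction_add fraction_mult m_ac a_ac r_distr)
  \<comment> \<open>Adding \<open>ac/(su)\<close> and \<open>bc/(tu)\<close> produces the
    denominator \<open>(su)(tu)\<close>, which has one factor \<open>u\<close> more than the left
    side; so the left side is expanded by \<open>u\<close>.\<close>
  have "fraction R S ((t \<otimes> a \<oplus> s \<otimes> b) \<otimes> c) (s \<otimes> t \<otimes> u) =
    fraction R S (u \<otimes> ((t \<otimes> a \<oplus> s \<otimes> b) \<otimes> c)) (u \<otimes> (s \<otimes> t \<otimes> u))"
    using * by (intro fraction_cancel[symmetric]) auto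
  then show "(A \<oplus>\<^bsub>localization R S\<^esub> B) \<otimes>\<^bsub>localization R S\<^esub> C =
      A \<otimes>\<^bsub>localization R S\<^esub> C \<oplus>\<^bsub>localization R S\<^esub> B \<otimes>\<^bsub>localization R S\<^esub> C"
    using * by (simp add: fraction_add fraction_mult m_ac a_ac l_distr r_distr)
next
  fix A assume "A \<in> carrier (localization R S)"
  then obtain a s where *: "a \<in> carrier R" "s \<in> S" "A = fraction R S a s"
    by (auto elim!: localization_cases)
  then show "\<zero>\<^bsub>localization R S\<^esub> \<oplus>\<^bsub>localization R S\<^esub> A = A"
    "\<one>\<^bsub>localization R S\<^esub> \<otimes>\<^bsub>localization R S\<^esub> A = A"
    by (simp_all add: fraction_add fraction_mult fraction_one fraction_zero)
  have "fraction R S (\<ominus> a) s \<oplus>\<^bsub>localization R S\<^esub> A = fraction R S \<zero> \<one>"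
    using * one_closed by (simp add: fraction_add fraction_eq_iff r_distr[symmetric] l_neg) blast
  then show "\<exists>B\<in>carrier (localization R S). B \<oplus>\<^bsub>localization R S\<^esub> A = \<zero>\<^bsub>localization R S\<^esub>"
    using * by (auto simp: fraction_zero intro!: bexI[of _ "fraction R S (\<ominus> a) s"])
qed (auto simp: fraction_one fraction_zero)

lemma fraction_hom: "(\<lambda>a. fraction R S a \<one>) \<in> ring_hom R (localization R S)"
  by (rule ring_hom_memI) (auto simp: fraction_mult fraction_add fraction_one)

end

text \<open>The induced map is single valued only if \<open>h\<close> maps the denominators to units.\<close>

definition fraction_map ::
  "('a, 'm) ring_scheme \<Rightarrow> 'a set \<Rightarrow> ('b, 'n) ring_scheme \<Rightarrow> ('a \<Rightarrow> 'b) \<Rightarrow> ('a \<times> 'a) set \<Rightarrow> 'b" where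
  "fraction_map R S T h A = (THE b. b \<in> carrier T \<and> (\<forall>(a, s)\<in>A. h s \<otimes>\<^bsub>T\<^esub> b = h a))"

locale fractions_hom = fractions R S + ring_hom_cring R T h for R (structure) and S and T (structure) and h +
  assumes hom_Units: "s \<in> S \<Longrightarrow> h s \<in> Units T"
begin

lemma Units_cancel:
  assumes "u \<in> S" "a \<in> carrier T" "b \<in> carrier T" "h u \<otimes>\<^bsub>T\<^esub> a = h u \<otimes>\<^bsub>T\<^esub> b"
  shows "a = b"
  using assms hom_Units[OF assms(1)] S.Units_l_cancel by blast

text \<open>The equation \<open>h s b = h a\<close> passes to any other representative
  \<open>(a', s')\<close>: multiplied by \<open>h (u s)\<close>, with \<open>u\<close> the witness
  of equality of the two fractions, both sides agree, and \<open>h (u s)\<close> is a unit. Stating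
  the value by an equation rather than with an inverse lets later proofs avoid computing with
  inverses.\<close>

lemma fraction_map_eqI:
  assumes "a \<in> carrier R" "s \<in> S" "b \<in> carrier T" "h s \<otimes>\<^bsub>T\<^esub> b = h a"
  shows "fraction_map R S T h (fraction R S a s) = b"
  unfolding fraction_map_def
proof (rule the_equality, safe)
  fix a' s' assume "(a', s') \<in> fraction R S a s"
  then obtain u where *: "u \<in> S" "u \<otimes> (s' \<otimes> a) = u \<otimes> (s \<otimes> a')" "a' \<in> carrier R" "s' \<in> S"
    by (auto simp: fraction_def)
  have [simp]: "u \<in> carrier R" "s \<in> carrier R" "s' \<in> carrier R" using * assms by auto
  have "h (u \<otimes> s) \<otimes>\<^bsub>T\<^esub> (h s' \<otimes>\<^bsub>T\<^esub> b) = h (u \<otimes> (s' \<otimes> a))"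
    using *(1,3,4) assms(1-3) by (simp add: assms(4)[symmetric] S.m_ac)
  also have "\<dots> = h (u \<otimes> s) \<otimes>\<^bsub>T\<^esub> h a'"
    unfolding *(2) using *(1,3,4) assms(1-3) by (simp add: S.m_ac)
  finally have "h (u \<otimes> s) \<otimes>\<^bsub>T\<^esub> (h s' \<otimes>\<^bsub>T\<^esub> b) = h (u \<otimes> s) \<otimes>\<^bsub>T\<^esub> h a'" .
  then show "h s' \<otimes>\<^bsub>T\<^esub> b = h a'"
    using *(1,3,4) assms(1-3) Units_cancel[of "u \<otimes> s" "h s' \<otimes>\<^bsub>T\<^esub> b" "h a'"] by simp
next
  fix b' assume "b' \<in> carrier T" "\<forall>(a', s')\<in>fraction R S a s. h s' \<otimes>\<^bsub>T\<^esub> b' = h a'"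
  then have "h s \<otimes>\<^bsub>T\<^esub> b' = h s \<otimes>\<^bsub>T\<^esub> b" using assms fraction_self[of a s] by auto
  then show "b' = b"
    using Units_cancel assms(2,3) \<open>b' \<in> carrier T\<close> by blast
qed (use assms in auto)

lemma fraction_map_fraction:
  assumes "a \<in> carrier R" "s \<in> S"
  shows "fraction_map R S T h (fraction R S a s) = inv\<^bsub>T\<^esub> (h s) \<otimes>\<^bsub>T\<^esub> h a"
  using assms hom_Units by (intro fraction_map_eqI) (auto simp: S.m_assoc[symmetric])

text \<open>With \<open>i\<close> and \<open>j\<close> the inverses of the two denominators,
  \<open>fraction_map_eqI\<close> asks only that the proposed product or sum become the image of the
  numerator when multiplied by \<open>h (s t)\<close>, where the inverses cancel.\<close>

lemma fraction_map_hom: "fraction_map R S T h \<in> ring_hom (localization R S) T"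
proof (rule ring_hom_memI)
  fix A assume "A \<in> carrier (localization R S)"
  then show "fraction_map R S T h A \<in> carrier T"
    using hom_Units by (auto elim!: localization_cases simp: fraction_map_fraction)
next
  fix A B assume "A \<in> carrier (localization R S)" "B \<in> carrier (localization R S)"
  then obtain a s b t where *: "a \<in> carrier R" "s \<in> S" "A = fraction R S a s"
    "b \<in> carrier R" "t \<in> S" "B = fraction R S b t"
    by (auto elim!: localization_cases)
  define i where "i = inv\<^bsub>T\<^esub> (h s)"
  define j where "j = inv\<^bsub>T\<^esub> (h t)"
  have ij: "i \<in> carrier T" "j \<in> carrier T" "h s \<otimes>\<^bsub>T\<^esub> i = \<one>\<^bsub>T\<^esub>" "h t \<otimes>\<^bsub>T\<^esub> j = \<one>\<^bsub>T\<^esub>"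
    using * hom_Units by (auto simp: i_def j_def)
  have c: "h s \<in> carrier T" "h t \<in> carrier T" "h a \<in> carrier T" "h b \<in> carrier T"
    using * by auto
  have mult: "h (s \<otimes> t) \<otimes>\<^bsub>T\<^esub> ((i \<otimes>\<^bsub>T\<^esub> h a) \<otimes>\<^bsub>T\<^esub> (j \<otimes>\<^bsub>T\<^esub> h b)) = h (a \<otimes> b)"
  proof -
    have "h (s \<otimes> t) \<otimes>\<^bsub>T\<^esub> ((i \<otimes>\<^bsub>T\<^esub> h a) \<otimes>\<^bsub>T\<^esub> (j \<otimes>\<^bsub>T\<^esub> h b)) =
        (h s \<otimes>\<^bsub>T\<^esub> i) \<otimes>\<^bsub>T\<^esub> (h t \<otimes>\<^bsub>T\<^esub> j) \<otimes>\<^bsub>T\<^esub> (h a \<otimes>\<^bsub>T\<^esub> h b)"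
      using * ij(1,2) c by (simp add: S.m_ac)
    then show ?thesis using ij c * by simp
  qed
  have add: "h (s \<otimes> t) \<otimes>\<^bsub>T\<^esub> (i \<otimes>\<^bsub>T\<^esub> h a \<oplus>\<^bsub>T\<^esub> j \<otimes>\<^bsub>T\<^esub> h b) = h (t \<otimes> a \<oplus> s \<otimes> b)"
  proof -
    have "h (s \<otimes> t) \<otimes>\<^bsub>T\<^esub> (i \<otimes>\<^bsub>T\<^esub> h a \<oplus>\<^bsub>T\<^esub> j \<otimes>\<^bsub>T\<^esub> h b) =
        (h s \<otimes>\<^bsub>T\<^esub> i) \<otimes>\<^bsub>T\<^esub> (h t \<otimes>\<^bsub>T\<^esub> h a) \<oplus>\<^bsub>T\<^esub> (h t \<otimes>\<^bsub>T\<^esub> j) \<otimes>\<^bsub>T\<^esub> (h s \<otimes>\<^bsub>T\<^esub> h b)"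
      using * ij(1,2) c by (simp add: S.m_ac S.r_distr)
    then show ?thesis using ij c * by simp
  qed
  show "fraction_map R S T h (A \<otimes>\<^bsub>localization R S\<^esub> B) =
      fraction_map R S T h A \<otimes>\<^bsub>T\<^esub> fraction_map R S T h B"
    unfolding *(3,6)
    using * ij c mult
    by (simp only: fraction_mult fraction_map_fraction flip: i_def j_def) (intro fraction_map_eqI; simp)
  show "fraction_map R S T h (A \<oplus>\<^bsub>localization R S\<^esub> B) =
      fraction_map R S T h A \<oplus>\<^bsub>T\<^esub> fraction_map R S T h B"
    unfolding *(3,6)
    using * ij c add
    by (simp only: fraction_add fraction_map_fraction flip: i_def j_def) (intro fraction_map_eqI; simp)
qed (auto simp: fraction_one intro!: fraction_map_eqI)

end

section \<open>Local rings\<close>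

lemma (in cring) ideal_eq_carrier_if_Units:
  assumes "ideal I R" "a \<in> I" "a \<in> Units R"
  shows "I = carrier R"
proof -
  interpret ideal I R by fact
  have "inv a \<otimes> a \<in> I" using assms by (intro I_l_closed) auto
  then show ?thesis using assms by (intro one_imp_carrier) auto
qed

text \<open>Krull's theorem by Zorn's lemma on the proper ideals containing \<open>I\<close>: an
  ideal is proper exactly when it misses \<open>\<one>\<close>, and that survives the union of a
  chain.\<close>

lemma (in cring) proper_ideal_subset_maximalideal:
  assumes "ideal I R" "I \<noteq> carrier R"
  obtains m where "maximalideal m R" "I \<subseteq> m"
proof -
  define \<A> where "\<A> = {J. ideal J R \<and> I \<subseteq> J \<and> J \<noteq> carrier R}"
  have one: "\<one> \<notin> J" if "J \<in> \<A>" for J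
    using that ideal.one_imp_carrier by (auto simp: \<A>_def)
  have "\<exists>m\<in>\<A>. \<forall>J\<in>\<A>. m \<subseteq> J \<longrightarrow> J = m"
  proof (rule subset_Zorn_nonempty)
    show "\<A> \<noteq> {}" using assms by (auto simp: \<A>_def)
    fix \<C> assume "\<C> \<noteq> {}" and chain: "subset.chain \<A> \<C>"
    then obtain J0 where J0: "J0 \<in> \<C>" by auto
    have sub: "\<C> \<subseteq> \<A>" using chain by (auto simp: subset.chain_def)
    have "ideal (\<Union>\<C>) R"
    proof (rule idealI)
      show "subgroup (\<Union>\<C>) (add_monoid R)"
      proof (rule subgroup.intro)
        show "\<Union>\<C> \<subseteq> carrier (add_monoid R)"
        proof
          fix x assume "x \<in> \<Union>\<C>"
          then obtain J where "x \<in> J" "ideal J R" using sub unfolding \<A>_def by blast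
          then show "x \<in> carrier (add_monoid R)" by (simp add: ideal.Icarr)
        qed
        show "\<one>\<^bsub>add_monoid R\<^esub> \<in> \<Union>\<C>"
        proof -
          have "ideal J0 R" using J0 sub unfolding \<A>_def by blast
          then have "\<zero> \<in> J0" by (intro additive_subgroup.zero_closed ideal.axioms(1))
          then show ?thesis using J0 by auto
        qed
        fix x assume "x \<in> \<Union>\<C>"
        then obtain J where J: "x \<in> J" "J \<in> \<C>" by auto
        then have "ideal J R" using sub by (auto simp: \<A>_def)
        then have "\<ominus> x \<in> J"
          using J by (intro additive_subgroup.a_inv_closed ideal.axioms(1))
        then show "inv\<^bsub>add_monoid R\<^esub> x \<in> \<Union>\<C>" using J by (auto simp: a_inv_def)
      next
        fix x y assume "x \<in> \<Union>\<C>" "y \<in> \<Union>\<C>"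
        \<comment> \<open>Of two members of a chain one contains the other, so both elements lie in
          a common ideal \<open>L\<close> and can be added there.\<close>
        then obtain J K where JK: "x \<in> J" "J \<in> \<C>" "y \<in> K" "K \<in> \<C>" by auto
        moreover from this have "J \<subseteq> K \<or> K \<subseteq> J" using chain by (simp add: subset_chain_def)
        ultimately obtain L where L: "x \<in> L" "y \<in> L" "L \<in> \<C>" by blast
        then have "ideal L R" using sub by (auto simp: \<A>_def)
        then have "x \<oplus> y \<in> L" using L by (intro additive_subgroup.a_closed ideal.axioms(1))
        then show "x \<otimes>\<^bsub>add_monoid R\<^esub> y \<in> \<Union>\<C>" using L by auto
      qed
    next
      fix a x assume "a \<in> \<Union>\<C>" and x: "x \<in> carrier R"
      then obtain J where J: "a \<in> J" "J \<in> \<C>" "ideal J R" using sub unfolding \<A>_def by blast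
      then show "x \<otimes> a \<in> \<Union>\<C>" "a \<otimes> x \<in> \<Union>\<C>"
        using x ideal.I_l_closed[OF J(3)] ideal.I_r_closed[OF J(3)] by blast+
    qed (rule ring_axioms)
    moreover have "I \<subseteq> \<Union>\<C>" using J0 sub by (auto simp: \<A>_def)
    moreover have "\<Union>\<C> \<noteq> carrier R" using one sub one_closed by blast
    ultimately show "\<Union>\<C> \<in> \<A>" by (simp add: \<A>_def)
  qed
  then obtain m where m: "m \<in> \<A>" "\<And>J. J \<in> \<A> \<Longrightarrow> m \<subseteq> J \<Longrightarrow> J = m" by blast
  have "maximalideal m R"
  proof (rule maximalidealI)
    fix J assume "ideal J R" "m \<subseteq> J" "J \<subseteq> carrier R"
    moreover have "I \<subseteq> J" using m(1) \<open>m \<subseteq> J\<close> by (auto simp: \<A>_def)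
    ultimately show "J = m \<or> J = carrier R" using m(2)[of J] by (auto simp: \<A>_def)
  qed (use m in \<open>auto simp: \<A>_def\<close>)
  then show thesis using that m by (auto simp: \<A>_def)
qed

lemma local_ring_cring: "local_ring R \<Longrightarrow> cring R"
  by (simp add: local_ring_def)

lemma max_ideal_maximalideal: "local_ring R \<Longrightarrow> maximalideal (max_ideal R) R"
  unfolding local_ring_def max_ideal_def by (rule theI') blast

lemma max_ideal_primeideal: "local_ring R \<Longrightarrow> primeideal (max_ideal R) R"
  by (simp add: cring.maximalideal_prime local_ring_cring max_ideal_maximalideal)

text \<open>A non-unit generates a proper principal ideal; some maximal ideal contains it, and there
  is only one.\<close>

lemma local_ring_Units:
  fixes R (structure)
  assumes "local_ring R" "a \<in> carrier R" "a \<notin> max_ideal R"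
  shows "a \<in> Units R"
proof (rule ccontr)
  interpret cring R by (rule local_ring_cring) fact
  assume a: "a \<notin> Units R"
  have aI: "a \<in> PIdl a" using assms by (simp add: cgenideal_self)
  have "\<one> \<notin> PIdl a"
  proof
    assume "\<one> \<in> PIdl a"
    then obtain b where "b \<in> carrier R" "b \<otimes> a = \<one>" by (auto simp: cgenideal_def)
    then show False using a assms(2) m_comm[of a b] by (auto simp: Units_def)
  qed
  then have "PIdl a \<noteq> carrier R" by auto
  then obtain m where "maximalideal m R" "PIdl a \<subseteq> m"
    using proper_ideal_subset_maximalideal cgenideal_ideal assms by metis
  moreover from this have "m = max_ideal R"
    using assms max_ideal_maximalideal unfolding local_ring_def by blast
  ultimately show False using aI assms by blast
qed

lemma max_ideal_iff_not_Units:
  assumes "local_ring R"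
  shows "a \<in> max_ideal R \<longleftrightarrow> a \<in> carrier R \<and> a \<notin> Units R"
proof -
  interpret maximalideal "max_ideal R" R by (rule max_ideal_maximalideal) fact
  interpret cring R by (rule local_ring_cring) fact
  show ?thesis
    using assms local_ring_Units ideal_eq_carrier_if_Units[OF is_ideal] Icarr I_notcarr by metis
qed

text \<open>If every element outside \<open>I\<close> is a unit, an ideal not contained in
  \<open>I\<close> is the whole ring. So \<open>I\<close> contains all proper ideals and is the only
  maximal one.\<close>

lemma local_ringI:
  assumes "cring R" "ideal I R" "I \<noteq> carrier R"
    and "\<And>a. \<lbrakk>a \<in> carrier R; a \<notin> I\<rbrakk> \<Longrightarrow> a \<in> Units R"
  shows "local_ring R" "max_ideal R = I"
proof -
  interpret cring R by fact
  have proper: "J \<subseteq> I" if "ideal J R" "J \<noteq> carrier R" for J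
    using ideal_eq_carrier_if_Units[OF that(1)] that(2) assms(4) ideal.Icarr[OF that(1)] by blast
  have max: "maximalideal I R"
    by (rule maximalidealI) (use assms(2,3) proper in blast)+
  moreover have uniq: "J = I" if "maximalideal J R" for J
  proof -
    interpret maximalideal J R by fact
    have "J \<subseteq> I" using proper[OF is_ideal] I_notcarr by auto
    moreover have "I \<subseteq> carrier R" using ideal.Icarr[OF assms(2)] by auto
    ultimately show ?thesis using I_maximal[OF assms(2)] assms(3) by auto
  qed
  ultimately show "local_ring R" unfolding local_ring_def using assms(1) by blast
  show "max_ideal R = I" unfolding max_ideal_def using max uniq by (rule the_equality)
qed

section \<open>Ideals under ring homomorphisms and under localization at a prime\<close>

lemma ideal_vimage:
  assumes "h \<in> ring_hom R S" "cring R" "cring S" "ideal I S"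
  shows "ideal {a \<in> carrier R. h a \<in> I} R"
proof -
  interpret ideal I S by fact
  interpret ring_hom_cring R S h
    using assms by (intro ring_hom_cring.intro ring_hom_cring_axioms.intro)
  show ?thesis
    by (intro idealI subgroup.intro)
      (auto simp: R.ring_axioms I_l_closed I_r_closed a_inv_def[symmetric])
qed

lemma (in primeideal) submonoid_complement: "submonoid (carrier R - I) R"
  by unfold_locales (use I_prime one_imp_carrier I_notcarr in auto)

lemma (in primeideal) fractions_complement: "fractions R (carrier R - I)"
  by (intro fractions.intro is_cring submonoid_complement)

text \<open>Multiplying by elements outside a prime does not change membership in it. Hence whether
  the numerator lies in \<open>I\<close> is a property of the fraction, not of the
  representative.\<close>

lemma (in primeideal) fraction_prime_iff:
  assumes "a \<in> carrier R" "b \<in> carrier R" "s \<in> carrier R - I" "t \<in> carrier R - I"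
    and "fraction R (carrier R - I) a s = fraction R (carrier R - I) b t"
  shows "a \<in> I \<longleftrightarrow> b \<in> I"
proof -
  interpret fractions R "carrier R - I" by (rule fractions_complement)
  obtain u where u: "u \<in> carrier R - I" "u \<otimes> (t \<otimes> a) = u \<otimes> (s \<otimes> b)"
    using assms by (auto simp: fraction_eq_iff)
  show ?thesis
  proof -
    have "v \<otimes> (w \<otimes> c) \<in> I \<longleftrightarrow> c \<in> I" if "v \<in> carrier R - I" "w \<in> carrier R - I" "c \<in> carrier R" for v w c
      using that I_prime[of v "w \<otimes> c"] I_prime[of w c] by (auto intro: I_l_closed)
    then show ?thesis using u assms by metis
  qed
qed

text \<open>This set is the extension of \<open>I\<close> to its own localization; it becomes the
  maximal ideal there.\<close>

lemma (in primeideal) ideal_fractions: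
  "ideal {fraction R (carrier R - I) a s | a s. a \<in> I \<and> s \<in> carrier R - I}
     (localization R (carrier R - I))"
proof -
  let ?S = "carrier R - I" 
  let ?L = "localization R ?S"
  interpret fractions R ?S by (rule fractions_complement)
  have 1: "A \<otimes>\<^bsub>?L\<^esub> B \<in> {fraction R ?S a s | a s. a \<in> I \<and> s \<in> ?S}"
    if A: "A \<in> carrier ?L" and B: "B \<in> {fraction R ?S a s | a s. a \<in> I \<and> s \<in> ?S}" for A B
  proof -
    obtain b t where b: "b \<in> carrier R" "t \<in> ?S" "A = fraction R ?S b t"
      by (rule localization_cases[OF A])
    obtain a s where a: "a \<in> I" "s \<in> ?S" "B = fraction R ?S a s" using B by blast
    have "A \<otimes>\<^bsub>?L\<^esub> B = fraction R ?S (b \<otimes> a) (t \<otimes> s)"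
      unfolding a b using a b Icarr by (intro fraction_mult)
    then show ?thesis using a b m_closed[of t s] by (blast intro: I_l_closed)
  qed
  show ?thesis
  proof (intro idealI loc.ring_axioms group.subgroupI)
    show "group (add_monoid ?L)" by (rule loc.a_group)
    show "{fraction R ?S a s |a s. a \<in> I \<and> s \<in> ?S} \<noteq> {}"
    proof -
      have "\<one> \<notin> I" using one_imp_carrier I_notcarr by blast
      then have "fraction R ?S \<zero> \<one> \<in> {fraction R ?S a s |a s. a \<in> I \<and> s \<in> ?S}"
        by (intro CollectI exI[of _ \<zero>] exI[of _ \<one>]) simp
      then show ?thesis by blast
    qed
    fix A assume A: "A \<in> {fraction R ?S a s |a s. a \<in> I \<and> s \<in> ?S}"
    then have Ac: "A \<in> carrier ?L" using Icarr by auto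
    \<comment> \<open>Negation is multiplication by minus one, so closure under it is a case of
      \<open>1\<close>.\<close>
    have "\<ominus>\<^bsub>?L\<^esub> A = (\<ominus>\<^bsub>?L\<^esub> \<one>\<^bsub>?L\<^esub>) \<otimes>\<^bsub>?L\<^esub> A"
      using Ac by (simp add: loc.l_minus)
    then have "\<ominus>\<^bsub>?L\<^esub> A \<in> {fraction R ?S a s |a s. a \<in> I \<and> s \<in> ?S}"
      using 1[OF _ A, of "\<ominus>\<^bsub>?L\<^esub> \<one>\<^bsub>?L\<^esub>"] by simp
    then show "inv\<^bsub>add_monoid ?L\<^esub> A \<in> {fraction R ?S a s |a s. a \<in> I \<and> s \<in> ?S}"
      by (simp add: a_inv_def)
    fix B assume "B \<in> {fraction R ?S a s |a s. a \<in> I \<and> s \<in> ?S}"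
    then obtain b t where b: "b \<in> I" "t \<in> ?S" "B = fraction R ?S b t" by blast
    obtain a s where a: "a \<in> I" "s \<in> ?S" "A = fraction R ?S a s" using A by blast
    have "A \<oplus>\<^bsub>?L\<^esub> B = fraction R ?S (t \<otimes> a \<oplus> s \<otimes> b) (s \<otimes> t)"
      unfolding a b using a b Icarr by (intro fraction_add)
    moreover have "t \<otimes> a \<oplus> s \<otimes> b \<in> I" "s \<otimes> t \<in> ?S"
      using a b m_closed[of s t] by (auto intro!: a_closed I_l_closed)
    ultimately show "A \<otimes>\<^bsub>add_monoid ?L\<^esub> B \<in> {fraction R ?S a s |a s. a \<in> I \<and> s \<in> ?S}"
      by auto
  next
    fix A B assume A: "A \<in> {fraction R ?S a s |a s. a \<in> I \<and> s \<in> ?S}" and B: "B \<in> carrier ?L"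
    then have "A \<in> carrier ?L" using Icarr by auto
    then have "A \<otimes>\<^bsub>?L\<^esub> B = B \<otimes>\<^bsub>?L\<^esub> A" using B by (rule loc.m_comm)
    then show "B \<otimes>\<^bsub>?L\<^esub> A \<in> {fraction R ?S a s |a s. a \<in> I \<and> s \<in> ?S}"
      "A \<otimes>\<^bsub>?L\<^esub> B \<in> {fraction R ?S a s |a s. a \<in> I \<and> s \<in> ?S}"
      using 1[OF B A] by simp_all
  qed (use Icarr in auto)
qed

lemma ring_hom_pow:
  assumes "h \<in> ring_hom R S" "ring R" "a \<in> carrier R"
  shows "h (a [^]\<^bsub>R\<^esub> (n::nat)) = h a [^]\<^bsub>S\<^esub> n"
proof -
  interpret ring R by fact
  show ?thesis
    using assms(1,3) by (induction n) (simp_all add: ring_hom_one ring_hom_mult)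
qed

section \<open>Stalks\<close>

context ringed_space
begin

lemma restriction_closed:
  "\<lbrakk>openin (Top X) U; openin (Top X) V; V \<subseteq> U; s \<in> carrier (Sec X U)\<rbrakk>
    \<Longrightarrow> Res X U V s \<in> carrier (Sec X V)"
  by (rule ring_hom_closed[OF restriction_hom])

lemma mem_germ_iff:
  "(V, t) \<in> germ X x U s \<longleftrightarrow> openin (Top X) V \<and> x \<in> V \<and> t \<in> carrier (Sec X V) \<and>
     (\<exists>W. openin (Top X) W \<and> x \<in> W \<and> W \<subseteq> U \<inter> V \<and> Res X U W s = Res X V W t)"
  by (simp add: germ_def)

lemma germ_self:
  "\<lbrakk>openin (Top X) U; x \<in> U; s \<in> carrier (Sec X U)\<rbrakk> \<Longrightarrow> (U, s) \<in> germ X x U s"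
  by (auto simp: mem_germ_iff)

text \<open>Equality near \<open>x\<close> is transitive: two neighbourhoods of agreement are
  intersected. This gives one inclusion between the classes, and symmetry the other.\<close>

lemma germ_eqI:
  assumes "openin (Top X) U" "s \<in> carrier (Sec X U)" "openin (Top X) V" "t \<in> carrier (Sec X V)"
    and "openin (Top X) W" "x \<in> W" "W \<subseteq> U \<inter> V" "Res X U W s = Res X V W t"
  shows "germ X x U s = germ X x V t"
proof -
  have *: "germ X x V t \<subseteq> germ X x U s"
    if A: "openin (Top X) U" "s \<in> carrier (Sec X U)" "openin (Top X) V" "t \<in> carrier (Sec X V)"
      "openin (Top X) W" "x \<in> W" "W \<subseteq> U \<inter> V" and eq: "Res X U W s = Res X V W t" for U s V t
  proof (clarsimp simp: mem_germ_iff)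
    fix V' t' W'
    assume B: "openin (Top X) V'" "x \<in> V'" "t' \<in> carrier (Sec X V')" "openin (Top X) W'"
      "x \<in> W'" "W' \<subseteq> V" "W' \<subseteq> V'" and eq': "Res X V W' t = Res X V' W' t'"
    have o: "openin (Top X) (W \<inter> W')" using A B by auto
    have "Res X U (W \<inter> W') s = Res X W (W \<inter> W') (Res X U W s)"
      using A B o by (intro restriction_trans[symmetric]) auto
    also have "\<dots> = Res X V (W \<inter> W') t"
      unfolding eq using A B o by (intro restriction_trans) auto
    also have "\<dots> = Res X W' (W \<inter> W') (Res X V W' t)"
      using A B o by (intro restriction_trans[symmetric]) auto
    also have "\<dots> = Res X V' (W \<inter> W') t'"
      unfolding eq' using A B o by (intro restriction_trans) auto
    finally show "\<exists>W. openin (Top X) W \<and> x \<in> W \<and> W \<subseteq> U \<and> W \<subseteq> V' \<and> Res X U W s = Res X V' W t'"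
      using A B o by (intro exI[of _ "W \<inter> W'"]) auto
  qed
  show ?thesis
    using *[of U s V t] *[of V t U s] assms by auto
qed

lemma germ_eq_iff:
  assumes "openin (Top X) U" "x \<in> U" "s \<in> carrier (Sec X U)"
    and "openin (Top X) V" "x \<in> V" "t \<in> carrier (Sec X V)"
  shows "germ X x U s = germ X x V t \<longleftrightarrow>
    (\<exists>W. openin (Top X) W \<and> x \<in> W \<and> W \<subseteq> U \<inter> V \<and> Res X U W s = Res X V W t)"
proof
  assume "germ X x U s = germ X x V t"
  then have "(V, t) \<in> germ X x U s" using assms germ_self by auto
  then show "\<exists>W. openin (Top X) W \<and> x \<in> W \<and> W \<subseteq> U \<inter> V \<and> Res X U W s = Res X V W t"
    by (simp add: mem_germ_iff)
qed (use assms germ_eqI in blast)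

lemma mem_germD:
  assumes "(V, t) \<in> germ X x U s" "openin (Top X) U" "s \<in> carrier (Sec X U)"
  shows "openin (Top X) V" "x \<in> V" "t \<in> carrier (Sec X V)" "germ X x V t = germ X x U s"
proof -
  show *: "openin (Top X) V" "x \<in> V" "t \<in> carrier (Sec X V)"
    using assms by (auto simp: mem_germ_iff)
  obtain W where "openin (Top X) W" "x \<in> W" "W \<subseteq> U \<inter> V" "Res X U W s = Res X V W t"
    using assms by (auto simp: mem_germ_iff)
  then show "germ X x V t = germ X x U s"
    using assms * by (intro germ_eqI[symmetric])
qed

lemma germ_restriction:
  assumes "openin (Top X) U" "openin (Top X) V" "V \<subseteq> U" "x \<in> V" "s \<in> carrier (Sec X U)"
  shows "germ X x V (Res X U V s) = germ X x U s"
  using assms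
  by (intro germ_eqI[where W = V]) (auto simp: restriction_closed restriction_id)

lemma germ_in_carrier [simp]:
  "\<lbrakk>openin (Top X) U; x \<in> U; s \<in> carrier (Sec X U)\<rbrakk> \<Longrightarrow> germ X x U s \<in> carrier (stalk X x)"
  by (auto simp: stalk_def)

lemma stalk_cases:
  assumes "A \<in> carrier (stalk X x)"
  obtains U s where "openin (Top X) U" "x \<in> U" "s \<in> carrier (Sec X U)" "A = germ X x U s"
  using assms by (auto simp: stalk_def)

text \<open>Restriction to an intersection represents two germs on one open set, so that a ring law
  in the stalk is the same law in a ring of sections.\<close>

lemma stalk_cases2:
  assumes "A \<in> carrier (stalk X x)" "B \<in> carrier (stalk X x)"
  obtains U s t where "openin (Top X) U" "x \<in> U" "s \<in> carrier (Sec X U)" "t \<in> carrier (Sec X U)"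
    "A = germ X x U s" "B = germ X x U t"
proof -
  obtain U s where U: "openin (Top X) U" "x \<in> U" "s \<in> carrier (Sec X U)" "A = germ X x U s"
    by (rule stalk_cases[OF assms(1)])
  obtain V t where V: "openin (Top X) V" "x \<in> V" "t \<in> carrier (Sec X V)" "B = germ X x V t"
    by (rule stalk_cases[OF assms(2)])
  show thesis
    by (rule that[of "U \<inter> V" "Res X U (U \<inter> V) s" "Res X V (U \<inter> V) t"])
      (use U V in \<open>auto simp: openin_Int restriction_closed germ_restriction\<close>)
qed

lemma stalk_cases3:
  assumes "A \<in> carrier (stalk X x)" "B \<in> carrier (stalk X x)" "C \<in> carrier (stalk X x)"
  obtains U s t u where "openin (Top X) U" "x \<in> U"
    "s \<in> carrier (Sec X U)" "t \<in> carrier (Sec X U)" "u \<in> carrier (Sec X U)"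
    "A = germ X x U s" "B = germ X x U t" "C = germ X x U u"
proof -
  obtain U s t where U: "openin (Top X) U" "x \<in> U" "s \<in> carrier (Sec X U)" "t \<in> carrier (Sec X U)"
    "A = germ X x U s" "B = germ X x U t"
    by (rule stalk_cases2[OF assms(1,2)])
  obtain V u where V: "openin (Top X) V" "x \<in> V" "u \<in> carrier (Sec X V)" "C = germ X x V u"
    by (rule stalk_cases[OF assms(3)])
  show thesis
    by (rule that[of "U \<inter> V" "Res X U (U \<inter> V) s" "Res X U (U \<inter> V) t" "Res X V (U \<inter> V) u"])
      (use U V in \<open>auto simp: openin_Int restriction_closed germ_restriction\<close>)
qed

text \<open>\<open>F\<close> stands for a binary operation on sections that commutes with
  restriction; addition and multiplication are both instances. Commuting with restriction is what
  makes the germ of the result independent of the representatives.\<close>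

lemma UN_germ_germ:
  assumes closed: "\<And>U s t. \<lbrakk>openin (Top X) U; s \<in> carrier (Sec X U); t \<in> carrier (Sec X U)\<rbrakk>
      \<Longrightarrow> F U s t \<in> carrier (Sec X U)"
    and res: "\<And>U V s t. \<lbrakk>openin (Top X) U; openin (Top X) V; V \<subseteq> U; s \<in> carrier (Sec X U);
      t \<in> carrier (Sec X U)\<rbrakk> \<Longrightarrow> Res X U V (F U s t) = F V (Res X U V s) (Res X U V t)"
    and U: "openin (Top X) U" "x \<in> U" "s \<in> carrier (Sec X U)" "t \<in> carrier (Sec X U)"
  shows "(\<Union>(V, a)\<in>germ X x U s. \<Union>(W, b)\<in>germ X x U t.
      germ X x (V \<inter> W) (F (V \<inter> W) (Res X V (V \<inter> W) a) (Res X W (V \<inter> W) b))) = germ X x U (F U s t)"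
proof -
  have *: "germ X x (V \<inter> W) (F (V \<inter> W) (Res X V (V \<inter> W) a) (Res X W (V \<inter> W) b)) = germ X x U (F U s t)"
    if a: "(V, a) \<in> germ X x U s" and b: "(W, b) \<in> germ X x U t" for V a W b
  proof -
    note V = mem_germD[OF a U(1,3)] and W = mem_germD[OF b U(1,4)]
    obtain V' where V': "openin (Top X) V'" "x \<in> V'" "V' \<subseteq> U \<inter> V" "Res X U V' s = Res X V V' a"
      using a by (auto simp: mem_germ_iff)
    obtain W' where W': "openin (Top X) W'" "x \<in> W'" "W' \<subseteq> U \<inter> W" "Res X U W' t = Res X W W' b"
      using b by (auto simp: mem_germ_iff)
    \<comment> \<open>On \<open>Q\<close> both pairs of representatives agree at the same time, so
      both candidates for the result restrict to the same section.\<close>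
    define Q where "Q = V' \<inter> W'"
    have Q: "openin (Top X) Q" "x \<in> Q" "Q \<subseteq> U" "Q \<subseteq> V \<inter> W" "Q \<subseteq> V'" "Q \<subseteq> W'"
      using V' W' by (auto simp: Q_def)
    have "Res X U Q s = Res X V' Q (Res X U V' s)"
      using U V' Q by (intro restriction_trans[symmetric]) auto
    also have "\<dots> = Res X V Q a"
      unfolding V'(4) using V V' Q by (intro restriction_trans) auto
    finally have s: "Res X U Q s = Res X V Q a" .
    have "Res X U Q t = Res X W' Q (Res X U W' t)"
      using U W' Q by (intro restriction_trans[symmetric]) auto
    also have "\<dots> = Res X W Q b"
      unfolding W'(4) using W W' Q by (intro restriction_trans) auto
    finally have t: "Res X U Q t = Res X W Q b" .
    have c: "Res X V (V \<inter> W) a \<in> carrier (Sec X (V \<inter> W))" "Res X W (V \<inter> W) b \<in> carrier (Sec X (V \<inter> W))"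
      using V W by (auto intro!: restriction_closed)
    have "Res X (V \<inter> W) Q (F (V \<inter> W) (Res X V (V \<inter> W) a) (Res X W (V \<inter> W) b)) =
        F Q (Res X (V \<inter> W) Q (Res X V (V \<inter> W) a)) (Res X (V \<inter> W) Q (Res X W (V \<inter> W) b))"
      using V W Q c by (intro res) auto
    also have "\<dots> = F Q (Res X V Q a) (Res X W Q b)"
      using V W Q by (subst (1 2) restriction_trans) auto
    also have "\<dots> = Res X U Q (F U s t)"
      using U Q by (simp add: res s t)
    finally show ?thesis
      using U V W Q c by (intro germ_eqI[where W = Q]) (auto intro: closed)
  qed
  show ?thesis
  proof (intro equalityI subsetI)
    fix y assume "y \<in> germ X x U (F U s t)"
    then have "y \<in> germ X x (U \<inter> U) (F (U \<inter> U) (Res X U (U \<inter> U) s) (Res X U (U \<inter> U) t))"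
      using *[OF germ_self[OF U(1,2,3)] germ_self[OF U(1,2,4)]] by simp
    then show "y \<in> (\<Union>(V, a)\<in>germ X x U s. \<Union>(W, b)\<in>germ X x U t.
      germ X x (V \<inter> W) (F (V \<inter> W) (Res X V (V \<inter> W) a) (Res X W (V \<inter> W) b)))"
      using germ_self[OF U(1,2,3)] germ_self[OF U(1,2,4)] by blast
  qed (use * in auto)
qed

lemma stalk_mult:
  assumes "openin (Top X) U" "x \<in> U" "s \<in> carrier (Sec X U)" "t \<in> carrier (Sec X U)"
  shows "germ X x U s \<otimes>\<^bsub>stalk X x\<^esub> germ X x U t = germ X x U (s \<otimes>\<^bsub>Sec X U\<^esub> t)"
  unfolding stalk_def monoid.simps
  using sections_cring restriction_hom
  by (intro UN_germ_germ assms) (auto simp: ring_hom_mult intro: monoid.m_closed cring.axioms ring.is_monoid)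

lemma stalk_add:
  assumes "openin (Top X) U" "x \<in> U" "s \<in> carrier (Sec X U)" "t \<in> carrier (Sec X U)"
  shows "germ X x U s \<oplus>\<^bsub>stalk X x\<^esub> germ X x U t = germ X x U (s \<oplus>\<^bsub>Sec X U\<^esub> t)"
  unfolding stalk_def ring.simps
  using sections_cring restriction_hom
  by (intro UN_germ_germ assms) (auto simp: ring_hom_add intro: cring.cring_simprules(1))

lemma stalk_one:
  assumes "openin (Top X) U" "x \<in> U"
  shows "\<one>\<^bsub>stalk X x\<^esub> = germ X x U \<one>\<^bsub>Sec X U\<^esub>"
proof -
  have U: "U \<subseteq> points X" using assms by (simp add: openin_subset)
  then have "germ X x (points X) \<one>\<^bsub>Sec X (points X)\<^esub> = germ X x U (Res X (points X) U \<one>\<^bsub>Sec X (points X)\<^esub>)"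
    using assms sections_cring by (intro germ_restriction[symmetric]) (auto intro: cring.cring_simprules)
  then show ?thesis
    using assms U by (simp add: stalk_def ring_hom_one[OF restriction_hom])
qed

lemma stalk_zero:
  assumes "openin (Top X) U" "x \<in> U"
  shows "\<zero>\<^bsub>stalk X x\<^esub> = germ X x U \<zero>\<^bsub>Sec X U\<^esub>"
proof -
  have U: "U \<subseteq> points X" using assms by (simp add: openin_subset)
  then have "germ X x (points X) \<zero>\<^bsub>Sec X (points X)\<^esub> = germ X x U (Res X (points X) U \<zero>\<^bsub>Sec X (points X)\<^esub>)"
    using assms sections_cring by (intro germ_restriction[symmetric]) (auto intro: cring.cring_simprules)
  then show ?thesis
    using assms U sections_cring
    by (simp add: stalk_def ring_hom_zero[OF restriction_hom] cring.axioms)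
qed

lemma cring_stalk:
  assumes x: "x \<in> points X"
  shows "cring (stalk X x)"
proof (intro cringI abelian_groupI comm_monoidI)
  have p: "openin (Top X) (points X)" by simp
  interpret P: cring "Sec X (points X)" by (rule sections_cring[OF p])
  show "\<zero>\<^bsub>stalk X x\<^esub> \<in> carrier (stalk X x)" "\<one>\<^bsub>stalk X x\<^esub> \<in> carrier (stalk X x)"
    by (simp_all add: stalk_zero[OF p x] stalk_one[OF p x] x)
next
  fix A B assume "A \<in> carrier (stalk X x)" "B \<in> carrier (stalk X x)"
  then obtain U s t where U: "openin (Top X) U" "x \<in> U" "s \<in> carrier (Sec X U)" "t \<in> carrier (Sec X U)"
    "A = germ X x U s" "B = germ X x U t"
    by (rule stalk_cases2)
  interpret U: cring "Sec X U" by (rule sections_cring[OF U(1)])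
  show "A \<oplus>\<^bsub>stalk X x\<^esub> B \<in> carrier (stalk X x)" "A \<otimes>\<^bsub>stalk X x\<^esub> B \<in> carrier (stalk X x)"
    "A \<oplus>\<^bsub>stalk X x\<^esub> B = B \<oplus>\<^bsub>stalk X x\<^esub> A" "A \<otimes>\<^bsub>stalk X x\<^esub> B = B \<otimes>\<^bsub>stalk X x\<^esub> A"
    using U by (simp_all add: stalk_mult stalk_add U.a_comm U.m_comm)
next
  fix A B C assume "A \<in> carrier (stalk X x)" "B \<in> carrier (stalk X x)" "C \<in> carrier (stalk X x)"
  then obtain U s t u where U: "openin (Top X) U" "x \<in> U"
    "s \<in> carrier (Sec X U)" "t \<in> carrier (Sec X U)" "u \<in> carrier (Sec X U)"
    "A = germ X x U s" "B = germ X x U t" "C = germ X x U u"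
    by (rule stalk_cases3)
  interpret U: cring "Sec X U" by (rule sections_cring[OF U(1)])
  show "A \<oplus>\<^bsub>stalk X x\<^esub> B \<oplus>\<^bsub>stalk X x\<^esub> C = A \<oplus>\<^bsub>stalk X x\<^esub> (B \<oplus>\<^bsub>stalk X x\<^esub> C)"
    "A \<otimes>\<^bsub>stalk X x\<^esub> B \<otimes>\<^bsub>stalk X x\<^esub> C = A \<otimes>\<^bsub>stalk X x\<^esub> (B \<otimes>\<^bsub>stalk X x\<^esub> C)"
    "(A \<oplus>\<^bsub>stalk X x\<^esub> B) \<otimes>\<^bsub>stalk X x\<^esub> C = A \<otimes>\<^bsub>stalk X x\<^esub> C \<oplus>\<^bsub>stalk X x\<^esub> B \<otimes>\<^bsub>stalk X x\<^esub> C"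
    using U by (simp_all add: stalk_mult stalk_add U.a_assoc U.m_assoc U.l_distr)
next
  fix A assume "A \<in> carrier (stalk X x)"
  then obtain U s where U: "openin (Top X) U" "x \<in> U" "s \<in> carrier (Sec X U)" "A = germ X x U s"
    by (rule stalk_cases)
  interpret U: cring "Sec X U" by (rule sections_cring[OF U(1)])
  show "\<zero>\<^bsub>stalk X x\<^esub> \<oplus>\<^bsub>stalk X x\<^esub> A = A" "\<one>\<^bsub>stalk X x\<^esub> \<otimes>\<^bsub>stalk X x\<^esub> A = A"
    using U by (simp_all add: stalk_mult stalk_add stalk_one[OF U(1,2)] stalk_zero[OF U(1,2)])
  have "germ X x U (\<ominus>\<^bsub>Sec X U\<^esub> s) \<oplus>\<^bsub>stalk X x\<^esub> A = \<zero>\<^bsub>stalk X x\<^esub>"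
    using U by (simp add: stalk_add stalk_zero[OF U(1,2)] U.l_neg)
  then show "\<exists>B\<in>carrier (stalk X x). B \<oplus>\<^bsub>stalk X x\<^esub> A = \<zero>\<^bsub>stalk X x\<^esub>"
    using U by (meson U.a_inv_closed germ_in_carrier)
qed

lemma germ_hom:
  assumes "openin (Top X) U" "x \<in> U"
  shows "germ X x U \<in> ring_hom (Sec X U) (stalk X x)"
  using assms by (intro ring_hom_memI) (simp_all add: stalk_mult stalk_add stalk_one)

text \<open>The domain shrinks twice: to \<open>Q\<close>, where the element and a representative of
  its inverse are both defined, and to \<open>W\<close>, where their product is one and not merely
  has the germ one at \<open>x\<close>.\<close>

lemma germ_Units:
  assumes "openin (Top X) U" "x \<in> U" "s \<in> carrier (Sec X U)" "germ X x U s \<in> Units (stalk X x)"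
  obtains W r where "openin (Top X) W" "x \<in> W" "W \<subseteq> U" "r \<in> carrier (Sec X W)"
    "r \<otimes>\<^bsub>Sec X W\<^esub> Res X U W s = \<one>\<^bsub>Sec X W\<^esub>"
proof -
  have x: "x \<in> points X" using assms openin_subset by blast
  obtain B where B: "B \<in> carrier (stalk X x)" "B \<otimes>\<^bsub>stalk X x\<^esub> germ X x U s = \<one>\<^bsub>stalk X x\<^esub>"
    using assms(4) by (auto simp: Units_def)
  obtain V b where V: "openin (Top X) V" "x \<in> V" "b \<in> carrier (Sec X V)" "B = germ X x V b"
    by (rule stalk_cases[OF B(1)])
  define Q where "Q = U \<inter> V"
  have Q: "openin (Top X) Q" "x \<in> Q" "Q \<subseteq> U" "Q \<subseteq> V" using assms V by (auto simp: Q_def)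
  interpret Q: cring "Sec X Q" by (rule sections_cring[OF Q(1)])
  let ?s = "Res X U Q s" and ?b = "Res X V Q b"
  have c: "?s \<in> carrier (Sec X Q)" "?b \<in> carrier (Sec X Q)"
    using assms V Q by (auto intro: restriction_closed)
  have "germ X x Q (?b \<otimes>\<^bsub>Sec X Q\<^esub> ?s) = germ X x Q \<one>\<^bsub>Sec X Q\<^esub>"
    using assms V Q B c by (simp add: germ_restriction flip: stalk_mult stalk_one)
  then obtain W where W: "openin (Top X) W" "x \<in> W" "W \<subseteq> Q"
    "Res X Q W (?b \<otimes>\<^bsub>Sec X Q\<^esub> ?s) = Res X Q W \<one>\<^bsub>Sec X Q\<^esub>"
    using Q c by (subst (asm) germ_eq_iff) auto
  note h = restriction_hom[OF Q(1) W(1,3)]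
  have "Res X Q W ?b \<otimes>\<^bsub>Sec X W\<^esub> Res X Q W ?s = \<one>\<^bsub>Sec X W\<^esub>"
    using W(4) c by (simp add: ring_hom_mult[OF h] ring_hom_one[OF h])
  moreover have "Res X Q W ?s = Res X U W s"
    using assms Q W by (intro restriction_trans)
  ultimately show thesis
    using that[of W "Res X Q W ?b"] W Q c ring_hom_closed[OF h] by auto
qed

text \<open>Equal germs at \<open>x\<close> mean equal restrictions near \<open>x\<close>. The open
  sets on which \<open>s\<close> and \<open>t\<close> agree therefore cover \<open>U\<close>, and
  separatedness applies to this cover.\<close>

lemma sections_eqI:
  assumes "openin (Top X) U" "s \<in> carrier (Sec X U)" "t \<in> carrier (Sec X U)"
    and "\<And>x. x \<in> U \<Longrightarrow> germ X x U s = germ X x U t"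
  shows "s = t"
proof -
  define \<U> where "\<U> = {W. openin (Top X) W \<and> W \<subseteq> U \<and> Res X U W s = Res X U W t}"
  have "U \<subseteq> \<Union>\<U>"
  proof
    fix x assume "x \<in> U"
    then have "\<exists>W. openin (Top X) W \<and> x \<in> W \<and> W \<subseteq> U \<inter> U \<and> Res X U W s = Res X U W t"
      using assms(1-3) assms(4)[of x] by (simp only: germ_eq_iff)
    then show "x \<in> \<Union>\<U>" by (auto simp: \<U>_def)
  qed
  then have "\<Union>\<U> = U" by (auto simp: \<U>_def)
  then show ?thesis
    using separated[of \<U> s t] assms by (auto simp: \<U>_def)
qed

text \<open>Two local sections with the prescribed germs agree on the overlap by
  \<open>sections_eqI\<close>, so gluing applies to the cover by all open sets that carry such a
  section.\<close>

lemma section_of_germs: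
  assumes "openin (Top X) U"
    and local: "\<And>x. x \<in> U \<Longrightarrow> \<exists>W s. openin (Top X) W \<and> x \<in> W \<and> W \<subseteq> U \<and> s \<in> carrier (Sec X W) \<and>
      (\<forall>y\<in>W. germ X y W s = \<phi> y)"
  obtains s where "s \<in> carrier (Sec X U)" "\<And>x. x \<in> U \<Longrightarrow> germ X x U s = \<phi> x"
proof -
  define \<U> where "\<U> = {W. openin (Top X) W \<and> W \<subseteq> U \<and> (\<exists>s\<in>carrier (Sec X W). \<forall>y\<in>W. germ X y W s = \<phi> y)}"
  \<comment> \<open>The choice is harmless: on each \<open>W\<close> the germs determine the
    section.\<close>
  define \<sigma> where "\<sigma> W = (SOME s. s \<in> carrier (Sec X W) \<and> (\<forall>y\<in>W. germ X y W s = \<phi> y))" for W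
  have "x \<in> \<Union>\<U>" if x: "x \<in> U" for x
  proof -
    obtain W s where "openin (Top X) W" "x \<in> W" "W \<subseteq> U" "s \<in> carrier (Sec X W)"
      "\<forall>y\<in>W. germ X y W s = \<phi> y"
      using local[OF x] by (elim exE conjE)
    then show ?thesis by (auto simp: \<U>_def)
  qed
  then have \<U>: "\<Union>\<U> = U" by (auto simp: \<U>_def)
  have \<sigma>: "\<sigma> W \<in> carrier (Sec X W) \<and> (\<forall>y\<in>W. germ X y W (\<sigma> W) = \<phi> y)" if W: "W \<in> \<U>" for W
  proof -
    obtain s where "s \<in> carrier (Sec X W) \<and> (\<forall>y\<in>W. germ X y W s = \<phi> y)"
      using W unfolding \<U>_def by blast
    then show ?thesis unfolding \<sigma>_def by (rule someI)
  qed
  have o: "openin (Top X) W" if "W \<in> \<U>" for W using that by (simp add: \<U>_def)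
  have "Res X V (V \<inter> W) (\<sigma> V) = Res X W (V \<inter> W) (\<sigma> W)" if "V \<in> \<U>" "W \<in> \<U>" for V W
    using o[OF that(1)] o[OF that(2)] \<sigma>[OF that(1)] \<sigma>[OF that(2)]
    by (intro sections_eqI[of "V \<inter> W"]) (auto simp: openin_Int restriction_closed germ_restriction)
  then obtain s where s: "s \<in> carrier (Sec X U)" "\<And>W. W \<in> \<U> \<Longrightarrow> Res X U W s = \<sigma> W"
    using gluing[of \<U> \<sigma>] o \<sigma> unfolding \<U> by blast
  have "germ X x U s = \<phi> x" if x: "x \<in> U" for x
  proof -
    obtain W where W: "W \<in> \<U>" "x \<in> W" using x \<U> by auto
    have "germ X x U s = germ X x W (Res X U W s)"
      using assms W o s(1) \<U> by (intro germ_restriction[symmetric]) auto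
    then show ?thesis using \<sigma>[OF W(1)] s(2)[OF W(1)] W(2) by simp
  qed
  with s(1) show thesis by (rule that)
qed

end

section \<open>Morphisms of ringed spaces\<close>

locale rs_morphism = source: ringed_space X + target: ringed_space Y
  for X :: "('a, 'r) rspace" and Y :: "('b, 's) rspace" +
  fixes f :: "('a, 'r, 'b, 's) rs_map"
  assumes rs_hom: "f \<in> rs_hom X Y"
begin

lemma pt_closed: "x \<in> points X \<Longrightarrow> pt f x \<in> points Y"
  using rs_hom continuous_map_image_subset_topspace[of "Top X" "Top Y" "pt f"]
  by (auto simp: rs_hom_def)

lemma openin_preim: "openin (Top Y) V \<Longrightarrow> openin (Top X) (preim X f V)"
  using rs_hom openin_continuous_map_preimage[of "Top X" "Top Y" "pt f" V]
  by (simp add: rs_hom_def preim_def)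

lemma sharp_hom: "openin (Top Y) V \<Longrightarrow> sharp f V \<in> ring_hom (Sec Y V) (Sec X (preim X f V))"
  using rs_hom by (simp add: rs_hom_def)

lemma sharp_closed:
  "\<lbrakk>openin (Top Y) V; s \<in> carrier (Sec Y V)\<rbrakk> \<Longrightarrow> sharp f V s \<in> carrier (Sec X (preim X f V))"
  by (rule ring_hom_closed[OF sharp_hom])

lemma sharp_restriction:
  "\<lbrakk>openin (Top Y) V; openin (Top Y) W; W \<subseteq> V; s \<in> carrier (Sec Y V)\<rbrakk>
    \<Longrightarrow> sharp f W (Res Y V W s) = Res X (preim X f V) (preim X f W) (sharp f V s)"
  using rs_hom by (simp add: rs_hom_def)

text \<open>Compatibility of \<open>sharp\<close> with restriction makes all representatives
  contribute the same germ, so the union defining \<open>stalk_map\<close> collapses to any one of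
  them.\<close>

lemma stalk_map_germ:
  assumes x: "x \<in> points X" and V: "openin (Top Y) V" "pt f x \<in> V" "s \<in> carrier (Sec Y V)"
  shows "stalk_map X f x (germ Y (pt f x) V s) = germ X x (preim X f V) (sharp f V s)"
proof -
  have *: "germ X x (preim X f W) (sharp f W t) = germ X x (preim X f V) (sharp f V s)"
    if a: "(W, t) \<in> germ Y (pt f x) V s" for W t
  proof -
    note W = target.mem_germD[OF a V(1,3)]
    obtain Q where Q: "openin (Top Y) Q" "pt f x \<in> Q" "Q \<subseteq> V" "Q \<subseteq> W" "Res Y V Q s = Res Y W Q t"
      using a by (auto simp: target.mem_germ_iff)
    have p: "x \<in> preim X f Q" "preim X f Q \<subseteq> preim X f V \<inter> preim X f W"
      using Q x by (auto simp: preim_def)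
    show ?thesis
    proof (rule source.germ_eqI[OF _ _ _ _ _ p(1)])
      show "preim X f Q \<subseteq> preim X f W \<inter> preim X f V" using p by auto
      show "Res X (preim X f W) (preim X f Q) (sharp f W t) =
          Res X (preim X f V) (preim X f Q) (sharp f V s)"
        using Q V W by (simp flip: sharp_restriction)
    qed (use V W Q openin_preim sharp_closed in auto)
  qed
  show ?thesis
  proof (rule equalityI)
    show "stalk_map X f x (germ Y (pt f x) V s) \<subseteq> germ X x (preim X f V) (sharp f V s)"
      unfolding stalk_map_def using * by blast
    show "germ X x (preim X f V) (sharp f V s) \<subseteq> stalk_map X f x (germ Y (pt f x) V s)"
      unfolding stalk_map_def using target.germ_self[OF V] by blast
  qed
qed

lemma stalk_map_hom:
  assumes x: "x \<in> points X"
  shows "stalk_map X f x \<in> ring_hom (stalk Y (pt f x)) (stalk X x)"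
proof (rule ring_hom_memI)
  have preim: "x \<in> preim X f V \<longleftrightarrow> pt f x \<in> V" for V using x by (simp add: preim_def)
  show "stalk_map X f x A \<in> carrier (stalk X x)" if A: "A \<in> carrier (stalk Y (pt f x))" for A
    by (rule target.stalk_cases[OF A])
      (simp add: stalk_map_germ[OF x] openin_preim sharp_closed preim)
  show "stalk_map X f x (A \<otimes>\<^bsub>stalk Y (pt f x)\<^esub> B) =
      stalk_map X f x A \<otimes>\<^bsub>stalk X x\<^esub> stalk_map X f x B"
    and "stalk_map X f x (A \<oplus>\<^bsub>stalk Y (pt f x)\<^esub> B) =
      stalk_map X f x A \<oplus>\<^bsub>stalk X x\<^esub> stalk_map X f x B"
    if AB: "A \<in> carrier (stalk Y (pt f x))" "B \<in> carrier (stalk Y (pt f x))" for A B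
  proof -
    obtain V s t where V: "openin (Top Y) V" "pt f x \<in> V" "s \<in> carrier (Sec Y V)"
      "t \<in> carrier (Sec Y V)" "A = germ Y (pt f x) V s" "B = germ Y (pt f x) V t"
      using AB by (rule target.stalk_cases2)
    interpret V: cring "Sec Y V" by (rule target.sections_cring[OF V(1)])
    show "stalk_map X f x (A \<otimes>\<^bsub>stalk Y (pt f x)\<^esub> B) =
        stalk_map X f x A \<otimes>\<^bsub>stalk X x\<^esub> stalk_map X f x B"
      and "stalk_map X f x (A \<oplus>\<^bsub>stalk Y (pt f x)\<^esub> B) =
        stalk_map X f x A \<oplus>\<^bsub>stalk X x\<^esub> stalk_map X f x B"
      using V by (simp_all add: stalk_map_germ[OF x] target.stalk_mult target.stalk_add
        source.stalk_mult source.stalk_add openin_preim sharp_closed preim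
        ring_hom_mult[OF sharp_hom] ring_hom_add[OF sharp_hom])
  qed
  show "stalk_map X f x \<one>\<^bsub>stalk Y (pt f x)\<^esub> = \<one>\<^bsub>stalk X x\<^esub>"
  proof -
    have p: "openin (Top Y) (points Y)" "pt f x \<in> points Y" using x pt_closed by auto
    interpret V: cring "Sec Y (points Y)" by (rule target.sections_cring[OF p(1)])
    have x': "x \<in> preim X f (points Y)" using p by (simp add: preim)
    then show ?thesis
      using p by (simp add: stalk_map_germ[OF x] target.stalk_one[OF p] ring_hom_one[OF sharp_hom]
        source.stalk_one[OF openin_preim[OF p(1)] x'])
  qed
qed

lemma stalk_map_closed:
  "\<lbrakk>x \<in> points X; A \<in> carrier (stalk Y (pt f x))\<rbrakk> \<Longrightarrow> stalk_map X f x A \<in> carrier (stalk X x)"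
  by (rule ring_hom_closed[OF stalk_map_hom])

end

text \<open>Because all components are extensional, agreement on points, open sets and sections is
  already equality of the records.\<close>

lemma rs_map_eqI:
  assumes "f \<in> rs_hom X Y" "g \<in> rs_hom X Y"
    and "\<And>x. x \<in> points X \<Longrightarrow> pt f x = pt g x"
    and "\<And>V s. \<lbrakk>openin (Top Y) V; s \<in> carrier (Sec Y V)\<rbrakk> \<Longrightarrow> sharp f V s = sharp g V s"
  shows "f = g"
proof (rule rs_map.equality)
  show "pt f = pt g"
    using assms by (intro extensionalityI[of _ "points X"]) (auto simp: rs_hom_def)
  have "sharp f V = sharp g V" if "openin (Top Y) V" for V
    using that assms by (intro extensionalityI[of _ "carrier (Sec Y V)"]) (auto simp: rs_hom_def)
  then show "sharp f = sharp g"
    using assms by (intro extensionalityI[of _ "{V. openin (Top Y) V}"]) (auto simp: rs_hom_def)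
qed simp

lemma pt_rs_id: "x \<in> points X \<Longrightarrow> pt (rs_id X) x = x"
  by (simp add: rs_id_def)

lemma preim_rs_id: "openin (Top X) V \<Longrightarrow> preim X (rs_id X) V = V"
  using openin_subset by (fastforce simp: preim_def rs_id_def)

lemma (in ringed_space) rs_id_hom: "rs_id X \<in> rs_hom X X"
proof -
  have "continuous_map (Top X) (Top X) (pt (rs_id X))"
    by (rule continuous_map_eq[of _ _ id]) (auto simp: rs_id_def)
  moreover have "sharp (rs_id X) V \<in> ring_hom (Sec X V) (Sec X V)" if V: "openin (Top X) V" for V
  proof -
    interpret cring "Sec X V" by (rule sections_cring[OF V])
    show ?thesis using V by (intro ring_hom_memI) (auto simp: rs_id_def)
  qed
  ultimately show ?thesis
    by (simp add: rs_hom_def preim_rs_id) (auto simp: rs_id_def restriction_closed)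
qed

section \<open>Composition of morphisms of ringed spaces\<close>

context
  fixes X :: "('a, 'r) rspace" and Y :: "('b, 's) rspace" and Z :: "('c, 't) rspace" and f g
  assumes XY: "rs_morphism X Y f" and YZ: "rs_morphism Y Z g"
begin

interpretation f: rs_morphism X Y f by (rule XY)
interpretation g: rs_morphism Y Z g by (rule YZ)

lemma pt_rs_comp: "x \<in> points X \<Longrightarrow> pt (rs_comp X Y Z g f) x = pt g (pt f x)"
  by (simp add: rs_comp_def)

lemma sharp_rs_comp:
  "\<lbrakk>openin (Top Z) W; s \<in> carrier (Sec Z W)\<rbrakk>
    \<Longrightarrow> sharp (rs_comp X Y Z g f) W s = sharp f (preim Y g W) (sharp g W s)"
  by (simp add: rs_comp_def)

lemma preim_rs_comp: "preim X (rs_comp X Y Z g f) W = preim X f (preim Y g W)"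
  using f.pt_closed by (auto simp: preim_def rs_comp_def)

lemma rs_comp_hom: "rs_comp X Y Z g f \<in> rs_hom X Z"
proof -
  have "continuous_map (Top X) (Top Z) (pt (rs_comp X Y Z g f))"
    by (rule continuous_map_eq[OF continuous_map_compose[of "Top X" "Top Y" "pt f" _ "pt g"]])
      (use f.rs_hom g.rs_hom in \<open>auto simp: rs_hom_def rs_comp_def\<close>)
  moreover have "sharp (rs_comp X Y Z g f) W \<in> ring_hom (Sec Z W) (Sec X (preim X (rs_comp X Y Z g f) W))"
    if W: "openin (Top Z) W" for W
  proof -
    interpret W: cring "Sec Z W" by (rule g.target.sections_cring[OF W])
    note h = ring_hom_trans[OF g.sharp_hom[OF W] f.sharp_hom[OF g.openin_preim[OF W]]]
    show ?thesis
      unfolding preim_rs_comp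
      using ring_hom_closed[OF h] ring_hom_mult[OF h] ring_hom_add[OF h] ring_hom_one[OF h] W
      by (intro ring_hom_memI) (auto simp: sharp_rs_comp)
  qed
  moreover have "sharp (rs_comp X Y Z g f) W (Res Z V W s) =
      Res X (preim X (rs_comp X Y Z g f) V) (preim X (rs_comp X Y Z g f) W) (sharp (rs_comp X Y Z g f) V s)"
    if "openin (Top Z) V" "openin (Top Z) W" "W \<subseteq> V" "s \<in> carrier (Sec Z V)" for V W s
  proof -
    have "preim Y g W \<subseteq> preim Y g V" using that by (auto simp: preim_def)
    then show ?thesis
      using that by (simp add: sharp_rs_comp preim_rs_comp g.target.restriction_closed
        g.sharp_restriction f.sharp_restriction g.openin_preim g.sharp_closed)
  qed
  ultimately show ?thesis
    by (simp add: rs_hom_def) (simp add: rs_comp_def)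
qed

lemma rs_morphism_comp: "rs_morphism X Z (rs_comp X Y Z g f)"
  by (intro rs_morphism.intro rs_morphism_axioms.intro rs_comp_hom
      f.source.ringed_space_axioms g.target.ringed_space_axioms)

lemma stalk_map_rs_comp:
  assumes x: "x \<in> points X" and A: "A \<in> carrier (stalk Z (pt g (pt f x)))"
  shows "stalk_map X (rs_comp X Y Z g f) x A = stalk_map X f x (stalk_map Y g (pt f x) A)"
proof -
  interpret gf: rs_morphism X Z "rs_comp X Y Z g f" by (rule rs_morphism_comp)
  obtain W s where W: "openin (Top Z) W" "pt g (pt f x) \<in> W" "s \<in> carrier (Sec Z W)"
    "A = germ Z (pt g (pt f x)) W s"
    using A by (rule g.target.stalk_cases)
  have "pt f x \<in> preim Y g W" using W x f.pt_closed by (simp add: preim_def)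
  then show ?thesis
    using gf.stalk_map_germ[OF x W(1)] W x
    by (simp add: pt_rs_comp g.stalk_map_germ f.stalk_map_germ f.pt_closed g.openin_preim
        g.sharp_closed sharp_rs_comp preim_rs_comp)
qed

text \<open>Contravariance of pulling back subsets of stalks. It makes the prime condition stable
  under composition, and in the uniqueness proof it forces the prime of a lifted point.\<close>

lemma stalk_vimage_rs_comp:
  assumes x: "x \<in> points X"
  shows "stalk_vimage X Z (rs_comp X Y Z g f) x z =
    stalk_vimage Y Z g (pt f x) (stalk_vimage X Y f x z)"
  using x by (auto simp: stalk_vimage_def pt_rs_comp stalk_map_rs_comp g.stalk_map_closed f.pt_closed)

lemma rs_comp_assoc:
  assumes ZQ: "rs_morphism Z Q h"
  shows "rs_comp X Z Q h (rs_comp X Y Z g f) = rs_comp X Y Q (rs_comp Y Z Q h g) f"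
proof -
  interpret h: rs_morphism Z Q h by (rule ZQ)
  have "preim Y (rs_comp Y Z Q h g) W = preim Y g (preim Z h W)" for W
    using g.pt_closed by (auto simp: preim_def rs_comp_def)
  then show ?thesis
    using f.pt_closed
    by (auto simp: rs_comp_def fun_eq_iff h.openin_preim h.sharp_closed restrict_def)
qed

end

lemma (in rs_morphism) rs_comp_id_left: "rs_comp X Y Y (rs_id Y) f = f"
proof (rule rs_map_eqI[OF rs_comp_hom rs_hom])
  show "rs_morphism X Y f" by (rule rs_morphism_axioms)
  show "rs_morphism Y Y (rs_id Y)"
    by (intro rs_morphism.intro rs_morphism_axioms.intro target.ringed_space_axioms target.rs_id_hom)
qed (auto simp: rs_comp_def rs_id_def preim_def[of Y] pt_closed intro: arg_cong[where f = "\<lambda>V. sharp f V _"]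
  dest: openin_subset)

lemma (in rs_morphism) rs_comp_id_right: "rs_comp X X Y f (rs_id X) = f"
proof (rule rs_map_eqI[OF rs_comp_hom rs_hom])
  show "rs_morphism X Y f" by (rule rs_morphism_axioms)
  show "rs_morphism X X (rs_id X)"
    by (intro rs_morphism.intro rs_morphism_axioms.intro source.ringed_space_axioms source.rs_id_hom)
qed (auto simp: rs_comp_def rs_id_def openin_preim sharp_closed)

lemma (in ringed_space) stalk_map_rs_id:
  assumes x: "x \<in> points X" and A: "A \<in> carrier (stalk X x)"
  shows "stalk_map X (rs_id X) x A = A"
proof -
  interpret rs_morphism X X "rs_id X"
    by (intro rs_morphism.intro rs_morphism_axioms.intro ringed_space_axioms rs_id_hom)
  note p = pt_rs_id[OF x]
  obtain W s where W: "openin (Top X) W" "x \<in> W" "s \<in> carrier (Sec X W)" "A = germ X x W s"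
    using A by (rule stalk_cases)
  have "sharp (rs_id X) W s = s" using W by (simp add: rs_id_def)
  then show ?thesis
    using stalk_map_germ[OF x W(1)] W by (simp add: p preim_rs_id)
qed

subsection \<open>Morphisms of primed and of locally ringed spaces\<close>

text \<open>For singleton prime systems the prime condition says that maximal ideals pull back to
  maximal ideals. Full faithfulness of the inclusion is thus an equality of sets of maps, and facts
  on identities and composites carry over.\<close>

lemma lrs_hom_eq_prs_hom: "lrs_hom X Y = prs_hom X (local_primes X) Y (local_primes Y)"
  by (simp add: lrs_hom_def prs_hom_def local_primes_def)

lemma (in primed_ringed_space) rs_id_prs_hom: "rs_id X \<in> prs_hom X M X M"
proof -
  have "stalk_vimage X X (rs_id X) x z = z" if x: "x \<in> points X" and z: "z \<in> M x" for x z
  proof -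
    interpret primeideal z "stalk X x" using primes_subset_Spec[OF x] z by (auto simp: Spec_def)
    show ?thesis
      using x Icarr by (auto simp: stalk_vimage_def stalk_map_rs_id pt_rs_id)
  qed
  then show ?thesis using rs_id_hom by (auto simp: prs_hom_def pt_rs_id)
qed

lemma rs_morphism_prs_hom:
  assumes "ringed_space X" "ringed_space Y" "f \<in> prs_hom X M Y N"
  shows "rs_morphism X Y f"
  using assms by (intro rs_morphism.intro rs_morphism_axioms.intro) (auto simp: prs_hom_def)

lemma prs_hom_rs_comp:
  assumes "ringed_space X" "ringed_space Y" "ringed_space Z"
    and "f \<in> prs_hom X M Y N" "g \<in> prs_hom Y N Z P"
  shows "rs_comp X Y Z g f \<in> prs_hom X M Z P"
proof -
  note f = rs_morphism_prs_hom[OF assms(1,2,4)] and g = rs_morphism_prs_hom[OF assms(2,3,5)]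
  show ?thesis
    using assms(4,5) rs_comp_hom[OF f g] rs_morphism.pt_closed[OF f]
    by (auto simp: prs_hom_def pt_rs_comp[OF f g] stalk_vimage_rs_comp[OF f g])
qed

lemma (in locally_ringed_space) primed_local_primes: "primed_ringed_space X (local_primes X)"
  by unfold_locales (use stalk_local max_ideal_primeideal in \<open>auto simp: local_primes_def Spec_def\<close>)

section \<open>The localization of a primed ringed space\<close>

lemma loc_stalk_Pair: "loc_stalk X (x, z) = localization (stalk X x) (carrier (stalk X x) - z)"
  by (simp add: loc_stalk_def)

lemma loc_frac_Pair: "loc_frac X (x, z) = fraction (stalk X x) (carrier (stalk X x) - z)"
  by (simp add: loc_frac_def)

lemma mem_loc_basic: "(x, z) \<in> loc_basic X M U s \<longleftrightarrow> x \<in> U \<and> z \<in> M x \<and> germ X x U s \<notin> z"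
  by (simp add: loc_basic_def)

lemma Top_loc_space [simp]: "Top (loc_space X M) = loc_topology X M"
  and carrier_Sec_loc_space [simp]: "carrier (Sec (loc_space X M) V) = loc_sections X M V"
  and mult_Sec_loc_space [simp]:
    "\<sigma> \<otimes>\<^bsub>Sec (loc_space X M) V\<^esub> \<tau> = (\<lambda>p\<in>V. \<sigma> p \<otimes>\<^bsub>loc_stalk X p\<^esub> \<tau> p)"
  and add_Sec_loc_space [simp]:
    "\<sigma> \<oplus>\<^bsub>Sec (loc_space X M) V\<^esub> \<tau> = (\<lambda>p\<in>V. \<sigma> p \<oplus>\<^bsub>loc_stalk X p\<^esub> \<tau> p)"
  and one_Sec_loc_space [simp]: "\<one>\<^bsub>Sec (loc_space X M) V\<^esub> = (\<lambda>p\<in>V. \<one>\<^bsub>loc_stalk X p\<^esub>)"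
  and zero_Sec_loc_space [simp]: "\<zero>\<^bsub>Sec (loc_space X M) V\<^esub> = (\<lambda>p\<in>V. \<zero>\<^bsub>loc_stalk X p\<^esub>)"
  and Res_loc_space [simp]: "Res (loc_space X M) V W \<sigma> = restrict \<sigma> W"
  by (simp_all add: loc_space_def)

context primed_ringed_space
begin

lemma primeideal_M: "\<lbrakk>x \<in> points X; z \<in> M x\<rbrakk> \<Longrightarrow> primeideal z (stalk X x)"
  using primes_subset_Spec by (auto simp: Spec_def)

lemma fractions_M:
  "\<lbrakk>x \<in> points X; z \<in> M x\<rbrakk> \<Longrightarrow> fractions (stalk X x) (carrier (stalk X x) - z)"
  by (rule primeideal.fractions_complement[OF primeideal_M])

lemma cring_loc_stalk:
  assumes "x \<in> points X" "z \<in> M x"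
  shows "cring (loc_stalk X (x, z))"
proof -
  interpret fractions "stalk X x" "carrier (stalk X x) - z" by (rule fractions_M[OF assms])
  show ?thesis unfolding loc_stalk_Pair by (rule loc.is_cring)
qed

subsection \<open>The topology\<close>

lemma loc_basicD:
  assumes "openin (Top X) U" "s \<in> carrier (Sec X U)" "(x, z) \<in> loc_basic X M U s"
  shows "x \<in> U" "x \<in> points X" "z \<in> M x" "germ X x U s \<in> carrier (stalk X x) - z"
  using assms openin_subset by (fastforce simp: mem_loc_basic)+

lemma germ_mult_mem_iff:
  assumes "openin (Top X) U" "x \<in> U" "s \<in> carrier (Sec X U)" "t \<in> carrier (Sec X U)" "z \<in> M x"
  shows "germ X x U (s \<otimes>\<^bsub>Sec X U\<^esub> t) \<in> z \<longleftrightarrow> germ X x U s \<in> z \<or> germ X x U t \<in> z"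
proof -
  have "x \<in> points X" using assms openin_subset by blast
  then interpret primeideal z "stalk X x" using assms by (intro primeideal_M)
  show ?thesis
    using assms I_prime I_l_closed I_r_closed germ_in_carrier by (metis stalk_mult)
qed

lemma loc_basic_mult:
  assumes "openin (Top X) U" "s \<in> carrier (Sec X U)" "t \<in> carrier (Sec X U)"
  shows "loc_basic X M U (s \<otimes>\<^bsub>Sec X U\<^esub> t) = loc_basic X M U s \<inter> loc_basic X M U t"
  using assms by (auto simp: loc_basic_def germ_mult_mem_iff)

lemma loc_basic_restriction:
  assumes "openin (Top X) U" "openin (Top X) V" "V \<subseteq> U" "s \<in> carrier (Sec X U)"
  shows "loc_basic X M V (Res X U V s) = {p \<in> loc_basic X M U s. fst p \<in> V}"
  using assms by (auto simp: loc_basic_def germ_restriction)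

text \<open>A product avoids a prime exactly when both factors do. After restriction to
  \<open>U \<inter> V\<close> the intersection is the basic set of the product, so basic sets form a
  basis.\<close>

lemma loc_basic_Int:
  assumes U: "openin (Top X) U" "s \<in> carrier (Sec X U)" and V: "openin (Top X) V" "t \<in> carrier (Sec X V)"
  shows "loc_basic X M U s \<inter> loc_basic X M V t =
    loc_basic X M (U \<inter> V) (Res X U (U \<inter> V) s \<otimes>\<^bsub>Sec X (U \<inter> V)\<^esub> Res X V (U \<inter> V) t)"
proof -
  have o: "openin (Top X) (U \<inter> V)" using U V by blast
  have "Res X U (U \<inter> V) s \<in> carrier (Sec X (U \<inter> V))" "Res X V (U \<inter> V) t \<in> carrier (Sec X (U \<inter> V))"
    using U V o by (auto intro: restriction_closed)
  then show ?thesis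
    using U V o by (subst loc_basic_mult) (auto simp: loc_basic_restriction mem_loc_basic)
qed

text \<open>Primes are proper, so the germ of one lies in none of them. Basic sets of this shape are
  the preimages of open sets under the projection.\<close>

lemma loc_basic_one:
  assumes "openin (Top X) U"
  shows "loc_basic X M U \<one>\<^bsub>Sec X U\<^esub> = {(x, z). x \<in> U \<and> z \<in> M x}"
proof -
  have "germ X x U \<one>\<^bsub>Sec X U\<^esub> \<notin> z" if "x \<in> U" "z \<in> M x" for x z
  proof -
    have "x \<in> points X" using assms that openin_subset by blast
    then interpret primeideal z "stalk X x" using that by (intro primeideal_M)
    show ?thesis using assms that one_imp_carrier I_notcarr by (auto simp flip: stalk_one)
  qed
  then show ?thesis by (auto simp: loc_basic_def)
qed

text \<open>Closure of the basic sets under intersection makes the unions of basic sets a topology,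
  so the \<open>topology\<close> constructor can be unfolded into a pointwise criterion.\<close>

lemma openin_loc_topology:
  "openin (loc_topology X M) V \<longleftrightarrow> (\<forall>p\<in>V. \<exists>U s. openin (Top X) U \<and> s \<in> carrier (Sec X U) \<and>
     p \<in> loc_basic X M U s \<and> loc_basic X M U s \<subseteq> V)"
proof -
  let ?B = "\<lambda>B. \<exists>U s. openin (Top X) U \<and> s \<in> carrier (Sec X U) \<and> B = loc_basic X M U s"
  have "istopology (arbitrary union_of ?B)"
  proof (rule istopology_base, elim exE conjE)
    fix S T U s V t
    assume A: "openin (Top X) U" "s \<in> carrier (Sec X U)" "S = loc_basic X M U s"
      "openin (Top X) V" "t \<in> carrier (Sec X V)" "T = loc_basic X M V t"
    have o: "openin (Top X) (U \<inter> V)" using A by blast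
    interpret cring "Sec X (U \<inter> V)" by (rule sections_cring[OF o])
    show "?B (S \<inter> T)"
      using A o loc_basic_Int[OF A(1,2,4,5)] restriction_closed[OF A(1) o _ A(2)]
        restriction_closed[OF A(4) o _ A(5)]
      by blast
  qed
  then have *: "openin (loc_topology X M) V \<longleftrightarrow> (arbitrary union_of ?B) V"
    by (simp add: loc_topology_def)
  show ?thesis
    unfolding * arbitrary_union_of_alt by blast
qed

lemma openin_loc_basic:
  "\<lbrakk>openin (Top X) U; s \<in> carrier (Sec X U)\<rbrakk> \<Longrightarrow> openin (loc_topology X M) (loc_basic X M U s)"
  by (auto simp: openin_loc_topology)

lemma points_loc_space: "points (loc_space X M) = {(x, z). x \<in> points X \<and> z \<in> M x}"
proof -
  have p: "openin (Top X) (points X)" by simp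
  interpret cring "Sec X (points X)" by (rule sections_cring[OF p])
  have "openin (loc_topology X M) {(x, z). x \<in> points X \<and> z \<in> M x}"
    using openin_loc_basic[OF p one_closed] by (simp add: loc_basic_one[OF p])
  moreover have "p \<in> {(x, z). x \<in> points X \<and> z \<in> M x}" if p: "p \<in> topspace (loc_topology X M)" for p
  proof -
    obtain U s where "openin (Top X) U" "s \<in> carrier (Sec X U)" "p \<in> loc_basic X M U s"
      using openin_topspace[of "loc_topology X M"] p unfolding openin_loc_topology by metis
    then show ?thesis using loc_basicD(2,3)[of U s "fst p" "snd p"] by (cases p) auto
  qed
  ultimately show ?thesis using openin_subset[of "loc_topology X M"] by (intro equalityI) auto
qed

lemma openin_loc_topologyD:
  "\<lbrakk>openin (loc_topology X M) V; (x, z) \<in> V\<rbrakk> \<Longrightarrow> x \<in> points X \<and> z \<in> M x"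
  using openin_subset[of "loc_topology X M" V] points_loc_space by auto

subsection \<open>The structure sheaf\<close>

lemma loc_frac_cancel:
  assumes "openin (Top X) U" "a \<in> carrier (Sec X U)" "t \<in> carrier (Sec X U)" "w \<in> carrier (Sec X U)"
    and "(x, z) \<in> loc_basic X M U t" "(x, z) \<in> loc_basic X M U w"
  shows "loc_frac X (x, z) (germ X x U (a \<otimes>\<^bsub>Sec X U\<^esub> w)) (germ X x U (t \<otimes>\<^bsub>Sec X U\<^esub> w)) =
    loc_frac X (x, z) (germ X x U a) (germ X x U t)"
proof -
  note t = loc_basicD[OF assms(1,3,5)] and w = loc_basicD[OF assms(1,4,6)]
  interpret U: cring "Sec X U" by (rule sections_cring[OF assms(1)])
  interpret fractions "stalk X x" "carrier (stalk X x) - z" by (rule fractions_M[OF t(2,3)])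
  show ?thesis
    using assms(1-4) t w fraction_cancel[of "germ X x U a" "germ X x U t" "germ X x U w"]
    by (simp add: loc_frac_Pair U.m_comm[of _ w] stalk_mult[symmetric] del: Diff_iff)
qed

text \<open>A denominator without exponent is the case \<open>n = 1\<close> of the definition, and a
  local representation as a fraction already puts the values into the rings of fractions.\<close>

lemma loc_sectionsI:
  assumes ext: "\<sigma> \<in> extensional V"
    and rep: "\<And>p. p \<in> V \<Longrightarrow> \<exists>U t a. openin (Top X) U \<and> t \<in> carrier (Sec X U) \<and> a \<in> carrier (Sec X U) \<and>
       p \<in> loc_basic X M U t \<and> loc_basic X M U t \<subseteq> V \<and>
       (\<forall>x z. (x, z) \<in> loc_basic X M U t \<longrightarrow> \<sigma> (x, z) = loc_frac X (x, z) (germ X x U a) (germ X x U t))"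
  shows "\<sigma> \<in> loc_sections X M V"
proof -
  have "\<sigma> p \<in> carrier (loc_stalk X p)" if p: "p \<in> V" for p
  proof -
    obtain U t a where U: "openin (Top X) U" "t \<in> carrier (Sec X U)" "a \<in> carrier (Sec X U)"
       "p \<in> loc_basic X M U t"
       "\<And>x z. (x, z) \<in> loc_basic X M U t \<Longrightarrow> \<sigma> (x, z) = loc_frac X (x, z) (germ X x U a) (germ X x U t)"
      using rep[OF p] by (elim exE conjE) blast
    obtain x z where [simp]: "p = (x, z)" by fastforce
    note t = loc_basicD[OF U(1,2) U(4)[simplified]]
    interpret fractions "stalk X x" "carrier (stalk X x) - z" by (rule fractions_M[OF t(2,3)])
    show ?thesis using U(1-4) U(5)[of x z] t by (simp add: loc_stalk_Pair loc_frac_Pair)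
  qed
  moreover have "\<exists>U t a n. openin (Top X) U \<and> t \<in> carrier (Sec X U) \<and> a \<in> carrier (Sec X U) \<and>
       p \<in> loc_basic X M U t \<and> loc_basic X M U t \<subseteq> V \<and>
       (\<forall>(x, z)\<in>loc_basic X M U t.
          \<sigma> (x, z) = loc_frac X (x, z) (germ X x U a) (germ X x U t [^]\<^bsub>stalk X x\<^esub> (n::nat)))"
    if p: "p \<in> V" for p
  proof -
    obtain U t a where U: "openin (Top X) U" "t \<in> carrier (Sec X U)" "a \<in> carrier (Sec X U)"
       "p \<in> loc_basic X M U t" "loc_basic X M U t \<subseteq> V"
       "\<And>x z. (x, z) \<in> loc_basic X M U t \<Longrightarrow> \<sigma> (x, z) = loc_frac X (x, z) (germ X x U a) (germ X x U t)"
      using rep[OF p] by (elim exE conjE) blast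
    have "germ X x U t [^]\<^bsub>stalk X x\<^esub> (1::nat) = germ X x U t" if xz: "(x, z) \<in> loc_basic X M U t" for x z
    proof -
      note t = loc_basicD[OF U(1,2) xz]
      interpret cring "stalk X x" by (rule cring_stalk[OF t(2)])
      show ?thesis using t by simp
    qed
    then show ?thesis
      using U by (intro exI[of _ U] exI[of _ t] exI[of _ a] exI[of _ 1]) auto
  qed
  ultimately show ?thesis
    using ext unfolding loc_sections_def PiE_def by blast
qed

text \<open>
  A fraction \<open>a/t^n\<close> on \<open>U(U,t)\<close> is the fraction \<open>(a t)/t^(n+1)\<close> on \<open>U(U,t^(n+1)) = U(U,t)\<close>,
  so the exponents in the definition of sections can be avoided.
\<close>

lemma loc_section_rep:
  assumes "\<sigma> \<in> loc_sections X M V" "p \<in> V"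
  obtains U t a where "openin (Top X) U" "t \<in> carrier (Sec X U)" "a \<in> carrier (Sec X U)"
    "p \<in> loc_basic X M U t" "loc_basic X M U t \<subseteq> V"
    "\<And>x z. (x, z) \<in> loc_basic X M U t \<Longrightarrow> \<sigma> (x, z) = loc_frac X (x, z) (germ X x U a) (germ X x U t)"
proof -
  obtain U t a n where U: "openin (Top X) U" "t \<in> carrier (Sec X U)" "a \<in> carrier (Sec X U)"
    "p \<in> loc_basic X M U t" "loc_basic X M U t \<subseteq> V"
    and \<sigma>: "\<And>x z. (x, z) \<in> loc_basic X M U t \<Longrightarrow>
        \<sigma> (x, z) = loc_frac X (x, z) (germ X x U a) (germ X x U t [^]\<^bsub>stalk X x\<^esub> (n::nat))"
  proof -
    have "\<exists>U t a n. openin (Top X) U \<and> t \<in> carrier (Sec X U) \<and> a \<in> carrier (Sec X U) \<and>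
       p \<in> loc_basic X M U t \<and> loc_basic X M U t \<subseteq> V \<and>
       (\<forall>(x, z)\<in>loc_basic X M U t.
          \<sigma> (x, z) = loc_frac X (x, z) (germ X x U a) (germ X x U t [^]\<^bsub>stalk X x\<^esub> (n::nat)))"
      using assms by (simp add: loc_sections_def)
    then show thesis using that by (elim exE conjE) fast
  qed
  interpret U: cring "Sec X U" by (rule sections_cring[OF U(1)])
  \<comment> \<open>Only an inclusion holds for \<open>k = 0\<close>, where the power is one and its
    basic set lies over all of \<open>U\<close>. The extra factor \<open>t\<close> in the new
    denominator restores equality.\<close>
  have basic: "loc_basic X M U t \<subseteq> loc_basic X M U (t [^]\<^bsub>Sec X U\<^esub> k)" for k :: nat
    using U loc_basic_one[OF U(1)] by (induction k) (auto simp: loc_basic_mult mem_loc_basic)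
  have "loc_basic X M U (t [^]\<^bsub>Sec X U\<^esub> n \<otimes>\<^bsub>Sec X U\<^esub> t) = loc_basic X M U t"
    using U basic by (auto simp: loc_basic_mult)
  moreover have "\<sigma> (x, z) = loc_frac X (x, z) (germ X x U (a \<otimes>\<^bsub>Sec X U\<^esub> t))
      (germ X x U (t [^]\<^bsub>Sec X U\<^esub> n \<otimes>\<^bsub>Sec X U\<^esub> t))" if xz: "(x, z) \<in> loc_basic X M U t" for x z
  proof -
    have "x \<in> U" using loc_basicD[OF U(1,2) xz] by simp
    have "\<sigma> (x, z) = loc_frac X (x, z) (germ X x U a) (germ X x U (t [^]\<^bsub>Sec X U\<^esub> n))"
      using \<sigma>[OF xz] ring_hom_pow[OF germ_hom[OF U(1) \<open>x \<in> U\<close>] U.ring_axioms U(2), of n] by simp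
    also have "\<dots> = loc_frac X (x, z) (germ X x U (a \<otimes>\<^bsub>Sec X U\<^esub> t))
      (germ X x U (t [^]\<^bsub>Sec X U\<^esub> n \<otimes>\<^bsub>Sec X U\<^esub> t))"
      using U basic xz by (intro loc_frac_cancel[symmetric]) auto
    finally show ?thesis .
  qed
  ultimately show thesis
    using that[of U "t [^]\<^bsub>Sec X U\<^esub> n \<otimes>\<^bsub>Sec X U\<^esub> t" "a \<otimes>\<^bsub>Sec X U\<^esub> t"] U by simp
qed

text \<open>Over \<open>U1 \<inter> U2\<close> the product of the two denominators is a common one,
  and its basic set is the intersection of the two basic sets.\<close>

lemma loc_section_rep2:
  assumes "\<sigma> \<in> loc_sections X M V" "p \<in> V" "\<tau> \<in> loc_sections X M W" "p \<in> W"
  obtains U t a b where "openin (Top X) U" "t \<in> carrier (Sec X U)" "a \<in> carrier (Sec X U)"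
    "b \<in> carrier (Sec X U)" "p \<in> loc_basic X M U t" "loc_basic X M U t \<subseteq> V \<inter> W"
    "\<And>x z. (x, z) \<in> loc_basic X M U t \<Longrightarrow> \<sigma> (x, z) = loc_frac X (x, z) (germ X x U a) (germ X x U t)"
    "\<And>x z. (x, z) \<in> loc_basic X M U t \<Longrightarrow> \<tau> (x, z) = loc_frac X (x, z) (germ X x U b) (germ X x U t)"
proof -
  obtain U1 t1 a1 where 1: "openin (Top X) U1" "t1 \<in> carrier (Sec X U1)" "a1 \<in> carrier (Sec X U1)"
    "p \<in> loc_basic X M U1 t1" "loc_basic X M U1 t1 \<subseteq> V"
    "\<And>x z. (x, z) \<in> loc_basic X M U1 t1 \<Longrightarrow> \<sigma> (x, z) = loc_frac X (x, z) (germ X x U1 a1) (germ X x U1 t1)"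
    using loc_section_rep[OF assms(1,2)] by metis
  obtain U2 t2 a2 where 2: "openin (Top X) U2" "t2 \<in> carrier (Sec X U2)" "a2 \<in> carrier (Sec X U2)"
    "p \<in> loc_basic X M U2 t2" "loc_basic X M U2 t2 \<subseteq> W"
    "\<And>x z. (x, z) \<in> loc_basic X M U2 t2 \<Longrightarrow> \<tau> (x, z) = loc_frac X (x, z) (germ X x U2 a2) (germ X x U2 t2)"
    using loc_section_rep[OF assms(3,4)] by metis
  define U where "U = U1 \<inter> U2"
  have U: "openin (Top X) U" "U \<subseteq> U1" "U \<subseteq> U2" using 1 2 by (auto simp: U_def)
  interpret U: cring "Sec X U" by (rule sections_cring[OF U(1)])
  define t1' where "t1' = Res X U1 U t1"
  define a1' where "a1' = Res X U1 U a1"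
  define t2' where "t2' = Res X U2 U t2"
  define a2' where "a2' = Res X U2 U a2"
  have c: "t1' \<in> carrier (Sec X U)" "a1' \<in> carrier (Sec X U)" "t2' \<in> carrier (Sec X U)" "a2' \<in> carrier (Sec X U)"
    using 1 2 U by (auto simp: t1'_def a1'_def t2'_def a2'_def intro: restriction_closed)
  define t where "t = t1' \<otimes>\<^bsub>Sec X U\<^esub> t2'"
  have basic: "loc_basic X M U t = loc_basic X M U1 t1 \<inter> loc_basic X M U2 t2"
    using loc_basic_Int[OF 1(1,2) 2(1,2)] by (simp add: t_def t1'_def t2'_def U_def)
  have mem: "(x, z) \<in> loc_basic X M U t1'" "(x, z) \<in> loc_basic X M U t2'"
    "(x, z) \<in> loc_basic X M U1 t1" "(x, z) \<in> loc_basic X M U2 t2" "x \<in> U"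
    if xz: "(x, z) \<in> loc_basic X M U t" for x z
  proof -
    show "(x, z) \<in> loc_basic X M U1 t1" "(x, z) \<in> loc_basic X M U2 t2"
      using xz unfolding basic by auto
    show "(x, z) \<in> loc_basic X M U t1'" "(x, z) \<in> loc_basic X M U t2'" "x \<in> U"
      using xz c U by (auto simp: t_def loc_basic_mult mem_loc_basic)
  qed
  show thesis
  proof (rule that[of U t "a1' \<otimes>\<^bsub>Sec X U\<^esub> t2'" "a2' \<otimes>\<^bsub>Sec X U\<^esub> t1'"])
    fix x z assume xz: "(x, z) \<in> loc_basic X M U t"
    note m = mem[OF xz]
    have g: "germ X x U a1' = germ X x U1 a1" "germ X x U t1' = germ X x U1 t1"
      "germ X x U a2' = germ X x U2 a2" "germ X x U t2' = germ X x U2 t2"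
      using U 1 2 m by (auto simp: t1'_def a1'_def t2'_def a2'_def germ_restriction)
    show "\<sigma> (x, z) = loc_frac X (x, z) (germ X x U (a1' \<otimes>\<^bsub>Sec X U\<^esub> t2')) (germ X x U t)"
      unfolding t_def using c U m by (simp add: 1(6) loc_frac_cancel g)
    have "t = t2' \<otimes>\<^bsub>Sec X U\<^esub> t1'" using c by (simp add: t_def U.m_comm)
    then show "\<tau> (x, z) = loc_frac X (x, z) (germ X x U (a2' \<otimes>\<^bsub>Sec X U\<^esub> t1')) (germ X x U t)"
      using c U m by (simp add: 2(6) loc_frac_cancel g)
  qed (use U c basic 1 2 in \<open>auto simp: t_def\<close>)
qed

lemma loc_sections_extensional: "\<sigma> \<in> loc_sections X M V \<Longrightarrow> \<sigma> \<in> extensional V"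
  by (auto simp: loc_sections_def PiE_def)

lemma loc_sections_value:
  "\<lbrakk>\<sigma> \<in> loc_sections X M V; p \<in> V\<rbrakk> \<Longrightarrow> \<sigma> p \<in> carrier (loc_stalk X p)"
  by (auto simp: loc_sections_def)

lemma loc_section_frac:
  assumes "openin (Top X) U" "t \<in> carrier (Sec X U)" "a \<in> carrier (Sec X U)"
  shows "(\<lambda>(x, z)\<in>loc_basic X M U t. loc_frac X (x, z) (germ X x U a) (germ X x U t))
    \<in> loc_sections X M (loc_basic X M U t)"
  using assms by (intro loc_sectionsI; (intro exI[of _ U] exI[of _ t] exI[of _ a])?) auto

lemma one_loc_sections:
  assumes V: "openin (loc_topology X M) V"
  shows "(\<lambda>p\<in>V. \<one>\<^bsub>loc_stalk X p\<^esub>) \<in> loc_sections X M V"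
proof (rule loc_sectionsI)
  fix p assume "p \<in> V"
  then obtain U t where U: "openin (Top X) U" "t \<in> carrier (Sec X U)" "p \<in> loc_basic X M U t"
    "loc_basic X M U t \<subseteq> V"
    using V unfolding openin_loc_topology by blast
  have "\<one>\<^bsub>loc_stalk X (x, z)\<^esub> = loc_frac X (x, z) (germ X x U t) (germ X x U t)"
    if "(x, z) \<in> loc_basic X M U t" for x z
  proof -
    note t = loc_basicD[OF U(1,2) that]
    interpret fractions "stalk X x" "carrier (stalk X x) - z" by (rule fractions_M[OF t(2,3)])
    show ?thesis
      using t fraction_cancel[of "\<one>\<^bsub>stalk X x\<^esub>" "\<one>\<^bsub>stalk X x\<^esub>" "germ X x U t"]
      by (simp add: loc_stalk_Pair loc_frac_Pair fraction_one del: Diff_iff)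
  qed
  then show "\<exists>U t a. openin (Top X) U \<and> t \<in> carrier (Sec X U) \<and> a \<in> carrier (Sec X U) \<and>
       p \<in> loc_basic X M U t \<and> loc_basic X M U t \<subseteq> V \<and>
       (\<forall>x z. (x, z) \<in> loc_basic X M U t \<longrightarrow> (\<lambda>p\<in>V. \<one>\<^bsub>loc_stalk X p\<^esub>) (x, z) = loc_frac X (x, z) (germ X x U a) (germ X x U t))"
    using U by (intro exI[of _ U] exI[of _ t]) auto
qed simp

lemma mult_loc_sections:
  assumes \<sigma>: "\<sigma> \<in> loc_sections X M V" and \<tau>: "\<tau> \<in> loc_sections X M V"
  shows "(\<lambda>p\<in>V. \<sigma> p \<otimes>\<^bsub>loc_stalk X p\<^esub> \<tau> p) \<in> loc_sections X M V"
proof (rule loc_sectionsI)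
  fix p assume p: "p \<in> V"
  obtain U t a b where U: "openin (Top X) U" "t \<in> carrier (Sec X U)" "a \<in> carrier (Sec X U)"
    "b \<in> carrier (Sec X U)" "p \<in> loc_basic X M U t" "loc_basic X M U t \<subseteq> V \<inter> V"
    and eqs: "\<And>x z. (x, z) \<in> loc_basic X M U t \<Longrightarrow> \<sigma> (x, z) = loc_frac X (x, z) (germ X x U a) (germ X x U t)"
    "\<And>x z. (x, z) \<in> loc_basic X M U t \<Longrightarrow> \<tau> (x, z) = loc_frac X (x, z) (germ X x U b) (germ X x U t)"
    using loc_section_rep2[OF \<sigma> p \<tau> p] by metis
  interpret U: cring "Sec X U" by (rule sections_cring[OF U(1)])
  have "\<sigma> (x, z) \<otimes>\<^bsub>loc_stalk X (x, z)\<^esub> \<tau> (x, z) =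
      loc_frac X (x, z) (germ X x U (a \<otimes>\<^bsub>Sec X U\<^esub> b)) (germ X x U (t \<otimes>\<^bsub>Sec X U\<^esub> t))"
    if xz: "(x, z) \<in> loc_basic X M U t" for x z
  proof -
    note t = loc_basicD[OF U(1,2) xz]
    interpret fractions "stalk X x" "carrier (stalk X x) - z" by (rule fractions_M[OF t(2,3)])
    show ?thesis
      using t U by (simp add: eqs xz loc_stalk_Pair loc_frac_Pair fraction_mult stalk_mult)
  qed
  then show "\<exists>U t a. openin (Top X) U \<and> t \<in> carrier (Sec X U) \<and> a \<in> carrier (Sec X U) \<and>
       p \<in> loc_basic X M U t \<and> loc_basic X M U t \<subseteq> V \<and>
       (\<forall>x z. (x, z) \<in> loc_basic X M U t \<longrightarrow> (\<lambda>p\<in>V. \<sigma> p \<otimes>\<^bsub>loc_stalk X p\<^esub> \<tau> p) (x, z) =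
          loc_frac X (x, z) (germ X x U a) (germ X x U t))"
    using U by (intro exI[of _ U] exI[of _ "t \<otimes>\<^bsub>Sec X U\<^esub> t"] exI[of _ "a \<otimes>\<^bsub>Sec X U\<^esub> b"])
      (auto simp: loc_basic_mult)
qed simp

lemma add_loc_sections:
  assumes \<sigma>: "\<sigma> \<in> loc_sections X M V" and \<tau>: "\<tau> \<in> loc_sections X M V"
  shows "(\<lambda>p\<in>V. \<sigma> p \<oplus>\<^bsub>loc_stalk X p\<^esub> \<tau> p) \<in> loc_sections X M V"
proof (rule loc_sectionsI)
  fix p assume p: "p \<in> V"
  obtain U t a b where U: "openin (Top X) U" "t \<in> carrier (Sec X U)" "a \<in> carrier (Sec X U)"
    "b \<in> carrier (Sec X U)" "p \<in> loc_basic X M U t" "loc_basic X M U t \<subseteq> V \<inter> V"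
    and eqs: "\<And>x z. (x, z) \<in> loc_basic X M U t \<Longrightarrow> \<sigma> (x, z) = loc_frac X (x, z) (germ X x U a) (germ X x U t)"
    "\<And>x z. (x, z) \<in> loc_basic X M U t \<Longrightarrow> \<tau> (x, z) = loc_frac X (x, z) (germ X x U b) (germ X x U t)"
    using loc_section_rep2[OF \<sigma> p \<tau> p] by metis
  interpret U: cring "Sec X U" by (rule sections_cring[OF U(1)])
  let ?n = "t \<otimes>\<^bsub>Sec X U\<^esub> a \<oplus>\<^bsub>Sec X U\<^esub> t \<otimes>\<^bsub>Sec X U\<^esub> b"
  have "\<sigma> (x, z) \<oplus>\<^bsub>loc_stalk X (x, z)\<^esub> \<tau> (x, z) =
      loc_frac X (x, z) (germ X x U ?n) (germ X x U (t \<otimes>\<^bsub>Sec X U\<^esub> t))"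
    if xz: "(x, z) \<in> loc_basic X M U t" for x z
  proof -
    note t = loc_basicD[OF U(1,2) xz]
    interpret fractions "stalk X x" "carrier (stalk X x) - z" by (rule fractions_M[OF t(2,3)])
    show ?thesis
      using t U by (simp add: eqs xz loc_stalk_Pair loc_frac_Pair fraction_add stalk_mult stalk_add)
  qed
  then show "\<exists>U t a. openin (Top X) U \<and> t \<in> carrier (Sec X U) \<and> a \<in> carrier (Sec X U) \<and>
       p \<in> loc_basic X M U t \<and> loc_basic X M U t \<subseteq> V \<and>
       (\<forall>x z. (x, z) \<in> loc_basic X M U t \<longrightarrow> (\<lambda>p\<in>V. \<sigma> p \<oplus>\<^bsub>loc_stalk X p\<^esub> \<tau> p) (x, z) =
          loc_frac X (x, z) (germ X x U a) (germ X x U t))"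
    using U by (intro exI[of _ U] exI[of _ "t \<otimes>\<^bsub>Sec X U\<^esub> t"] exI[of _ ?n])
      (auto simp: loc_basic_mult)
qed simp

text \<open>Locally \<open>(-a)/t\<close> is the negative of \<open>a/t\<close>: in their sum the
  numerator \<open>t(-a) + ta\<close> vanishes, and additive inverses are unique.\<close>

lemma uminus_loc_sections:
  assumes \<sigma>: "\<sigma> \<in> loc_sections X M V"
  shows "(\<lambda>p\<in>V. \<ominus>\<^bsub>loc_stalk X p\<^esub> \<sigma> p) \<in> loc_sections X M V"
proof (rule loc_sectionsI)
  fix p assume p: "p \<in> V"
  obtain U t a where U: "openin (Top X) U" "t \<in> carrier (Sec X U)" "a \<in> carrier (Sec X U)"
    "p \<in> loc_basic X M U t" "loc_basic X M U t \<subseteq> V"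
    and \<sigma>: "\<And>x z. (x, z) \<in> loc_basic X M U t \<Longrightarrow> \<sigma> (x, z) = loc_frac X (x, z) (germ X x U a) (germ X x U t)"
    using loc_section_rep[OF \<sigma> p] by metis
  interpret U: cring "Sec X U" by (rule sections_cring[OF U(1)])
  have "\<ominus>\<^bsub>loc_stalk X (x, z)\<^esub> \<sigma> (x, z) = loc_frac X (x, z) (germ X x U (\<ominus>\<^bsub>Sec X U\<^esub> a)) (germ X x U t)"
    if xz: "(x, z) \<in> loc_basic X M U t" for x z
  proof -
    note t = loc_basicD[OF U(1,2) xz]
    let ?S = "carrier (stalk X x) - z"
    let ?L = "localization (stalk X x) ?S"
    interpret fractions "stalk X x" ?S by (rule fractions_M[OF t(2,3)])
    have a: "germ X x U a \<in> carrier (stalk X x)" "germ X x U (\<ominus>\<^bsub>Sec X U\<^esub> a) \<in> carrier (stalk X x)"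
      using t U by auto
    have g: "germ X x U (\<ominus>\<^bsub>Sec X U\<^esub> a) = \<ominus>\<^bsub>stalk X x\<^esub> germ X x U a"
      using t U germ_hom[OF U(1) t(1)] by (intro ring_hom_cring.hom_a_inv)
        (auto intro!: ring_hom_cring.intro ring_hom_cring_axioms.intro is_cring U.is_cring)
    have "fraction (stalk X x) ?S (germ X x U (\<ominus>\<^bsub>Sec X U\<^esub> a)) (germ X x U t) \<oplus>\<^bsub>?L\<^esub>
        fraction (stalk X x) ?S (germ X x U a) (germ X x U t) = \<zero>\<^bsub>?L\<^esub>"
    proof -
      have "germ X x U t \<otimes>\<^bsub>stalk X x\<^esub> germ X x U (\<ominus>\<^bsub>Sec X U\<^esub> a) \<oplus>\<^bsub>stalk X x\<^esub>
          germ X x U t \<otimes>\<^bsub>stalk X x\<^esub> germ X x U a = \<zero>\<^bsub>stalk X x\<^esub>"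
        using a t by (simp add: g r_distr[symmetric] l_neg)
      then show ?thesis
        unfolding fraction_add[OF a(2) t(4) a(1) t(4)] fraction_zero
        using t(4) by (intro fraction_eqI[of _ _ _ _ "\<one>\<^bsub>stalk X x\<^esub>"]) (simp_all del: Diff_iff)
    qed
    then show ?thesis
      using a t loc.minus_equality[of "fraction (stalk X x) ?S (germ X x U (\<ominus>\<^bsub>Sec X U\<^esub> a)) (germ X x U t)"
          "fraction (stalk X x) ?S (germ X x U a) (germ X x U t)"]
      by (simp add: \<sigma> xz loc_stalk_Pair loc_frac_Pair del: Diff_iff)
  qed
  then show "\<exists>U t a. openin (Top X) U \<and> t \<in> carrier (Sec X U) \<and> a \<in> carrier (Sec X U) \<and>
       p \<in> loc_basic X M U t \<and> loc_basic X M U t \<subseteq> V \<and>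
       (\<forall>x z. (x, z) \<in> loc_basic X M U t \<longrightarrow> (\<lambda>p\<in>V. \<ominus>\<^bsub>loc_stalk X p\<^esub> \<sigma> p) (x, z) =
          loc_frac X (x, z) (germ X x U a) (germ X x U t))"
    using U by (intro exI[of _ U] exI[of _ t] exI[of _ "\<ominus>\<^bsub>Sec X U\<^esub> a"]) auto
qed simp

lemma zero_loc_sections:
  assumes V: "openin (loc_topology X M) V"
  shows "(\<lambda>p\<in>V. \<zero>\<^bsub>loc_stalk X p\<^esub>) \<in> loc_sections X M V"
proof -
  let ?one = "\<lambda>p\<in>V. \<one>\<^bsub>loc_stalk X p\<^esub>"
  \<comment> \<open>Zero is written as minus one plus one, so that closure under negation and
    addition applies.\<close>
  have "(\<lambda>p\<in>V. \<zero>\<^bsub>loc_stalk X p\<^esub>) = (\<lambda>p\<in>V. (\<lambda>p\<in>V. \<ominus>\<^bsub>loc_stalk X p\<^esub> ?one p) p \<oplus>\<^bsub>loc_stalk X p\<^esub> ?one p)"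
  proof (rule restrict_ext)
    fix p assume p: "p \<in> V"
    obtain x z where xz: "p = (x, z)" by fastforce
    interpret cring "loc_stalk X p"
      using cring_loc_stalk openin_loc_topologyD[OF V] p unfolding xz by blast
    show "\<zero>\<^bsub>loc_stalk X p\<^esub> = (\<lambda>p\<in>V. \<ominus>\<^bsub>loc_stalk X p\<^esub> ?one p) p \<oplus>\<^bsub>loc_stalk X p\<^esub> ?one p"
      using p by (simp add: l_neg)
  qed
  then show ?thesis
    using V by (simp only: add_loc_sections uminus_loc_sections one_loc_sections)
qed

lemma cring_loc_sections:
  assumes V: "openin (loc_topology X M) V"
  shows "cring (Sec (loc_space X M) V)"
proof -
  have cr: "cring (loc_stalk X p)" if "p \<in> V" for p
    using cring_loc_stalk openin_loc_topologyD[OF V, of "fst p" "snd p"] that by (cases p) auto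
  have val: "\<sigma> p \<in> carrier (loc_stalk X p)" if "\<sigma> \<in> loc_sections X M V" "p \<in> V" for \<sigma> p
    using that by (rule loc_sections_value)
  have ext: "(\<lambda>p\<in>V. \<sigma> p) = \<sigma>" if "\<sigma> \<in> loc_sections X M V" for \<sigma>
    using loc_sections_extensional[OF that] by (rule extensional_restrict)
  show ?thesis
  proof (intro cringI abelian_groupI comm_monoidI)
    fix \<sigma> \<tau> assume "\<sigma> \<in> carrier (Sec (loc_space X M) V)" "\<tau> \<in> carrier (Sec (loc_space X M) V)"
    then show "\<sigma> \<oplus>\<^bsub>Sec (loc_space X M) V\<^esub> \<tau> \<in> carrier (Sec (loc_space X M) V)"
      "\<sigma> \<otimes>\<^bsub>Sec (loc_space X M) V\<^esub> \<tau> \<in> carrier (Sec (loc_space X M) V)"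
      "\<sigma> \<oplus>\<^bsub>Sec (loc_space X M) V\<^esub> \<tau> = \<tau> \<oplus>\<^bsub>Sec (loc_space X M) V\<^esub> \<sigma>"
      "\<sigma> \<otimes>\<^bsub>Sec (loc_space X M) V\<^esub> \<tau> = \<tau> \<otimes>\<^bsub>Sec (loc_space X M) V\<^esub> \<sigma>"
      using cring.cring_simprules(10,14)[OF cr] val
      by (auto simp: add_loc_sections mult_loc_sections intro!: restrict_ext)
  next
    fix \<rho> \<sigma> \<tau> assume "\<rho> \<in> carrier (Sec (loc_space X M) V)"
      "\<sigma> \<in> carrier (Sec (loc_space X M) V)" "\<tau> \<in> carrier (Sec (loc_space X M) V)"
    then show "\<rho> \<oplus>\<^bsub>Sec (loc_space X M) V\<^esub> \<sigma> \<oplus>\<^bsub>Sec (loc_space X M) V\<^esub> \<tau> =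
        \<rho> \<oplus>\<^bsub>Sec (loc_space X M) V\<^esub> (\<sigma> \<oplus>\<^bsub>Sec (loc_space X M) V\<^esub> \<tau>)"
      "\<rho> \<otimes>\<^bsub>Sec (loc_space X M) V\<^esub> \<sigma> \<otimes>\<^bsub>Sec (loc_space X M) V\<^esub> \<tau> =
        \<rho> \<otimes>\<^bsub>Sec (loc_space X M) V\<^esub> (\<sigma> \<otimes>\<^bsub>Sec (loc_space X M) V\<^esub> \<tau>)"
      "(\<rho> \<oplus>\<^bsub>Sec (loc_space X M) V\<^esub> \<sigma>) \<otimes>\<^bsub>Sec (loc_space X M) V\<^esub> \<tau> =
        \<rho> \<otimes>\<^bsub>Sec (loc_space X M) V\<^esub> \<tau> \<oplus>\<^bsub>Sec (loc_space X M) V\<^esub> \<sigma> \<otimes>\<^bsub>Sec (loc_space X M) V\<^esub> \<tau>"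
      using cring.cring_simprules(7,11,13)[OF cr] val by (auto intro!: restrict_ext)
  next
    fix \<sigma> assume \<sigma>: "\<sigma> \<in> carrier (Sec (loc_space X M) V)"
    have "(\<lambda>p\<in>V. \<zero>\<^bsub>loc_stalk X p\<^esub> \<oplus>\<^bsub>loc_stalk X p\<^esub> \<sigma> p) = (\<lambda>p\<in>V. \<sigma> p)"
      "(\<lambda>p\<in>V. \<one>\<^bsub>loc_stalk X p\<^esub> \<otimes>\<^bsub>loc_stalk X p\<^esub> \<sigma> p) = (\<lambda>p\<in>V. \<sigma> p)"
      "(\<lambda>p\<in>V. \<ominus>\<^bsub>loc_stalk X p\<^esub> \<sigma> p \<oplus>\<^bsub>loc_stalk X p\<^esub> \<sigma> p) = (\<lambda>p\<in>V. \<zero>\<^bsub>loc_stalk X p\<^esub>)"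
      using cring.cring_simprules(8,9,12)[OF cr] val \<sigma> by (auto intro!: restrict_ext)
    note this = this[unfolded ext[OF \<sigma>[simplified]]]
    then show "\<zero>\<^bsub>Sec (loc_space X M) V\<^esub> \<oplus>\<^bsub>Sec (loc_space X M) V\<^esub> \<sigma> = \<sigma>"
      "\<one>\<^bsub>Sec (loc_space X M) V\<^esub> \<otimes>\<^bsub>Sec (loc_space X M) V\<^esub> \<sigma> = \<sigma>"
      "\<exists>\<tau>\<in>carrier (Sec (loc_space X M) V). \<tau> \<oplus>\<^bsub>Sec (loc_space X M) V\<^esub> \<sigma> = \<zero>\<^bsub>Sec (loc_space X M) V\<^esub>"
      using \<sigma> uminus_loc_sections
      by (auto intro!: bexI[of _ "\<lambda>p\<in>V. \<ominus>\<^bsub>loc_stalk X p\<^esub> \<sigma> p"] cong: restrict_cong)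
  qed (use V zero_loc_sections one_loc_sections in auto)
qed

lemma restrict_loc_sections:
  assumes \<sigma>: "\<sigma> \<in> loc_sections X M V" and W: "openin (loc_topology X M) W" "W \<subseteq> V"
  shows "restrict \<sigma> W \<in> loc_sections X M W"
proof (rule loc_sectionsI)
  fix p assume p: "p \<in> W"
  \<comment> \<open>The constant section one on \<open>W\<close> serves as the second section: its
    only effect is to move the basic set into \<open>V \<inter> W\<close>.\<close>
  obtain U t a where U: "openin (Top X) U" "t \<in> carrier (Sec X U)" "a \<in> carrier (Sec X U)"
    "p \<in> loc_basic X M U t" "loc_basic X M U t \<subseteq> V \<inter> W"
    and \<sigma>: "\<And>x z. (x, z) \<in> loc_basic X M U t \<Longrightarrow> \<sigma> (x, z) = loc_frac X (x, z) (germ X x U a) (germ X x U t)"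
    using loc_section_rep2[OF \<sigma> subsetD[OF W(2) p] one_loc_sections[OF W(1)] p] by metis
  then show "\<exists>U t a. openin (Top X) U \<and> t \<in> carrier (Sec X U) \<and> a \<in> carrier (Sec X U) \<and>
       p \<in> loc_basic X M U t \<and> loc_basic X M U t \<subseteq> W \<and>
       (\<forall>x z. (x, z) \<in> loc_basic X M U t \<longrightarrow> restrict \<sigma> W (x, z) =
          loc_frac X (x, z) (germ X x U a) (germ X x U t))"
    by (intro exI[of _ U] exI[of _ t] exI[of _ a]) auto
qed simp

lemma glue_loc_sections:
  assumes "\<And>U. U \<in> \<U> \<Longrightarrow> openin (loc_topology X M) U"
    and \<sigma>: "\<And>U. U \<in> \<U> \<Longrightarrow> \<sigma> U \<in> loc_sections X M U"
    and compat: "\<And>U V. \<lbrakk>U \<in> \<U>; V \<in> \<U>\<rbrakk> \<Longrightarrow> restrict (\<sigma> U) (U \<inter> V) = restrict (\<sigma> V) (U \<inter> V)"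
  shows "\<exists>s\<in>loc_sections X M (\<Union>\<U>). \<forall>U\<in>\<U>. restrict s U = \<sigma> U"
proof -
  \<comment> \<open>Compatibility on overlaps makes the value independent of the chosen member
    containing \<open>p\<close>.\<close>
  define s where "s = (\<lambda>p\<in>\<Union>\<U>. \<sigma> (SOME U. U \<in> \<U> \<and> p \<in> U) p)"
  have s: "s p = \<sigma> U p" if "U \<in> \<U>" "p \<in> U" for U p
  proof -
    let ?V = "SOME U. U \<in> \<U> \<and> p \<in> U"
    have V: "?V \<in> \<U> \<and> p \<in> ?V" using that by (intro someI[of "\<lambda>U. U \<in> \<U> \<and> p \<in> U"]) auto
    have "\<sigma> ?V p = \<sigma> U p"
      using fun_cong[OF compat[of ?V U], of p] V that by simp
    then show ?thesis using that by (auto simp: s_def)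
  qed
  have "s \<in> loc_sections X M (\<Union>\<U>)"
  proof (rule loc_sectionsI)
    fix p assume "p \<in> \<Union>\<U>"
    then obtain V where V: "V \<in> \<U>" "p \<in> V" by auto
    obtain U t a where U: "openin (Top X) U" "t \<in> carrier (Sec X U)" "a \<in> carrier (Sec X U)"
      "p \<in> loc_basic X M U t" "loc_basic X M U t \<subseteq> V"
      and eq: "\<And>x z. (x, z) \<in> loc_basic X M U t \<Longrightarrow> \<sigma> V (x, z) = loc_frac X (x, z) (germ X x U a) (germ X x U t)"
      using loc_section_rep[OF \<sigma>[OF V(1)] V(2)] by metis
    have "s (x, z) = loc_frac X (x, z) (germ X x U a) (germ X x U t)"
      if "(x, z) \<in> loc_basic X M U t" for x z
      using eq[OF that] s[OF V(1), of "(x, z)"] U(5) that by auto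
    then show "\<exists>U t a. openin (Top X) U \<and> t \<in> carrier (Sec X U) \<and> a \<in> carrier (Sec X U) \<and>
       p \<in> loc_basic X M U t \<and> loc_basic X M U t \<subseteq> \<Union>\<U> \<and>
       (\<forall>x z. (x, z) \<in> loc_basic X M U t \<longrightarrow> s (x, z) = loc_frac X (x, z) (germ X x U a) (germ X x U t))"
      using U V by (intro exI[of _ U] exI[of _ t] exI[of _ a]) auto
  qed (simp add: s_def)
  moreover have "restrict s U = \<sigma> U" if U: "U \<in> \<U>" for U
    using s[OF U] loc_sections_extensional[OF \<sigma>[OF U]]
    by (intro extensionalityI[of _ U]) auto
  ultimately show ?thesis by blast
qed

lemma ringed_space_loc_space: "ringed_space (loc_space X M)"
proof (rule ringed_space.intro)
  fix U V assume "openin (Top (loc_space X M)) U" "openin (Top (loc_space X M)) V" and VU: "V \<subseteq> U"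
  then show "Res (loc_space X M) U V \<in> ring_hom (Sec (loc_space X M) U) (Sec (loc_space X M) V)"
    by (intro ring_hom_memI) (auto simp: restrict_loc_sections fun_eq_iff)
next
  fix \<U> s t
  assume st: "s \<in> carrier (Sec (loc_space X M) (\<Union>\<U>))" "t \<in> carrier (Sec (loc_space X M) (\<Union>\<U>))"
    and eq: "\<And>U. U \<in> \<U> \<Longrightarrow> Res (loc_space X M) (\<Union>\<U>) U s = Res (loc_space X M) (\<Union>\<U>) U t"
  show "s = t"
  proof (rule extensionalityI[of _ "\<Union>\<U>"])
    fix p assume "p \<in> \<Union>\<U>"
    then obtain U where "U \<in> \<U>" "p \<in> U" by auto
    then show "s p = t p" using fun_cong[OF eq, of U p] by simp
  qed (use st loc_sections_extensional in auto)
next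
  fix \<U> \<sigma>
  assume A: "\<And>U. U \<in> \<U> \<Longrightarrow> openin (Top (loc_space X M)) U"
    "\<And>U. U \<in> \<U> \<Longrightarrow> \<sigma> U \<in> carrier (Sec (loc_space X M) U)"
    "\<And>U V. \<lbrakk>U \<in> \<U>; V \<in> \<U>\<rbrakk> \<Longrightarrow>
      Res (loc_space X M) U (U \<inter> V) (\<sigma> U) = Res (loc_space X M) V (U \<inter> V) (\<sigma> V)"
  show "\<exists>s\<in>carrier (Sec (loc_space X M) (\<Union>\<U>)). \<forall>U\<in>\<U>. Res (loc_space X M) (\<Union>\<U>) U s = \<sigma> U"
    unfolding carrier_Sec_loc_space Res_loc_space
    by (rule glue_loc_sections) (use A in simp_all)
qed (use cring_loc_sections loc_sections_extensional in
    \<open>auto simp: extensional_restrict Int_absorb1 Int_absorb2\<close>)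

sublocale loc: ringed_space "loc_space X M"
  by (rule ringed_space_loc_space)

end

subsection \<open>The stalks\<close>

text \<open>The union runs over the representatives of a germ at \<open>p\<close>; all of them take
  the same value there. This is the canonical map from the stalk of the structure sheaf to the ring
  of fractions.\<close>

definition loc_eval ::
  "('a, 'r) loc_point \<Rightarrow> (('a, 'r) loc_point, ('a, 'r) loc_section) germ \<Rightarrow>
   (('a, 'r) germ \<times> ('a, 'r) germ) set" where
  "loc_eval p A = (\<Union>(V, \<sigma>)\<in>A. \<sigma> p)"

text \<open>For a prime \<open>z\<close> of the stalk this is the extension of \<open>z\<close> to
  the localization, its maximal ideal.\<close>

definition loc_max :: "('a, 'r) rspace \<Rightarrow> ('a, 'r) loc_point \<Rightarrow> (('a, 'r) germ \<times> ('a, 'r) germ) set set" where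
  "loc_max X = (\<lambda>(x, z). {loc_frac X (x, z) A B | A B. A \<in> z \<and> B \<in> carrier (stalk X x) - z})"

context primed_ringed_space
begin

lemma loc_eval_germ:
  assumes "openin (loc_topology X M) V" "p \<in> V" "\<sigma> \<in> loc_sections X M V"
  shows "loc_eval p (germ (loc_space X M) p V \<sigma>) = \<sigma> p"
proof -
  have "\<tau> p = \<sigma> p" if mem: "(W, \<tau>) \<in> germ (loc_space X M) p V \<sigma>" for W \<tau>
  proof -
    obtain Q where "p \<in> Q" "restrict \<sigma> Q = restrict \<tau> Q"
      using mem by (auto simp: loc.mem_germ_iff)
    then show ?thesis by (metis restrict_apply')
  qed
  moreover have "(V, \<sigma>) \<in> germ (loc_space X M) p V \<sigma>"
    using assms by (intro loc.germ_self) auto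
  ultimately show ?thesis unfolding loc_eval_def by blast
qed

lemma loc_eval_hom:
  assumes p: "p \<in> points (loc_space X M)"
  shows "loc_eval p \<in> ring_hom (stalk (loc_space X M) p) (loc_stalk X p)"
proof (rule ring_hom_memI)
  fix A assume "A \<in> carrier (stalk (loc_space X M) p)"
  then obtain V \<sigma> where "openin (loc_topology X M) V" "p \<in> V" "\<sigma> \<in> loc_sections X M V"
    "A = germ (loc_space X M) p V \<sigma>"
    by (rule loc.stalk_cases) simp
  then show "loc_eval p A \<in> carrier (loc_stalk X p)"
    by (simp add: loc_eval_germ loc_sections_value)
next
  fix A B assume "A \<in> carrier (stalk (loc_space X M) p)" "B \<in> carrier (stalk (loc_space X M) p)"
  then obtain V \<sigma> \<tau> where V: "openin (loc_topology X M) V" "p \<in> V" "\<sigma> \<in> loc_sections X M V"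
    "\<tau> \<in> loc_sections X M V" "A = germ (loc_space X M) p V \<sigma>" "B = germ (loc_space X M) p V \<tau>"
    by (rule loc.stalk_cases2) simp
  have "A \<otimes>\<^bsub>stalk (loc_space X M) p\<^esub> B = germ (loc_space X M) p V (\<lambda>p\<in>V. \<sigma> p \<otimes>\<^bsub>loc_stalk X p\<^esub> \<tau> p)"
    "A \<oplus>\<^bsub>stalk (loc_space X M) p\<^esub> B = germ (loc_space X M) p V (\<lambda>p\<in>V. \<sigma> p \<oplus>\<^bsub>loc_stalk X p\<^esub> \<tau> p)"
    using V by (simp_all add: loc.stalk_mult loc.stalk_add)
  then show "loc_eval p (A \<otimes>\<^bsub>stalk (loc_space X M) p\<^esub> B) = loc_eval p A \<otimes>\<^bsub>loc_stalk X p\<^esub> loc_eval p B"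
    "loc_eval p (A \<oplus>\<^bsub>stalk (loc_space X M) p\<^esub> B) = loc_eval p A \<oplus>\<^bsub>loc_stalk X p\<^esub> loc_eval p B"
    using V by (simp_all add: loc_eval_germ mult_loc_sections add_loc_sections)
next
  have o: "openin (Top (loc_space X M)) (points (loc_space X M))" by (rule openin_topspace)
  show "loc_eval p \<one>\<^bsub>stalk (loc_space X M) p\<^esub> = \<one>\<^bsub>loc_stalk X p\<^esub>"
    using p o by (simp add: loc.stalk_one[OF o p] loc_eval_germ one_loc_sections)
qed

lemma loc_frac_mem_loc_max_iff:
  assumes "x \<in> points X" "z \<in> M x" "A \<in> carrier (stalk X x)" "B \<in> carrier (stalk X x) - z"
  shows "loc_frac X (x, z) A B \<in> loc_max X (x, z) \<longleftrightarrow> A \<in> z"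
proof -
  interpret primeideal z "stalk X x" using assms by (intro primeideal_M)
  show ?thesis
  proof
    assume "loc_frac X (x, z) A B \<in> loc_max X (x, z)"
    then obtain C D where "C \<in> z" "D \<in> carrier (stalk X x) - z"
      "fraction (stalk X x) (carrier (stalk X x) - z) A B = fraction (stalk X x) (carrier (stalk X x) - z) C D"
      unfolding loc_max_def loc_frac_Pair by auto
    then show "A \<in> z" using fraction_prime_iff[of A C B D] assms(3,4) Icarr by blast
  qed (use assms(4) in \<open>auto simp: loc_max_def\<close>)
qed

lemma ideal_loc_max:
  assumes "x \<in> points X" "z \<in> M x"
  shows "ideal (loc_max X (x, z)) (loc_stalk X (x, z))"
proof -
  interpret primeideal z "stalk X x" using assms by (intro primeideal_M)
  show ?thesis using ideal_fractions by (simp add: loc_max_def loc_stalk_Pair loc_frac_Pair)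
qed

text \<open>Near \<open>p\<close> the section is \<open>a/t\<close>, and a value outside
  \<open>loc_max\<close> means that the germ of \<open>a\<close> avoids the prime. Hence
  \<open>p\<close> lies in the basic set of \<open>ta\<close>, where \<open>t/a\<close> is an
  inverse.\<close>

lemma germ_loc_space_Units:
  assumes V: "openin (loc_topology X M) V" "p \<in> V" "\<sigma> \<in> loc_sections X M V"
    and notin: "\<sigma> p \<notin> loc_max X p"
  shows "germ (loc_space X M) p V \<sigma> \<in> Units (stalk (loc_space X M) p)"
proof -
  obtain x z where p: "p = (x, z)" by fastforce
  obtain U t a where U: "openin (Top X) U" "t \<in> carrier (Sec X U)" "a \<in> carrier (Sec X U)"
    "p \<in> loc_basic X M U t" "loc_basic X M U t \<subseteq> V"
    and \<sigma>: "\<And>x z. (x, z) \<in> loc_basic X M U t \<Longrightarrow> \<sigma> (x, z) = loc_frac X (x, z) (germ X x U a) (germ X x U t)"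
    using loc_section_rep[OF V(3,2)] by metis
  interpret U: cring "Sec X U" by (rule sections_cring[OF U(1)])
  interpret S: cring "stalk (loc_space X M) p"
    using V openin_subset by (intro loc.cring_stalk) auto
  note t = loc_basicD[OF U(1,2) U(4)[unfolded p]]
  have "germ X x U a \<notin> z"
    using notin t U \<sigma>[of x z] loc_frac_mem_loc_max_iff[OF t(2,3)] by (simp add: p)
  then have pa: "p \<in> loc_basic X M U a" using t by (simp add: p mem_loc_basic)
  define W where "W = loc_basic X M U (t \<otimes>\<^bsub>Sec X U\<^esub> a)"
  have W: "openin (loc_topology X M) W" "p \<in> W" "W \<subseteq> V"
    "\<And>q. q \<in> W \<longleftrightarrow> q \<in> loc_basic X M U t \<and> q \<in> loc_basic X M U a"
    using U pa openin_loc_basic by (auto simp: W_def loc_basic_mult)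
  \<comment> \<open>The inverse \<open>t/a\<close> is expanded to \<open>t^2/(ta)\<close> so that
    its denominator is the section that defines \<open>W\<close>.\<close>
  define \<tau> where "\<tau> = (\<lambda>(x, z)\<in>W. loc_frac X (x, z) (germ X x U (t \<otimes>\<^bsub>Sec X U\<^esub> t)) (germ X x U (t \<otimes>\<^bsub>Sec X U\<^esub> a)))"
  have \<tau>: "\<tau> \<in> loc_sections X M W"
    unfolding \<tau>_def W_def using U by (intro loc_section_frac) auto
  have \<sigma>W: "restrict \<sigma> W \<in> loc_sections X M W"
    using V W by (intro restrict_loc_sections)
  have "restrict \<sigma> W q \<otimes>\<^bsub>loc_stalk X q\<^esub> \<tau> q = \<one>\<^bsub>loc_stalk X q\<^esub>" if q: "q \<in> W" for q
  proof -
    obtain y w where yw: "q = (y, w)" by fastforce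
    have qt: "(y, w) \<in> loc_basic X M U t" and qa: "(y, w) \<in> loc_basic X M U a"
      using q W(4) by (auto simp: yw)
    note t = loc_basicD[OF U(1,2) qt] and a = loc_basicD[OF U(1,3) qa]
    interpret fractions "stalk X y" "carrier (stalk X y) - w" by (rule fractions_M[OF t(2,3)])
    let ?t = "germ X y U t" and ?a = "germ X y U a"
    let ?F = "fraction (stalk X y) (carrier (stalk X y) - w)"
    have c: "?t \<in> carrier (stalk X y)" "?a \<in> carrier (stalk X y)"
      "?t \<otimes>\<^bsub>stalk X y\<^esub> ?a \<in> carrier (stalk X y) - w" using t(4) a(4) m_closed[OF t(4) a(4)] by auto
    have "restrict \<sigma> W q \<otimes>\<^bsub>loc_stalk X q\<^esub> \<tau> q = ?F ?a ?t \<otimes>\<^bsub>loc_stalk X q\<^esub> ?F (?t \<otimes>\<^bsub>stalk X y\<^esub> ?t) (?t \<otimes>\<^bsub>stalk X y\<^esub> ?a)"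
      using q qt U t(1) by (simp add: yw \<tau>_def \<sigma> loc_frac_Pair stalk_mult)
    also have "\<dots> = ?F (?a \<otimes>\<^bsub>stalk X y\<^esub> (?t \<otimes>\<^bsub>stalk X y\<^esub> ?t)) (?t \<otimes>\<^bsub>stalk X y\<^esub> (?t \<otimes>\<^bsub>stalk X y\<^esub> ?a))"
      unfolding yw loc_stalk_Pair using c t(4) by (intro fraction_mult) auto
    also have "?a \<otimes>\<^bsub>stalk X y\<^esub> (?t \<otimes>\<^bsub>stalk X y\<^esub> ?t) = (?t \<otimes>\<^bsub>stalk X y\<^esub> (?t \<otimes>\<^bsub>stalk X y\<^esub> ?a)) \<otimes>\<^bsub>stalk X y\<^esub> \<one>\<^bsub>stalk X y\<^esub>"
      using c by (simp add: m_ac)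
    also have "?F \<dots> (?t \<otimes>\<^bsub>stalk X y\<^esub> (?t \<otimes>\<^bsub>stalk X y\<^esub> ?a)) =
        ?F ((?t \<otimes>\<^bsub>stalk X y\<^esub> (?t \<otimes>\<^bsub>stalk X y\<^esub> ?a)) \<otimes>\<^bsub>stalk X y\<^esub> \<one>\<^bsub>stalk X y\<^esub>) ((?t \<otimes>\<^bsub>stalk X y\<^esub> (?t \<otimes>\<^bsub>stalk X y\<^esub> ?a)) \<otimes>\<^bsub>stalk X y\<^esub> \<one>\<^bsub>stalk X y\<^esub>)"
      using c by simp
    also have "\<dots> = ?F \<one>\<^bsub>stalk X y\<^esub> \<one>\<^bsub>stalk X y\<^esub>"
      using m_closed[OF t(4) c(3)] by (intro fraction_cancel) (simp_all del: Diff_iff)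
    finally show ?thesis by (simp add: yw loc_stalk_Pair fraction_one)
  qed
  then have "restrict \<sigma> W \<otimes>\<^bsub>Sec (loc_space X M) W\<^esub> \<tau> = \<one>\<^bsub>Sec (loc_space X M) W\<^esub>"
    by (simp cong: restrict_cong)
  then have "germ (loc_space X M) p W (restrict \<sigma> W) \<otimes>\<^bsub>stalk (loc_space X M) p\<^esub> germ (loc_space X M) p W \<tau> =
      \<one>\<^bsub>stalk (loc_space X M) p\<^esub>"
    using W \<sigma>W \<tau> loc.stalk_mult[of W p "restrict \<sigma> W" \<tau>] loc.stalk_one[of W p]
    by (simp del: mult_Sec_loc_space one_Sec_loc_space)
  moreover have "germ (loc_space X M) p W (restrict \<sigma> W) = germ (loc_space X M) p V \<sigma>"
    using loc.germ_restriction[of V W p \<sigma>] V W by simp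
  moreover have "germ (loc_space X M) p V \<sigma> \<in> carrier (stalk (loc_space X M) p)"
    "germ (loc_space X M) p W \<tau> \<in> carrier (stalk (loc_space X M) p)"
    using V W \<tau> by simp_all
  ultimately show ?thesis
    using S.m_comm by (auto simp: Units_def intro!: bexI[of _ "germ (loc_space X M) p W \<tau>"])
qed

text \<open>The pullback of \<open>loc_max\<close> along evaluation is a proper ideal, and every
  germ outside it is a unit; \<open>local_ringI\<close> turns this into both claims.\<close>

lemma
  assumes p: "p \<in> points (loc_space X M)"
  shows local_ring_stalk_loc_space: "local_ring (stalk (loc_space X M) p)"
    and max_ideal_stalk_loc_space: "max_ideal (stalk (loc_space X M) p) =
      {A \<in> carrier (stalk (loc_space X M) p). loc_eval p A \<in> loc_max X p}" (is "_ = ?I")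
proof -
  obtain x z where xz: "p = (x, z)" "x \<in> points X" "z \<in> M x" using p unfolding points_loc_space by auto
  interpret S: cring "stalk (loc_space X M) p" by (rule loc.cring_stalk[OF p])
  interpret T: cring "loc_stalk X p" unfolding xz by (rule cring_loc_stalk[OF xz(2,3)])
  interpret fractions "stalk X x" "carrier (stalk X x) - z" by (rule fractions_M[OF xz(2,3)])
  have "ideal ?I (stalk (loc_space X M) p)"
    using ideal_loc_max[OF xz(2,3)] unfolding xz(1)[symmetric]
    by (rule ideal_vimage[OF loc_eval_hom[OF p] S.is_cring T.is_cring])
  moreover have "?I \<noteq> carrier (stalk (loc_space X M) p)"
  proof
    assume "?I = carrier (stalk (loc_space X M) p)"
    then have "loc_eval p \<one>\<^bsub>stalk (loc_space X M) p\<^esub> \<in> loc_max X p" using S.one_closed by blast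
    then have "loc_frac X (x, z) \<one>\<^bsub>stalk X x\<^esub> \<one>\<^bsub>stalk X x\<^esub> \<in> loc_max X (x, z)"
      by (simp add: ring_hom_one[OF loc_eval_hom[OF p]]) (simp add: xz loc_stalk_Pair loc_frac_Pair fraction_one)
    then show False
      using one_closed loc_frac_mem_loc_max_iff[OF xz(2,3), of "\<one>\<^bsub>stalk X x\<^esub>" "\<one>\<^bsub>stalk X x\<^esub>"] by auto
  qed
  moreover have "A \<in> Units (stalk (loc_space X M) p)"
    if A: "A \<in> carrier (stalk (loc_space X M) p)" "A \<notin> ?I" for A
  proof -
    obtain V \<sigma> where V: "openin (loc_topology X M) V" "p \<in> V" "\<sigma> \<in> loc_sections X M V"
      "A = germ (loc_space X M) p V \<sigma>"
      using A(1) by (rule loc.stalk_cases) simp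
    then show ?thesis using A germ_loc_space_Units[OF V(1-3)] by (simp add: loc_eval_germ)
  qed
  ultimately show "local_ring (stalk (loc_space X M) p)" "max_ideal (stalk (loc_space X M) p) = ?I"
    using local_ringI[OF S.is_cring, of ?I] by blast+
qed

lemma germ_mem_max_ideal_loc_space:
  assumes "openin (loc_topology X M) V" "p \<in> V" "\<sigma> \<in> loc_sections X M V"
  shows "germ (loc_space X M) p V \<sigma> \<in> max_ideal (stalk (loc_space X M) p) \<longleftrightarrow> \<sigma> p \<in> loc_max X p"
proof -
  have "p \<in> points (loc_space X M)" using assms openin_subset by (metis Top_loc_space subsetD)
  then show ?thesis using assms by (simp add: max_ideal_stalk_loc_space loc_eval_germ)
qed

lemma locally_ringed_loc_space: "locally_ringed_space (loc_space X M)"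
  by (intro locally_ringed_space.intro ringed_space_loc_space locally_ringed_space_axioms.intro
      local_ring_stalk_loc_space)

subsection \<open>The projection\<close>

lemma pt_loc_proj: "(x, z) \<in> points (loc_space X M) \<Longrightarrow> pt (loc_proj X M) (x, z) = x"
  by (simp add: loc_proj_def)

lemma preim_loc_proj:
  assumes U: "openin (Top X) U"
  shows "preim (loc_space X M) (loc_proj X M) U = loc_basic X M U \<one>\<^bsub>Sec X U\<^esub>"
  using openin_subset[OF U] points_loc_space
  by (auto simp: preim_def loc_basic_one[OF U] loc_proj_def)

text \<open>With the domain written as a basic set and the denominator as the germ of one, the image
  has the form to which \<open>loc_section_frac\<close> applies.\<close>

lemma sharp_loc_proj:
  assumes "openin (Top X) U" "s \<in> carrier (Sec X U)"
  shows "sharp (loc_proj X M) U s =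
    (\<lambda>(x, z)\<in>loc_basic X M U \<one>\<^bsub>Sec X U\<^esub>. loc_frac X (x, z) (germ X x U s) (germ X x U \<one>\<^bsub>Sec X U\<^esub>))"
proof -
  have eq: "{p \<in> points (loc_space X M). fst p \<in> U} = loc_basic X M U \<one>\<^bsub>Sec X U\<^esub>"
    using openin_subset[OF assms(1)] points_loc_space by (auto simp: loc_basic_one[OF assms(1)])
  have "sharp (loc_proj X M) U s =
    (\<lambda>(x, z)\<in>{p \<in> points (loc_space X M). fst p \<in> U}. loc_frac X (x, z) (germ X x U s) \<one>\<^bsub>stalk X x\<^esub>)"
    using assms by (simp add: loc_proj_def)
  also have "\<dots> = (\<lambda>(x, z)\<in>loc_basic X M U \<one>\<^bsub>Sec X U\<^esub>. loc_frac X (x, z) (germ X x U s) (germ X x U \<one>\<^bsub>Sec X U\<^esub>))"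
    unfolding eq by (rule restrict_ext) (auto simp: loc_basic_one[OF assms(1)] stalk_one[OF assms(1)])
  finally show ?thesis .
qed

lemma loc_proj_hom: "loc_proj X M \<in> rs_hom (loc_space X M) X"
proof -
  let ?L = "loc_space X M" and ?p = "loc_proj X M"
  have "continuous_map (Top ?L) (Top X) (pt ?p)"
    unfolding continuous_map_def
  proof (intro conjI allI impI)
    show "pt ?p \<in> topspace (Top ?L) \<rightarrow> topspace (Top X)"
      using points_loc_space by (auto simp: loc_proj_def)
    fix U assume U: "openin (Top X) U"
    interpret U: cring "Sec X U" by (rule sections_cring[OF U])
    show "openin (Top ?L) {x \<in> topspace (Top ?L). pt ?p x \<in> U}"
      using preim_loc_proj[OF U] openin_loc_basic[OF U U.one_closed] by (simp add: preim_def)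
  qed
  moreover have "sharp ?p U \<in> ring_hom (Sec X U) (Sec ?L (preim ?L ?p U))" if U: "openin (Top X) U" for U
  proof -
    interpret U: cring "Sec X U" by (rule sections_cring[OF U])
    let ?B = "loc_basic X M U \<one>\<^bsub>Sec X U\<^esub>"
    have F: "x \<in> U \<and> x \<in> points X \<and> z \<in> M x \<and> fractions (stalk X x) (carrier (stalk X x) - z)"
      if "(x, z) \<in> ?B" for x z
      using loc_basicD[OF U U.one_closed that] fractions_M by auto
    note sh = sharp_loc_proj[OF U]
    show ?thesis
      unfolding preim_loc_proj[OF U]
    proof (rule ring_hom_memI)
      show "sharp ?p U s \<in> carrier (Sec ?L ?B)" if "s \<in> carrier (Sec X U)" for s
        using that U by (simp add: sh loc_section_frac)
      show "sharp ?p U (s \<otimes>\<^bsub>Sec X U\<^esub> t) = sharp ?p U s \<otimes>\<^bsub>Sec ?L ?B\<^esub> sharp ?p U t"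
        and "sharp ?p U (s \<oplus>\<^bsub>Sec X U\<^esub> t) = sharp ?p U s \<oplus>\<^bsub>Sec ?L ?B\<^esub> sharp ?p U t"
        if st: "s \<in> carrier (Sec X U)" "t \<in> carrier (Sec X U)" for s t
      proof -
        have h: "(\<lambda>a. fraction (stalk X x) (carrier (stalk X x) - z) a \<one>\<^bsub>stalk X x\<^esub>)
            \<in> ring_hom (stalk X x) (loc_stalk X (x, z))" "x \<in> U" if "(x, z) \<in> ?B" for x z
          using F[OF that] fractions.fraction_hom by (auto simp: loc_stalk_Pair)
        have g: "germ X x U s \<in> carrier (stalk X x)" "germ X x U t \<in> carrier (stalk X x)"
          if "(x, z) \<in> ?B" for x z using F[OF that] U st by auto
        show "sharp ?p U (s \<otimes>\<^bsub>Sec X U\<^esub> t) = sharp ?p U s \<otimes>\<^bsub>Sec ?L ?B\<^esub> sharp ?p U t"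
          "sharp ?p U (s \<oplus>\<^bsub>Sec X U\<^esub> t) = sharp ?p U s \<oplus>\<^bsub>Sec ?L ?B\<^esub> sharp ?p U t"
          using st U ring_hom_mult[OF h(1) g] ring_hom_add[OF h(1) g] h(2)
          by (auto simp: sh loc_frac_Pair stalk_mult[symmetric] stalk_add[symmetric] stalk_one[OF U, symmetric]
            intro!: restrict_ext)
      qed
      show "sharp ?p U \<one>\<^bsub>Sec X U\<^esub> = \<one>\<^bsub>Sec ?L ?B\<^esub>"
        using F U by (auto simp: sh loc_frac_Pair loc_stalk_Pair fractions.fraction_one stalk_one[OF U, symmetric]
            intro!: restrict_ext)
    qed
  qed
  moreover have "sharp ?p W (Res X V W s) = Res ?L (preim ?L ?p V) (preim ?L ?p W) (sharp ?p V s)"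
    if VW: "openin (Top X) V" "openin (Top X) W" "W \<subseteq> V" "s \<in> carrier (Sec X V)" for V W s
    using VW
    by (auto simp: sharp_loc_proj restriction_closed preim_loc_proj germ_restriction loc_basic_one
        stalk_one[symmetric] fun_eq_iff)
  ultimately show ?thesis
    by (simp add: rs_hom_def) (auto simp: loc_proj_def)
qed

sublocale proj: rs_morphism "loc_space X M" X "loc_proj X M"
  by (intro rs_morphism.intro rs_morphism_axioms.intro loc_proj_hom ringed_space_loc_space ringed_space_axioms)

lemma loc_eval_stalk_map_loc_proj:
  assumes p: "(x, z) \<in> points (loc_space X M)" and A: "A \<in> carrier (stalk X x)"
  shows "loc_eval (x, z) (stalk_map (loc_space X M) (loc_proj X M) (x, z) A) =
    loc_frac X (x, z) A \<one>\<^bsub>stalk X x\<^esub>"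
proof -
  obtain U s where U: "openin (Top X) U" "x \<in> U" "s \<in> carrier (Sec X U)" "A = germ X x U s"
    using A by (rule stalk_cases)
  interpret U: cring "Sec X U" by (rule sections_cring[OF U(1)])
  have mem: "(x, z) \<in> loc_basic X M U \<one>\<^bsub>Sec X U\<^esub>"
    using U p by (simp add: loc_basic_one points_loc_space del: Top_loc_space)
  have "stalk_map (loc_space X M) (loc_proj X M) (x, z) A =
      germ (loc_space X M) (x, z) (loc_basic X M U \<one>\<^bsub>Sec X U\<^esub>) (sharp (loc_proj X M) U s)"
    using proj.stalk_map_germ[OF p U(1)] U p by (simp add: pt_loc_proj preim_loc_proj)
  then show ?thesis
    using U mem by (simp add: loc_eval_germ sharp_loc_proj loc_section_frac openin_loc_basic stalk_one[OF U(1,2)])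
qed

text \<open>A germ \<open>A\<close> pulled back along the projection evaluates to
  \<open>A/1\<close>, which lies in \<open>loc_max\<close> exactly when \<open>A\<close> lies in
  \<open>z\<close>. The second coordinate of a point can thus be recovered from the
  projection.\<close>

lemma stalk_vimage_loc_proj:
  assumes p: "(x, z) \<in> points (loc_space X M)"
  shows "stalk_vimage (loc_space X M) X (loc_proj X M) (x, z) (max_ideal (stalk (loc_space X M) (x, z))) = z"
proof -
  have xz: "x \<in> points X" "z \<in> M x" using p points_loc_space by auto
  interpret z: primeideal z "stalk X x" by (rule primeideal_M[OF xz])
  interpret fractions "stalk X x" "carrier (stalk X x) - z" by (rule fractions_M[OF xz])
  have "stalk_map (loc_space X M) (loc_proj X M) (x, z) A \<in> max_ideal (stalk (loc_space X M) (x, z)) \<longleftrightarrow> A \<in> z"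
    if "A \<in> carrier (stalk X x)" for A
    using that p xz proj.stalk_map_closed[OF p, of A]
    by (simp add: max_ideal_stalk_loc_space[OF p] loc_eval_stalk_map_loc_proj pt_loc_proj
        loc_frac_mem_loc_max_iff del: Diff_iff)
  then show ?thesis using p z.Icarr by (auto simp: stalk_vimage_def pt_loc_proj)
qed

lemma loc_proj_prs_hom:
  "loc_proj X M \<in> prs_hom (loc_space X M) (local_primes (loc_space X M)) X M"
  using loc_proj_hom stalk_vimage_loc_proj points_loc_space
  by (auto simp: prs_hom_def local_primes_def pt_loc_proj)

text \<open>A germ with value \<open>A/B\<close> is exhibited as a solution of a linear equation
  whose coefficients come from \<open>X\<close>. Stated without division, the equation can be pushed
  through any homomorphism, and it determines the image once \<open>B\<close> goes to a
  unit.\<close>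

lemma loc_germ_rep:
  assumes V: "openin (loc_topology X M) V" "(x, z) \<in> V" "\<sigma> \<in> loc_sections X M V"
  obtains A B where "A \<in> carrier (stalk X x)" "B \<in> carrier (stalk X x) - z"
    "\<sigma> (x, z) = loc_frac X (x, z) A B"
    "stalk_map (loc_space X M) (loc_proj X M) (x, z) B \<otimes>\<^bsub>stalk (loc_space X M) (x, z)\<^esub>
      germ (loc_space X M) (x, z) V \<sigma> = stalk_map (loc_space X M) (loc_proj X M) (x, z) A"
proof -
  let ?L = "loc_space X M" and ?\<pi> = "loc_proj X M"
  have p: "(x, z) \<in> points ?L" using V openin_subset by (metis Top_loc_space subsetD)
  obtain U t a where U: "openin (Top X) U" "t \<in> carrier (Sec X U)" "a \<in> carrier (Sec X U)"
    "(x, z) \<in> loc_basic X M U t" "loc_basic X M U t \<subseteq> V"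
    and \<sigma>: "\<And>x z. (x, z) \<in> loc_basic X M U t \<Longrightarrow> \<sigma> (x, z) = loc_frac X (x, z) (germ X x U a) (germ X x U t)"
    using loc_section_rep[OF V(3,2)] by metis
  interpret U: cring "Sec X U" by (rule sections_cring[OF U(1)])
  note t = loc_basicD[OF U(1,2,4)]
  let ?B = "loc_basic X M U t" and ?P = "loc_basic X M U \<one>\<^bsub>Sec X U\<^esub>"
  have B: "openin (Top ?L) ?B" using openin_loc_basic U by simp
  have P: "openin (Top ?L) ?P" "?B \<subseteq> ?P"
    using openin_loc_basic[OF U(1) U.one_closed] U by (auto simp: loc_basic_one mem_loc_basic)
  \<comment> \<open>Germs coming from \<open>X\<close> are represented on \<open>?B\<close>, where
    \<open>\<sigma>\<close> is a single fraction, so the equation can be checked pointwise on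
    \<open>?B\<close>.\<close>
  have sm: "stalk_map ?L ?\<pi> (x, z) (germ X x U s) = germ ?L (x, z) ?B (restrict (sharp ?\<pi> U s) ?B)"
    if s: "s \<in> carrier (Sec X U)" for s
  proof -
    have "stalk_map ?L ?\<pi> (x, z) (germ X x U s) = germ ?L (x, z) ?P (sharp ?\<pi> U s)"
      using proj.stalk_map_germ[OF p U(1)] s t(1) p by (simp add: pt_loc_proj preim_loc_proj U(1))
    also have "\<dots> = germ ?L (x, z) ?B (Res ?L ?P ?B (sharp ?\<pi> U s))"
      using B P U(4) proj.sharp_closed[OF U(1) s] by (intro loc.germ_restriction[symmetric]) (simp_all add: preim_loc_proj U(1))
    finally show ?thesis by simp
  qed
  have sec: "restrict (sharp ?\<pi> U s) ?B \<in> loc_sections X M ?B" if "s \<in> carrier (Sec X U)" for s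
    using that B P U proj.sharp_closed[OF U(1) that] by (intro restrict_loc_sections) (simp_all add: preim_loc_proj)
  have \<sigma>B: "restrict \<sigma> ?B \<in> loc_sections X M ?B" using V U B by (intro restrict_loc_sections) simp_all
  have "restrict (sharp ?\<pi> U t) ?B q \<otimes>\<^bsub>loc_stalk X q\<^esub> restrict \<sigma> ?B q = restrict (sharp ?\<pi> U a) ?B q"
    if q: "q \<in> ?B" for q
  proof -
    obtain y w where yw: "q = (y, w)" by fastforce
    note t = loc_basicD[OF U(1,2) q[unfolded yw]]
    interpret fractions "stalk X y" "carrier (stalk X y) - w" by (rule fractions_M[OF t(2,3)])
    let ?F = "fraction (stalk X y) (carrier (stalk X y) - w)"
    have a: "germ X y U a \<in> carrier (stalk X y)" "germ X y U t \<in> carrier (stalk X y)" using U t by auto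
    have "restrict (sharp ?\<pi> U t) ?B q \<otimes>\<^bsub>loc_stalk X q\<^esub> restrict \<sigma> ?B q =
        ?F (germ X y U t) \<one>\<^bsub>stalk X y\<^esub> \<otimes>\<^bsub>localization (stalk X y) (carrier (stalk X y) - w)\<^esub> ?F (germ X y U a) (germ X y U t)"
      using q U P(2) subsetD[OF P(2) q] t(1)
      by (simp add: yw sharp_loc_proj \<sigma> loc_stalk_Pair loc_frac_Pair stalk_one[OF U(1)])
    also have "\<dots> = ?F (germ X y U t \<otimes>\<^bsub>stalk X y\<^esub> germ X y U a) (germ X y U t \<otimes>\<^bsub>stalk X y\<^esub> \<one>\<^bsub>stalk X y\<^esub>)"
      using a t(4) by (subst fraction_mult) (simp_all del: Diff_iff)
    also have "\<dots> = ?F (germ X y U a) \<one>\<^bsub>stalk X y\<^esub>"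
      using a t(4) by (intro fraction_cancel) (simp_all del: Diff_iff)
    also have "\<dots> = restrict (sharp ?\<pi> U a) ?B q"
      using q U subsetD[OF P(2) q] t(1)
      by (simp add: yw sharp_loc_proj loc_frac_Pair stalk_one[OF U(1)])
    finally show ?thesis .
  qed
  then have eq: "restrict (sharp ?\<pi> U t) ?B \<otimes>\<^bsub>Sec ?L ?B\<^esub> restrict \<sigma> ?B = restrict (sharp ?\<pi> U a) ?B"
    by (auto simp: fun_eq_iff)
  have "germ ?L (x, z) V \<sigma> = germ ?L (x, z) ?B (restrict \<sigma> ?B)"
    using loc.germ_restriction[of V ?B "(x, z)" \<sigma>] V U B by simp
  then have "stalk_map ?L ?\<pi> (x, z) (germ X x U t) \<otimes>\<^bsub>stalk ?L (x, z)\<^esub> germ ?L (x, z) V \<sigma> =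
      germ ?L (x, z) ?B (restrict (sharp ?\<pi> U t) ?B \<otimes>\<^bsub>Sec ?L ?B\<^esub> restrict \<sigma> ?B)"
    using U B sec \<sigma>B by (simp add: sm loc.stalk_mult del: mult_Sec_loc_space)
  also have "\<dots> = stalk_map ?L ?\<pi> (x, z) (germ X x U a)"
    unfolding eq using U by (simp add: sm)
  finally show thesis
    using that[of "germ X x U a" "germ X x U t"] U t \<sigma>[OF U(4)] by simp
qed

end

section \<open>The universal property of the localization\<close>

locale loc_lift = primed_ringed_space X M + T: locally_ringed_space T
  for X :: "('a, 'r) rspace" and M and T :: "('b, 's) rspace" +
  fixes g :: "('b, 's, 'a, 'r) rs_map"
  assumes g_prs_hom: "g \<in> prs_hom T (local_primes T) X M"
begin

sublocale g: rs_morphism T X g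
  by (rule rs_morphism_prs_hom[OF T.ringed_space_axioms ringed_space_axioms g_prs_hom])

definition lift_prime :: "'b \<Rightarrow> ('a, 'r) germ set" where
  "lift_prime y = stalk_vimage T X g y (max_ideal (stalk T y))"

definition lift_pt :: "'b \<Rightarrow> ('a, 'r) loc_point" where
  "lift_pt y = (pt g y, lift_prime y)"

definition lift_germ :: "'b \<Rightarrow> (('a, 'r) germ \<times> ('a, 'r) germ) set \<Rightarrow> ('b, 's) germ" where
  "lift_germ y = fraction_map (stalk X (pt g y)) (carrier (stalk X (pt g y)) - lift_prime y)
     (stalk T y) (stalk_map T g y)"

text \<open>The sheaf component picks the section with the prescribed germs;
  \<open>sections_eqI\<close> and \<open>section_of_germs\<close> give its uniqueness and existence.
  The preimage of \<open>V\<close> is spelled out because \<open>preim\<close> would need the map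
  that is being defined.\<close>

definition lift :: "('b, 's, ('a, 'r) loc_point, ('a, 'r) loc_section) rs_map" where
  "lift = \<lparr>pt = (\<lambda>y\<in>points T. lift_pt y),
     sharp = (\<lambda>V\<in>{V. openin (loc_topology X M) V}. \<lambda>\<sigma>\<in>loc_sections X M V.
       THE s. s \<in> carrier (Sec T {y \<in> points T. lift_pt y \<in> V}) \<and>
         (\<forall>y. y \<in> points T \<and> lift_pt y \<in> V \<longrightarrow>
            germ T y {y \<in> points T. lift_pt y \<in> V} s = lift_germ y (\<sigma> (lift_pt y))))\<rparr>"

lemma lift_prime_mem: "y \<in> points T \<Longrightarrow> lift_prime y \<in> M (pt g y)"
  using g_prs_hom by (simp add: prs_hom_def local_primes_def lift_prime_def)

lemma lift_pt_closed: "y \<in> points T \<Longrightarrow> lift_pt y \<in> points (loc_space X M)"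
  unfolding points_loc_space by (simp add: lift_pt_def g.pt_closed lift_prime_mem)

text \<open>In a local ring the maximal ideal consists of the non-units, so the complement of
  \<open>lift_prime\<close> contains precisely the elements that become invertible.\<close>

lemma mem_lift_prime:
  assumes "y \<in> points T" "A \<in> carrier (stalk X (pt g y))"
  shows "A \<in> lift_prime y \<longleftrightarrow> stalk_map T g y A \<notin> Units (stalk T y)"
  using assms g.stalk_map_closed
  by (simp add: lift_prime_def stalk_vimage_def max_ideal_iff_not_Units T.stalk_local)

lemma fractions_hom_lift:
  assumes y: "y \<in> points T"
  shows "fractions_hom (stalk X (pt g y)) (carrier (stalk X (pt g y)) - lift_prime y) (stalk T y) (stalk_map T g y)"
proof -
  interpret fractions "stalk X (pt g y)" "carrier (stalk X (pt g y)) - lift_prime y"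
    by (rule fractions_M[OF g.pt_closed[OF y] lift_prime_mem[OF y]])
  interpret Ty: cring "stalk T y" by (rule T.cring_stalk[OF y])
  show ?thesis
  proof unfold_locales
    show "stalk_map T g y \<in> ring_hom (stalk X (pt g y)) (stalk T y)" by (rule g.stalk_map_hom[OF y])
    show "stalk_map T g y A \<in> Units (stalk T y)" if "A \<in> carrier (stalk X (pt g y)) - lift_prime y" for A
      using that mem_lift_prime[OF y, of A] by blast
  qed
qed

lemma lift_germ_eqI:
  assumes "y \<in> points T" "A \<in> carrier (stalk X (pt g y))" "B \<in> carrier (stalk X (pt g y)) - lift_prime y"
    and "C \<in> carrier (stalk T y)" "stalk_map T g y B \<otimes>\<^bsub>stalk T y\<^esub> C = stalk_map T g y A"
  shows "lift_germ y (loc_frac X (lift_pt y) A B) = C"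
  unfolding lift_germ_def lift_pt_def loc_frac_Pair
  using assms by (intro fractions_hom.fraction_map_eqI fractions_hom_lift)

lemma lift_germ_hom:
  assumes y: "y \<in> points T"
  shows "lift_germ y \<in> ring_hom (loc_stalk X (lift_pt y)) (stalk T y)"
  unfolding lift_germ_def lift_pt_def loc_stalk_Pair
  using y by (intro fractions_hom.fraction_map_hom fractions_hom_lift)

text \<open>The image of \<open>A/B\<close> is a unit times the image of \<open>A\<close>. Both
  sides therefore depend only on whether \<open>A\<close> lies in \<open>lift_prime y\<close>. This
  is the locality of the lifted stalk maps.\<close>

lemma lift_germ_loc_max_iff:
  assumes y: "y \<in> points T" and v: "v \<in> carrier (loc_stalk X (lift_pt y))"
  shows "lift_germ y v \<in> max_ideal (stalk T y) \<longleftrightarrow> v \<in> loc_max X (lift_pt y)"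
proof -
  interpret fractions_hom "stalk X (pt g y)" "carrier (stalk X (pt g y)) - lift_prime y" "stalk T y" "stalk_map T g y"
    by (rule fractions_hom_lift[OF y])
  interpret m: maximalideal "max_ideal (stalk T y)" "stalk T y"
    by (rule max_ideal_maximalideal[OF T.stalk_local[OF y]])
  obtain A B where AB: "A \<in> carrier (stalk X (pt g y))" "B \<in> carrier (stalk X (pt g y)) - lift_prime y"
    "v = loc_frac X (lift_pt y) A B"
    using v unfolding lift_pt_def loc_stalk_Pair loc_frac_Pair by (rule localization_cases)
  define i where "i = inv\<^bsub>stalk T y\<^esub> stalk_map T g y B"
  have B: "stalk_map T g y B \<in> Units (stalk T y)" using hom_Units AB by blast
  have i: "i \<in> carrier (stalk T y)" "stalk_map T g y B \<in> carrier (stalk T y)" using B by (auto simp: i_def)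
  have v': "lift_germ y v = i \<otimes>\<^bsub>stalk T y\<^esub> stalk_map T g y A"
    using fraction_map_fraction AB by (simp add: lift_germ_def lift_pt_def loc_frac_Pair i_def del: Diff_iff)
  have "stalk_map T g y B \<otimes>\<^bsub>stalk T y\<^esub> (i \<otimes>\<^bsub>stalk T y\<^esub> stalk_map T g y A) = stalk_map T g y A"
    using B i AB by (simp add: i_def S.m_assoc[symmetric])
  then have "lift_germ y v \<in> max_ideal (stalk T y) \<longleftrightarrow> stalk_map T g y A \<in> max_ideal (stalk T y)"
    unfolding v' using i m.I_l_closed[of "stalk_map T g y A" i]
      m.I_l_closed[of "i \<otimes>\<^bsub>stalk T y\<^esub> stalk_map T g y A" "stalk_map T g y B"] by auto
  also have "\<dots> \<longleftrightarrow> A \<in> lift_prime y"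
    using AB(1) unfolding lift_prime_def stalk_vimage_def by blast
  also have "\<dots> \<longleftrightarrow> v \<in> loc_max X (lift_pt y)"
    using AB loc_frac_mem_loc_max_iff[OF g.pt_closed[OF y] lift_prime_mem[OF y]] by (simp add: lift_pt_def)
  finally show ?thesis .
qed

text \<open>Where \<open>t\<close> does not vanish its pullback is invertible, so \<open>a/t\<close> pulls back to a section.\<close>

lemma lift_local:
  assumes y: "y \<in> points T" and U: "openin (Top X) U" "t \<in> carrier (Sec X U)" "a \<in> carrier (Sec X U)"
    and mem: "lift_pt y \<in> loc_basic X M U t"
  obtains W s where "openin (Top T) W" "y \<in> W" "s \<in> carrier (Sec T W)"
    "\<And>y'. y' \<in> W \<Longrightarrow> lift_pt y' \<in> loc_basic X M U t"
    "\<And>y'. y' \<in> W \<Longrightarrow> germ T y' W s =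
       lift_germ y' (loc_frac X (lift_pt y') (germ X (pt g y') U a) (germ X (pt g y') U t))"
proof -
  let ?P = "preim T g U"
  have P: "openin (Top T) ?P" by (rule g.openin_preim[OF U(1)])
  note t = loc_basicD[OF U(1,2) mem[unfolded lift_pt_def]]
  have yP: "y \<in> ?P" using y t(1) by (simp add: preim_def)
  have "stalk_map T g y (germ X (pt g y) U t) \<in> Units (stalk T y)"
    using mem_lift_prime[OF y, of "germ X (pt g y) U t"] t(4) by auto
  then have "germ T y ?P (sharp g U t) \<in> Units (stalk T y)"
    using g.stalk_map_germ[OF y U(1) t(1) U(2)] by simp
  \<comment> \<open>\<open>r\<close> inverts the pullback of \<open>t\<close> on all of
    \<open>W\<close>, not only in the stalk at \<open>y\<close>.\<close>
  then obtain W r where W: "openin (Top T) W" "y \<in> W" "W \<subseteq> ?P" "r \<in> carrier (Sec T W)"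
    and r: "r \<otimes>\<^bsub>Sec T W\<^esub> Res T ?P W (sharp g U t) = \<one>\<^bsub>Sec T W\<^esub>"
    using T.germ_Units[OF P yP g.sharp_closed[OF U(1,2)]] by metis
  interpret W: cring "Sec T W" by (rule T.sections_cring[OF W(1)])
  let ?t = "Res T ?P W (sharp g U t)" and ?a = "Res T ?P W (sharp g U a)"
  have c: "?t \<in> carrier (Sec T W)" "?a \<in> carrier (Sec T W)"
    using W P U by (auto intro!: T.restriction_closed g.sharp_closed)
  \<comment> \<open>At each point of \<open>W\<close> the germ of \<open>r\<close> inverts the image
    of \<open>t\<close>. So \<open>t\<close> avoids the prime there, which keeps \<open>W\<close>
    inside the preimage of the basic set, and \<open>r\<close> times the pullback of
    \<open>a\<close> solves the equation for the image of \<open>a/t\<close>.\<close>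
  have *: "lift_pt y' \<in> loc_basic X M U t \<and> germ T y' W (r \<otimes>\<^bsub>Sec T W\<^esub> ?a) =
       lift_germ y' (loc_frac X (lift_pt y') (germ X (pt g y') U a) (germ X (pt g y') U t))"
    if y': "y' \<in> W" for y'
  proof -
    have y'T: "y' \<in> points T" "pt g y' \<in> U" using y' W(3) by (auto simp: preim_def)
    interpret S: cring "stalk T y'" by (rule T.cring_stalk[OF y'T(1)])
    have gc: "germ X (pt g y') U t \<in> carrier (stalk X (pt g y'))" "germ X (pt g y') U a \<in> carrier (stalk X (pt g y'))"
      using U y'T by auto
    have sm: "stalk_map T g y' (germ X (pt g y') U s) = germ T y' W (Res T ?P W (sharp g U s))"
      if s: "s \<in> carrier (Sec X U)" for s
      using g.stalk_map_germ[OF y'T(1) U(1) y'T(2) s] T.germ_restriction[OF P W(1,3) y' g.sharp_closed[OF U(1) s]]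
      by simp
    note h = T.germ_hom[OF W(1) y']
    have inv: "germ T y' W r \<otimes>\<^bsub>stalk T y'\<^esub> germ T y' W ?t = \<one>\<^bsub>stalk T y'\<^esub>"
      using c W by (simp add: ring_hom_mult[OF h, symmetric] r ring_hom_one[OF h])
    have c': "germ T y' W r \<in> carrier (stalk T y')" "germ T y' W ?t \<in> carrier (stalk T y')" "germ T y' W ?a \<in> carrier (stalk T y')"
      using c W y' by auto
    have inv': "germ T y' W ?t \<otimes>\<^bsub>stalk T y'\<^esub> germ T y' W r = \<one>\<^bsub>stalk T y'\<^esub>"
      using inv c' by (simp add: S.m_comm)
    have "stalk_map T g y' (germ X (pt g y') U t) \<in> Units (stalk T y')"
      unfolding sm[OF U(2)] using inv inv' c' by (auto simp: Units_def)
    then have t: "germ X (pt g y') U t \<notin> lift_prime y'"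
      using mem_lift_prime[OF y'T(1) gc(1)] by simp
    have "germ T y' W ?t \<otimes>\<^bsub>stalk T y'\<^esub> (germ T y' W r \<otimes>\<^bsub>stalk T y'\<^esub> germ T y' W ?a) = germ T y' W ?a"
      using inv' c' by (simp add: S.m_assoc[symmetric])
    then have "lift_germ y' (loc_frac X (lift_pt y') (germ X (pt g y') U a) (germ X (pt g y') U t)) =
        germ T y' W r \<otimes>\<^bsub>stalk T y'\<^esub> germ T y' W ?a"
      using gc t c' by (intro lift_germ_eqI y'T) (simp_all add: sm U)
    then show ?thesis
      using t y'T lift_prime_mem c W by (simp add: lift_pt_def mem_loc_basic ring_hom_mult[OF h])
  qed
  show thesis
    by (rule that[of W "r \<otimes>\<^bsub>Sec T W\<^esub> ?a"]) (use W c * in auto)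
qed

lemma preim_lift: "preim T lift V = {y \<in> points T. lift_pt y \<in> V}"
  by (auto simp: preim_def lift_def)

lemma pt_lift: "y \<in> points T \<Longrightarrow> pt lift y = lift_pt y"
  by (simp add: lift_def)

lemma openin_preim_lift:
  assumes V: "openin (loc_topology X M) V"
  shows "openin (Top T) (preim T lift V)"
proof (subst openin_subopen, intro ballI)
  fix y assume "y \<in> preim T lift V"
  then have y: "y \<in> points T" "lift_pt y \<in> V" by (auto simp: preim_lift)
  then obtain U t where U: "openin (Top X) U" "t \<in> carrier (Sec X U)" "lift_pt y \<in> loc_basic X M U t"
    "loc_basic X M U t \<subseteq> V"
    using V unfolding openin_loc_topology by metis
  \<comment> \<open>Any numerator yields the neighbourhood; \<open>t\<close> itself is
    taken.\<close>
  obtain W where W: "openin (Top T) W" "y \<in> W" "\<And>y'. y' \<in> W \<Longrightarrow> lift_pt y' \<in> loc_basic X M U t"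
    using lift_local[OF y(1) U(1,2,2,3)] by metis
  then have "W \<subseteq> preim T lift V" using openin_subset[OF W(1)] U(4) by (auto simp: preim_lift)
  then show "\<exists>W. openin (Top T) W \<and> y \<in> W \<and> W \<subseteq> preim T lift V" using W by blast
qed

text \<open>Near each point of the preimage \<open>\<sigma>\<close> is one fraction
  \<open>a/t\<close>, whose transported values are the germs of one section by
  \<open>lift_local\<close>. The definite description in \<open>lift\<close> thus has exactly one
  solution.\<close>

lemma
  assumes V: "openin (loc_topology X M) V" and \<sigma>: "\<sigma> \<in> loc_sections X M V"
  shows sharp_lift_closed: "sharp lift V \<sigma> \<in> carrier (Sec T (preim T lift V))"
    and germ_sharp_lift: "\<And>y. y \<in> preim T lift V \<Longrightarrow>
      germ T y (preim T lift V) (sharp lift V \<sigma>) = lift_germ y (\<sigma> (lift_pt y))"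
proof -
  let ?P = "preim T lift V"
  have P: "openin (Top T) ?P" by (rule openin_preim_lift[OF V])
  have "\<exists>W s. openin (Top T) W \<and> y \<in> W \<and> W \<subseteq> ?P \<and> s \<in> carrier (Sec T W) \<and>
      (\<forall>y'\<in>W. germ T y' W s = lift_germ y' (\<sigma> (lift_pt y')))" if y: "y \<in> ?P" for y
  proof -
    have y: "y \<in> points T" "lift_pt y \<in> V" using y by (auto simp: preim_lift)
    obtain U t a where U: "openin (Top X) U" "t \<in> carrier (Sec X U)" "a \<in> carrier (Sec X U)"
      "lift_pt y \<in> loc_basic X M U t" "loc_basic X M U t \<subseteq> V"
      and eq: "\<And>x z. (x, z) \<in> loc_basic X M U t \<Longrightarrow> \<sigma> (x, z) = loc_frac X (x, z) (germ X x U a) (germ X x U t)"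
      using loc_section_rep[OF \<sigma> y(2)] by metis
    obtain W s where W: "openin (Top T) W" "y \<in> W" "s \<in> carrier (Sec T W)"
      "\<And>y'. y' \<in> W \<Longrightarrow> lift_pt y' \<in> loc_basic X M U t"
      "\<And>y'. y' \<in> W \<Longrightarrow> germ T y' W s =
         lift_germ y' (loc_frac X (lift_pt y') (germ X (pt g y') U a) (germ X (pt g y') U t))"
      using lift_local[OF y(1) U(1-4)] by metis
    have "germ T y' W s = lift_germ y' (\<sigma> (lift_pt y'))" if "y' \<in> W" for y'
      using W(4,5)[OF that] eq[of "pt g y'" "lift_prime y'"] by (simp add: lift_pt_def)
    moreover have "W \<subseteq> ?P" using W U openin_subset[OF W(1)] by (auto simp: preim_lift)
    ultimately show ?thesis using W(1-3) by blast
  qed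
  then obtain s where s: "s \<in> carrier (Sec T ?P)" "\<And>y. y \<in> ?P \<Longrightarrow> germ T y ?P s = lift_germ y (\<sigma> (lift_pt y))"
    using T.section_of_germs[OF P, of "\<lambda>y. lift_germ y (\<sigma> (lift_pt y))"] by metis
  have "sharp lift V \<sigma> = (THE s. s \<in> carrier (Sec T ?P) \<and>
      (\<forall>y. y \<in> ?P \<longrightarrow> germ T y ?P s = lift_germ y (\<sigma> (lift_pt y))))"
    using V \<sigma> unfolding preim_lift by (simp add: lift_def)
  also have "\<dots> = s"
    by (rule the_equality) (use s T.sections_eqI[OF P] in auto)
  finally show "sharp lift V \<sigma> \<in> carrier (Sec T ?P)"
    "\<And>y. y \<in> ?P \<Longrightarrow> germ T y ?P (sharp lift V \<sigma>) = lift_germ y (\<sigma> (lift_pt y))"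
    using s by auto
qed

text \<open>All equations for the sheaf maps are tested on germs. There \<open>sharp lift\<close> is
  evaluation at \<open>lift_pt y\<close> followed by the ring homomorphism
  \<open>lift_germ y\<close>, and the ring operations on sections of the localization are
  pointwise.\<close>

lemma lift_rs_hom: "lift \<in> rs_hom T (loc_space X M)"
proof -
  let ?L = "loc_space X M"
  have "continuous_map (Top T) (Top ?L) (pt lift)"
    unfolding continuous_map_def
  proof (intro conjI allI impI)
    show "pt lift \<in> topspace (Top T) \<rightarrow> topspace (Top ?L)"
      using lift_pt_closed by (auto simp: pt_lift)
    fix V assume "openin (Top ?L) V"
    then show "openin (Top T) {y \<in> topspace (Top T). pt lift y \<in> V}"
      using openin_preim_lift[of V] by (simp add: preim_def)
  qed
  moreover have "sharp lift V \<in> ring_hom (Sec ?L V) (Sec T (preim T lift V))"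
    if "openin (Top ?L) V" for V
  proof (rule ring_hom_memI)
    let ?P = "preim T lift V"
    have V: "openin (loc_topology X M) V" using that by simp
    note P = openin_preim_lift[OF V] and g = germ_sharp_lift[OF V] and c = sharp_lift_closed[OF V]
    interpret P: cring "Sec T ?P" by (rule T.sections_cring[OF P])
    interpret V: cring "Sec ?L V" by (rule cring_loc_sections[OF V])
    have y: "y \<in> points T" "lift_pt y \<in> V" if "y \<in> ?P" for y using that by (auto simp: preim_lift)
    show "sharp lift V \<sigma> \<in> carrier (Sec T ?P)" if "\<sigma> \<in> carrier (Sec ?L V)" for \<sigma>
      using that c by simp
    show "sharp lift V (\<sigma> \<otimes>\<^bsub>Sec ?L V\<^esub> \<tau>) = sharp lift V \<sigma> \<otimes>\<^bsub>Sec T ?P\<^esub> sharp lift V \<tau>"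
      and "sharp lift V (\<sigma> \<oplus>\<^bsub>Sec ?L V\<^esub> \<tau>) = sharp lift V \<sigma> \<oplus>\<^bsub>Sec T ?P\<^esub> sharp lift V \<tau>"
      if st: "\<sigma> \<in> carrier (Sec ?L V)" "\<tau> \<in> carrier (Sec ?L V)" for \<sigma> \<tau>
    proof -
      have st': "\<sigma> \<in> loc_sections X M V" "\<tau> \<in> loc_sections X M V" using st by simp_all
      note gh = T.germ_hom[OF P]
      have "germ T z ?P (sharp lift V (\<sigma> \<otimes>\<^bsub>Sec ?L V\<^esub> \<tau>)) = germ T z ?P (sharp lift V \<sigma> \<otimes>\<^bsub>Sec T ?P\<^esub> sharp lift V \<tau>)"
        "germ T z ?P (sharp lift V (\<sigma> \<oplus>\<^bsub>Sec ?L V\<^esub> \<tau>)) = germ T z ?P (sharp lift V \<sigma> \<oplus>\<^bsub>Sec T ?P\<^esub> sharp lift V \<tau>)"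
        if z: "z \<in> ?P" for z
        using z y[OF z] st' c mult_loc_sections[OF st'] add_loc_sections[OF st']
          loc_sections_value[OF st'(1) y(2)[OF z]] loc_sections_value[OF st'(2) y(2)[OF z]]
        by (simp_all add: g ring_hom_mult[OF gh[OF z]] ring_hom_add[OF gh[OF z]]
            ring_hom_mult[OF lift_germ_hom] ring_hom_add[OF lift_germ_hom])
      then show "sharp lift V (\<sigma> \<otimes>\<^bsub>Sec ?L V\<^esub> \<tau>) = sharp lift V \<sigma> \<otimes>\<^bsub>Sec T ?P\<^esub> sharp lift V \<tau>"
        "sharp lift V (\<sigma> \<oplus>\<^bsub>Sec ?L V\<^esub> \<tau>) = sharp lift V \<sigma> \<oplus>\<^bsub>Sec T ?P\<^esub> sharp lift V \<tau>"
        using st' c V.m_closed[OF st] V.a_closed[OF st] by (auto intro!: T.sections_eqI[OF P] simp del: mult_Sec_loc_space add_Sec_loc_space)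
    qed
    show "sharp lift V \<one>\<^bsub>Sec ?L V\<^esub> = \<one>\<^bsub>Sec T ?P\<^esub>"
      using c y one_loc_sections[OF V]
      by (auto intro!: T.sections_eqI[OF P]
          simp: g ring_hom_one[OF T.germ_hom[OF P]] ring_hom_one[OF lift_germ_hom])
  qed
  moreover have "sharp lift W (Res ?L V W \<sigma>) = Res T (preim T lift V) (preim T lift W) (sharp lift V \<sigma>)"
    if VW: "openin (loc_topology X M) V" "openin (loc_topology X M) W" "W \<subseteq> V" "\<sigma> \<in> loc_sections X M V" for V W \<sigma>
  proof (rule T.sections_eqI[OF openin_preim_lift[OF VW(2)]])
    have sub: "preim T lift W \<subseteq> preim T lift V" using VW by (auto simp: preim_lift)
    have r: "restrict \<sigma> W \<in> loc_sections X M W" using VW by (intro restrict_loc_sections)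
    show "sharp lift W (Res ?L V W \<sigma>) \<in> carrier (Sec T (preim T lift W))"
      using VW r by (simp add: sharp_lift_closed)
    show "Res T (preim T lift V) (preim T lift W) (sharp lift V \<sigma>) \<in> carrier (Sec T (preim T lift W))"
      using VW sub by (intro T.restriction_closed) (simp_all add: openin_preim_lift sharp_lift_closed)
    fix y assume y: "y \<in> preim T lift W"
    then have "lift_pt y \<in> W" by (simp add: preim_lift)
    then show "germ T y (preim T lift W) (sharp lift W (Res ?L V W \<sigma>)) =
        germ T y (preim T lift W) (Res T (preim T lift V) (preim T lift W) (sharp lift V \<sigma>))"
      using VW y sub r
      by (simp add: germ_sharp_lift T.germ_restriction openin_preim_lift sharp_lift_closed subsetD)
  qed
  ultimately show ?thesis
    by (simp add: rs_hom_def) (simp add: lift_def)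
qed

sublocale lift: rs_morphism T "loc_space X M" lift
  by (intro rs_morphism.intro rs_morphism_axioms.intro lift_rs_hom ringed_space_loc_space T.ringed_space_axioms)

text \<open>The first coordinate of \<open>lift_pt\<close> settles the points. For a section
  \<open>s\<close>, the germ at \<open>y\<close> of either side is the image of the germ of
  \<open>s\<close> under \<open>g_y\<close>: on the left \<open>s/1\<close> is transported, and its
  denominator is one.\<close>

lemma loc_proj_lift: "rs_comp T (loc_space X M) X (loc_proj X M) lift = g"
proof (rule rs_map_eqI[OF rs_comp_hom g.rs_hom])
  let ?c = "rs_comp T (loc_space X M) X (loc_proj X M) lift"
  show c: "rs_morphism T (loc_space X M) lift" "rs_morphism (loc_space X M) X (loc_proj X M)"
    by (rule lift.rs_morphism_axioms proj.rs_morphism_axioms)+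
  show pt: "pt ?c y = pt g y" if "y \<in> points T" for y
    using that lift_pt_closed by (simp add: pt_rs_comp[OF c] pt_lift lift_pt_def pt_loc_proj del: Top_loc_space)
  fix U s assume U: "openin (Top X) U" "s \<in> carrier (Sec X U)"
  interpret U: cring "Sec X U" by (rule sections_cring[OF U(1)])
  interpret c: rs_morphism T X ?c by (rule rs_morphism_comp[OF c])
  let ?B = "loc_basic X M U \<one>\<^bsub>Sec X U\<^esub>"
  have B: "openin (loc_topology X M) ?B" using U openin_loc_basic by simp
  have sec: "sharp (loc_proj X M) U s \<in> loc_sections X M ?B"
    using U by (simp add: sharp_loc_proj loc_section_frac)
  have P: "preim T lift ?B = preim T g U"
    using lift_prime_mem by (auto simp: preim_lift preim_def[of T g] loc_basic_one[OF U(1)] lift_pt_def)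
  have sc: "sharp ?c U s = sharp lift ?B (sharp (loc_proj X M) U s)"
    using U by (simp add: sharp_rs_comp[OF c] preim_loc_proj)
  show "sharp ?c U s = sharp g U s"
  proof (rule T.sections_eqI[OF g.openin_preim[OF U(1)]])
    show "sharp ?c U s \<in> carrier (Sec T (preim T g U))"
      using sharp_lift_closed[OF B sec] unfolding sc P .
    show "sharp g U s \<in> carrier (Sec T (preim T g U))" by (rule g.sharp_closed[OF U])
    fix y assume y': "y \<in> preim T g U"
    then have y: "y \<in> points T" "pt g y \<in> U" "y \<in> preim T lift ?B"
      unfolding P by (auto simp: preim_def)
    interpret S: cring "stalk T y" by (rule T.cring_stalk[OF y(1)])
    interpret fractions_hom "stalk X (pt g y)" "carrier (stalk X (pt g y)) - lift_prime y" "stalk T y" "stalk_map T g y"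
      by (rule fractions_hom_lift[OF y(1)])
    have "germ T y (preim T g U) (sharp ?c U s) = lift_germ y (sharp (loc_proj X M) U s (lift_pt y))"
      using germ_sharp_lift[OF B sec y(3)] unfolding sc P .
    also have "sharp (loc_proj X M) U s (lift_pt y) = loc_frac X (lift_pt y) (germ X (pt g y) U s) \<one>\<^bsub>stalk X (pt g y)\<^esub>"
      using y U by (simp add: preim_lift sharp_loc_proj lift_pt_def stalk_one[OF U(1) y(2)])
    also have "lift_germ y \<dots> = germ T y (preim T g U) (sharp g U s)"
      using y U g.stalk_map_closed[OF y(1), of "germ X (pt g y) U s"] one_closed
      by (intro lift_germ_eqI) (simp_all add: g.stalk_map_germ[symmetric])
    finally show "germ T y (preim T g U) (sharp ?c U s) = germ T y (preim T g U) (sharp g U s)" .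
  qed
qed

text \<open>Membership of a germ in the maximal ideal is read off its value by
  \<open>loc_max\<close>, and \<open>lift_germ_loc_max_iff\<close> carries this to the stalk of
  \<open>T\<close>.\<close>

lemma lift_lrs_hom: "lift \<in> lrs_hom T (loc_space X M)"
proof -
  let ?L = "loc_space X M"
  have "stalk_vimage T ?L lift y (max_ideal (stalk T y)) = max_ideal (stalk ?L (lift_pt y))"
    if y: "y \<in> points T" for y
  proof -
    have "stalk_map T lift y A \<in> max_ideal (stalk T y) \<longleftrightarrow> A \<in> max_ideal (stalk ?L (lift_pt y))"
      if A: "A \<in> carrier (stalk ?L (lift_pt y))" for A
    proof -
      obtain V \<sigma> where V: "openin (loc_topology X M) V" "lift_pt y \<in> V" "\<sigma> \<in> loc_sections X M V"
        "A = germ ?L (lift_pt y) V \<sigma>"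
        using A by (rule loc.stalk_cases) simp
      have "y \<in> preim T lift V" using y V by (simp add: preim_lift)
      then have "stalk_map T lift y A = lift_germ y (\<sigma> (lift_pt y))"
        using lift.stalk_map_germ[OF y, of V \<sigma>] y V by (simp add: pt_lift germ_sharp_lift)
      then show ?thesis
        using V y by (simp add: lift_germ_loc_max_iff loc_sections_value germ_mem_max_ideal_loc_space)
    qed
    moreover have "max_ideal (stalk ?L (lift_pt y)) \<subseteq> carrier (stalk ?L (lift_pt y))"
      using max_ideal_stalk_loc_space[OF lift_pt_closed[OF y]] by auto
    ultimately show ?thesis using y by (auto simp: stalk_vimage_def pt_lift)
  qed
  then show ?thesis using lift_rs_hom by (simp add: lrs_hom_def pt_lift)
qed

lemma lift_unique:
  assumes h: "h \<in> lrs_hom T (loc_space X M)"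
    and comp: "rs_comp T (loc_space X M) X (loc_proj X M) h = g"
  shows "h = lift"
proof -
  let ?L = "loc_space X M" and ?\<pi> = "loc_proj X M"
  interpret h: rs_morphism T ?L h
    using h by (intro rs_morphism.intro rs_morphism_axioms.intro ringed_space_loc_space T.ringed_space_axioms)
      (simp add: lrs_hom_def)
  note c = h.rs_morphism_axioms proj.rs_morphism_axioms
  have pt: "pt h y = lift_pt y" if y: "y \<in> points T" for y
  proof -
    obtain x z where xz: "pt h y = (x, z)" by fastforce
    have p: "(x, z) \<in> points ?L" using h.pt_closed[OF y] unfolding xz .
    have x: "x = pt g y"
      using pt_rs_comp[OF c y] unfolding comp xz pt_loc_proj[OF p] by simp
    \<comment> \<open>The maximal ideal at \<open>y\<close> is pulled back along \<open>g\<close> in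
      two stages: locality of \<open>h\<close> gives the maximal ideal at \<open>(x, z)\<close>, and
      the projection turns that into \<open>z\<close>.\<close>
    have "lift_prime y = stalk_vimage ?L X ?\<pi> (pt h y) (stalk_vimage T ?L h y (max_ideal (stalk T y)))"
      using stalk_vimage_rs_comp[OF c y] unfolding comp lift_prime_def .
    also have "stalk_vimage T ?L h y (max_ideal (stalk T y)) = max_ideal (stalk ?L (x, z))"
      using h y by (simp add: lrs_hom_def xz)
    also have "stalk_vimage ?L X ?\<pi> (pt h y) (max_ideal (stalk ?L (x, z))) = z"
      unfolding xz by (rule stalk_vimage_loc_proj[OF p])
    finally show ?thesis by (simp add: lift_pt_def xz x)
  qed
  have preim: "preim T h V = preim T lift V" for V
    using pt by (auto simp: preim_def pt_lift)
  show ?thesis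
  proof (rule rs_map_eqI[OF h.rs_hom lift_rs_hom])
    show "pt h y = pt lift y" if "y \<in> points T" for y using pt that by (simp add: pt_lift)
    fix V \<sigma> assume "openin (Top ?L) V" "\<sigma> \<in> carrier (Sec ?L V)"
    then have V: "openin (loc_topology X M) V" "\<sigma> \<in> loc_sections X M V" by simp_all
    have hc: "sharp h V \<sigma> \<in> carrier (Sec T (preim T lift V))"
      using h.sharp_closed[of V \<sigma>] V by (simp add: preim)
    show "sharp h V \<sigma> = sharp lift V \<sigma>"
    proof (rule T.sections_eqI[OF openin_preim_lift[OF V(1)] hc sharp_lift_closed[OF V]])
      fix y assume y: "y \<in> preim T lift V"
      then have yT: "y \<in> points T" "lift_pt y \<in> V" by (auto simp: preim_lift)
      have pty: "pt h y = (pt g y, lift_prime y)" using pt[OF yT(1)] by (simp add: lift_pt_def)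
      obtain A B where AB: "A \<in> carrier (stalk X (pt g y))" "B \<in> carrier (stalk X (pt g y)) - lift_prime y"
        "\<sigma> (lift_pt y) = loc_frac X (lift_pt y) A B"
        and eq: "stalk_map ?L ?\<pi> (pt h y) B \<otimes>\<^bsub>stalk ?L (pt h y)\<^esub> germ ?L (pt h y) V \<sigma> =
          stalk_map ?L ?\<pi> (pt h y) A"
        using loc_germ_rep[OF V(1) yT(2)[unfolded lift_pt_def] V(2)] unfolding pty lift_pt_def by metis
      have p: "pt h y \<in> points ?L" using h.pt_closed[OF yT(1)] .
      have pt\<pi>: "pt ?\<pi> (pt h y) = pt g y"
        using pt_rs_comp[OF c yT(1)] by (simp add: comp)
      have sm: "stalk_map T h y (stalk_map ?L ?\<pi> (pt h y) C) = stalk_map T g y C"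
        if "C \<in> carrier (stalk X (pt g y))" for C
        using stalk_map_rs_comp[OF c yT(1)] that unfolding comp pt\<pi> by simp
      have g: "germ ?L (pt h y) V \<sigma> \<in> carrier (stalk ?L (pt h y))"
        using V yT pt by simp
      have gh: "stalk_map T h y (germ ?L (pt h y) V \<sigma>) = germ T y (preim T lift V) (sharp h V \<sigma>)"
        using h.stalk_map_germ[OF yT(1), of V \<sigma>] V yT pt by (simp add: preim)
      have "stalk_map ?L ?\<pi> (pt h y) B \<in> carrier (stalk ?L (pt h y))"
        using proj.stalk_map_closed[OF p, of B] AB unfolding pt\<pi> by blast
      \<comment> \<open>The equation of \<open>loc_germ_rep\<close> is mapped to the stalk of
        \<open>T\<close> by \<open>h\<close>. Since \<open>h\<close> followed by the projection is
        \<open>g\<close>, it becomes the equation that characterizes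
        \<open>lift_germ\<close>.\<close>
      then have "stalk_map T g y B \<otimes>\<^bsub>stalk T y\<^esub> germ T y (preim T lift V) (sharp h V \<sigma>) = stalk_map T g y A"
        using arg_cong[OF eq, of "stalk_map T h y"] AB g
        by (simp add: ring_hom_mult[OF h.stalk_map_hom[OF yT(1)]] sm gh)
      then have "lift_germ y (\<sigma> (lift_pt y)) = germ T y (preim T lift V) (sharp h V \<sigma>)"
        unfolding AB(3) using AB hc y openin_preim_lift[OF V(1)] by (intro lift_germ_eqI yT) simp_all
      then show "germ T y (preim T lift V) (sharp h V \<sigma>) = germ T y (preim T lift V) (sharp lift V \<sigma>)"
        using germ_sharp_lift[OF V y] by simp
    qed
  qed
qed

end

text \<open>In categorical terms the projection is a universal arrow from the inclusion of locally
  ringed spaces to \<open>(X, M)\<close>.\<close>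

theorem loc_space_universal:
  assumes "primed_ringed_space X M" "locally_ringed_space T" "g \<in> prs_hom T (local_primes T) X M"
  shows "\<exists>!h. h \<in> lrs_hom T (loc_space X M) \<and> rs_comp T (loc_space X M) X (loc_proj X M) h = g"
proof -
  interpret loc_lift X M T g
    by (intro loc_lift.intro loc_lift_axioms.intro assms)
  show ?thesis using lift_lrs_hom loc_proj_lift lift_unique by blast
qed

section \<open>Induced morphisms and functoriality\<close>

context
  fixes X :: "('a, 'r) rspace" and M and Y :: "('b, 's) rspace" and N
  assumes X: "primed_ringed_space X M" and Y: "primed_ringed_space Y N"
begin

interpretation X: primed_ringed_space X M by (rule X)
interpretation Y: primed_ringed_space Y N by (rule Y)

lemma loc_map_ex1:
  assumes f: "f \<in> prs_hom X M Y N"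
  shows "\<exists>!h. h \<in> lrs_hom (loc_space X M) (loc_space Y N) \<and>
     rs_comp (loc_space X M) (loc_space Y N) Y (loc_proj Y N) h =
     rs_comp (loc_space X M) X Y f (loc_proj X M)"
  by (intro loc_space_universal Y X.locally_ringed_loc_space prs_hom_rs_comp[OF _ _ _ X.loc_proj_prs_hom f]
      X.ringed_space_loc_space X.ringed_space_axioms Y.ringed_space_axioms)

lemma loc_map:
  assumes f: "f \<in> prs_hom X M Y N"
  shows loc_map_lrs_hom: "loc_map X M Y N f \<in> lrs_hom (loc_space X M) (loc_space Y N)"
    and loc_proj_loc_map: "rs_comp (loc_space X M) (loc_space Y N) Y (loc_proj Y N) (loc_map X M Y N f) =
      rs_comp (loc_space X M) X Y f (loc_proj X M)"
  using theI'[OF loc_map_ex1[OF f]] by (simp_all add: loc_map_def)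

lemma loc_map_eqI:
  assumes "f \<in> prs_hom X M Y N" "h \<in> lrs_hom (loc_space X M) (loc_space Y N)"
    and "rs_comp (loc_space X M) (loc_space Y N) Y (loc_proj Y N) h =
      rs_comp (loc_space X M) X Y f (loc_proj X M)"
  shows "loc_map X M Y N f = h"
  using loc_map_ex1[OF assms(1)] loc_map[OF assms(1)] assms(2,3) by blast

end

lemma lrs_hom_rs_comp:
  assumes "ringed_space X" "ringed_space Y" "ringed_space Z" "f \<in> lrs_hom X Y" "g \<in> lrs_hom Y Z"
  shows "rs_comp X Y Z g f \<in> lrs_hom X Z"
  using assms prs_hom_rs_comp unfolding lrs_hom_eq_prs_hom by blast

lemma rs_morphism_lrs_hom:
  assumes "ringed_space X" "ringed_space Y" "f \<in> lrs_hom X Y"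
  shows "rs_morphism X Y f"
  using assms rs_morphism_prs_hom unfolding lrs_hom_eq_prs_hom by blast

lemma (in locally_ringed_space) rs_id_lrs_hom: "rs_id X \<in> lrs_hom X X"
proof -
  interpret primed_ringed_space X "local_primes X" by (rule primed_local_primes)
  show ?thesis using rs_id_prs_hom by (simp add: lrs_hom_eq_prs_hom)
qed

lemma loc_map_id:
  assumes "primed_ringed_space X M"
  shows "loc_map X M X M (rs_id X) = rs_id (loc_space X M)"
proof -
  interpret primed_ringed_space X M by fact
  interpret L: locally_ringed_space "loc_space X M" by (rule locally_ringed_loc_space)
  show ?thesis
    by (rule loc_map_eqI[OF assms assms rs_id_prs_hom L.rs_id_lrs_hom])
      (simp add: proj.rs_comp_id_left proj.rs_comp_id_right)
qed

text \<open>The commuting squares of \<open>f\<close> and \<open>g\<close> paste to a commuting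
  square for the composite, and only one local morphism fits into such a square.\<close>

lemma loc_map_comp:
  assumes X: "primed_ringed_space X M" and Y: "primed_ringed_space Y N" and Z: "primed_ringed_space Z P"
    and f: "f \<in> prs_hom X M Y N" and g: "g \<in> prs_hom Y N Z P"
  shows "loc_map X M Z P (rs_comp X Y Z g f) =
    rs_comp (loc_space X M) (loc_space Y N) (loc_space Z P) (loc_map Y N Z P g) (loc_map X M Y N f)"
proof -
  interpret X: primed_ringed_space X M by (rule X)
  interpret Y: primed_ringed_space Y N by (rule Y)
  interpret Z: primed_ringed_space Z P by (rule Z)
  let ?LX = "loc_space X M" and ?LY = "loc_space Y N" and ?LZ = "loc_space Z P"
  let ?f = "loc_map X M Y N f" and ?g = "loc_map Y N Z P g"
  note rs = X.ringed_space_axioms Y.ringed_space_axioms Z.ringed_space_axioms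
  note lrs = X.ringed_space_loc_space Y.ringed_space_loc_space Z.ringed_space_loc_space
  have mf: "rs_morphism X Y f" and mg: "rs_morphism Y Z g"
    using rs_morphism_prs_hom rs f g by blast+
  have lf: "rs_morphism ?LX ?LY ?f" and lg: "rs_morphism ?LY ?LZ ?g"
    using rs_morphism_lrs_hom lrs loc_map_lrs_hom X Y Z f g by blast+
  have "rs_comp ?LX ?LZ Z (loc_proj Z P) (rs_comp ?LX ?LY ?LZ ?g ?f) =
      rs_comp ?LX ?LY Z (rs_comp ?LY ?LZ Z (loc_proj Z P) ?g) ?f"
    by (rule rs_comp_assoc[OF lf lg Z.proj.rs_morphism_axioms])
  also have "\<dots> = rs_comp ?LX ?LY Z (rs_comp ?LY Y Z g (loc_proj Y N)) ?f"
    by (simp add: loc_proj_loc_map[OF Y Z g])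
  also have "\<dots> = rs_comp ?LX Y Z g (rs_comp ?LX ?LY Y (loc_proj Y N) ?f)"
    by (rule rs_comp_assoc[OF lf Y.proj.rs_morphism_axioms mg, symmetric])
  also have "\<dots> = rs_comp ?LX Y Z g (rs_comp ?LX X Y f (loc_proj X M))"
    by (simp add: loc_proj_loc_map[OF X Y f])
  also have "\<dots> = rs_comp ?LX X Z (rs_comp X Y Z g f) (loc_proj X M)"
    by (rule rs_comp_assoc[OF X.proj.rs_morphism_axioms mf mg])
  finally show ?thesis
    by (intro loc_map_eqI X Z prs_hom_rs_comp[OF rs f g] lrs_hom_rs_comp[OF lrs]
        loc_map_lrs_hom[OF X Y f] loc_map_lrs_hom[OF Y Z g])
qed

section \<open>The retraction: localizing at the local prime system\<close>

lemma lrs_iso_loc_proj: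
  assumes "locally_ringed_space X"
  shows "lrs_iso (loc_space X (local_primes X)) X (loc_proj X (local_primes X))"
proof -
  interpret X: locally_ringed_space X by fact
  interpret primed_ringed_space X "local_primes X" by (rule X.primed_local_primes)
  let ?L = "loc_space X (local_primes X)" and ?\<pi> = "loc_proj X (local_primes X)"
  interpret L: locally_ringed_space ?L by (rule locally_ringed_loc_space)
  have \<pi>: "?\<pi> \<in> lrs_hom ?L X" using loc_proj_prs_hom by (simp add: lrs_hom_eq_prs_hom)
  \<comment> \<open>The candidate inverse is the factorization of the identity of \<open>X\<close>
    through the projection.\<close>
  obtain h where h: "h \<in> lrs_hom X ?L" "rs_comp X ?L X ?\<pi> h = rs_id X"
    using loc_space_universal[OF primed_ringed_space_axioms assms rs_id_prs_hom] by blast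
  note mh = rs_morphism_lrs_hom[OF X.ringed_space_axioms ringed_space_loc_space h(1)]
  have "rs_comp ?L ?L X ?\<pi> (rs_comp ?L X ?L h ?\<pi>) = rs_comp ?L X X (rs_comp X ?L X ?\<pi> h) ?\<pi>"
    by (rule rs_comp_assoc[OF proj.rs_morphism_axioms mh proj.rs_morphism_axioms])
  also have "\<dots> = ?\<pi>" by (simp add: h(2) proj.rs_comp_id_left)
  finally have 1: "rs_comp ?L ?L X ?\<pi> (rs_comp ?L X ?L h ?\<pi>) = ?\<pi>" .
  have 2: "rs_comp ?L X ?L h ?\<pi> \<in> lrs_hom ?L ?L"
    by (intro lrs_hom_rs_comp ringed_space_loc_space X.ringed_space_axioms \<pi> h)
  \<comment> \<open>Both sides are local factorizations of the projection through itself, so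
    uniqueness identifies them.\<close>
  have "rs_comp ?L X ?L h ?\<pi> = rs_id ?L"
    using loc_space_universal[OF primed_ringed_space_axioms locally_ringed_loc_space loc_proj_prs_hom]
      1 2 proj.rs_comp_id_right L.rs_id_lrs_hom by blast
  then show ?thesis using \<pi> h by (auto simp: lrs_iso_def)
qed

section \<open>The adjunction\<close>

lemma bij_betw_loc_adj:
  assumes Y: "locally_ringed_space Y" and X: "primed_ringed_space X M"
  shows "bij_betw (loc_adj Y X M) (lrs_hom Y (loc_space X M)) (prs_hom Y (local_primes Y) X M)"
proof -
  interpret Y: locally_ringed_space Y by (rule Y)
  interpret X: primed_ringed_space X M by (rule X)
  have closed: "loc_adj Y X M g \<in> prs_hom Y (local_primes Y) X M" if "g \<in> lrs_hom Y (loc_space X M)" for g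
    using that unfolding loc_adj_def lrs_hom_eq_prs_hom
    by (rule prs_hom_rs_comp[OF Y.ringed_space_axioms X.ringed_space_loc_space X.ringed_space_axioms _ X.loc_proj_prs_hom])
  \<comment> \<open>The universal property says that each \<open>g\<close> has exactly one preimage
    under \<open>loc_adj\<close>; together with \<open>closed\<close> this yields injectivity and
    surjectivity.\<close>
  have ex1: "\<exists>!h. h \<in> lrs_hom Y (loc_space X M) \<and> loc_adj Y X M h = g"
    if "g \<in> prs_hom Y (local_primes Y) X M" for g
    unfolding loc_adj_def by (rule loc_space_universal[OF X Y that])
  show ?thesis
  proof (rule bij_betw_imageI)
    show "inj_on (loc_adj Y X M) (lrs_hom Y (loc_space X M))"
      using ex1 closed unfolding inj_on_def by blast
    show "loc_adj Y X M ` lrs_hom Y (loc_space X M) = prs_hom Y (local_primes Y) X M"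
      using ex1 closed by blast
  qed
qed

text \<open>The adjunction map is composition with the projection, so precomposing with
  \<open>h\<close> commutes with it by associativity.\<close>

lemma loc_adj_natural_left:
  assumes "locally_ringed_space Y" "locally_ringed_space Y'" "primed_ringed_space X M"
    and "h \<in> lrs_hom Y' Y" "g \<in> lrs_hom Y (loc_space X M)"
  shows "loc_adj Y' X M (rs_comp Y' Y (loc_space X M) g h) = rs_comp Y' Y X (loc_adj Y X M g) h"
proof -
  interpret Y: locally_ringed_space Y by fact
  interpret Y': locally_ringed_space Y' by fact
  interpret X: primed_ringed_space X M by fact
  have "rs_morphism Y' Y h" "rs_morphism Y (loc_space X M) g"
    using assms(4,5) by (auto intro: rs_morphism_lrs_hom Y.ringed_space_axioms Y'.ringed_space_axioms
        X.ringed_space_loc_space)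
  then show ?thesis unfolding loc_adj_def by (rule rs_comp_assoc[OF _ _ X.proj.rs_morphism_axioms])
qed

text \<open>The square that characterizes \<open>loc_map\<close> moves \<open>k\<close> past the
  projections, between two uses of associativity.\<close>

lemma loc_adj_natural_right:
  assumes Y: "locally_ringed_space Y" and X: "primed_ringed_space X M" and X': "primed_ringed_space X' M'"
    and k: "k \<in> prs_hom X M X' M'" and g: "g \<in> lrs_hom Y (loc_space X M)"
  shows "loc_adj Y X' M' (rs_comp Y (loc_space X M) (loc_space X' M') (loc_map X M X' M' k) g) =
    rs_comp Y X X' k (loc_adj Y X M g)"
proof -
  interpret Y: locally_ringed_space Y by (rule Y)
  interpret X: primed_ringed_space X M by (rule X)
  interpret X': primed_ringed_space X' M' by (rule X')
  let ?L = "loc_space X M" and ?L' = "loc_space X' M'" and ?k = "loc_map X M X' M' k"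
  have mg: "rs_morphism Y ?L g"
    by (rule rs_morphism_lrs_hom[OF Y.ringed_space_axioms X.ringed_space_loc_space g])
  have mk: "rs_morphism X X' k"
    by (rule rs_morphism_prs_hom[OF X.ringed_space_axioms X'.ringed_space_axioms k])
  have ml: "rs_morphism ?L ?L' ?k"
    by (rule rs_morphism_lrs_hom[OF X.ringed_space_loc_space X'.ringed_space_loc_space loc_map_lrs_hom[OF X X' k]])
  have "rs_comp Y ?L' X' (loc_proj X' M') (rs_comp Y ?L ?L' ?k g) =
      rs_comp Y ?L X' (rs_comp ?L ?L' X' (loc_proj X' M') ?k) g"
    by (rule rs_comp_assoc[OF mg ml X'.proj.rs_morphism_axioms])
  also have "\<dots> = rs_comp Y ?L X' (rs_comp ?L X X' k (loc_proj X M)) g"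
    by (simp add: loc_proj_loc_map[OF X X' k])
  also have "\<dots> = rs_comp Y X X' k (rs_comp Y ?L X (loc_proj X M) g)"
    by (rule rs_comp_assoc[OF mg X.proj.rs_morphism_axioms mk, symmetric])
  finally show ?thesis by (simp add: loc_adj_def)
qed

lemma locally_ringed_space_loc_space:
  "primed_ringed_space X M \<Longrightarrow> locally_ringed_space (loc_space X M)"
  by (rule primed_ringed_space.locally_ringed_loc_space)

text \<open>For local \<open>f\<close> the square of the induced morphism is the naturality of the
  isomorphisms given by the projections.\<close>

lemma loc_proj_loc_map_local_primes:
  assumes "locally_ringed_space X" "locally_ringed_space Y" "f \<in> lrs_hom X Y"
  shows "rs_comp (loc_space X (local_primes X)) (loc_space Y (local_primes Y)) Y
      (loc_proj Y (local_primes Y)) (loc_map X (local_primes X) Y (local_primes Y) f) =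
    rs_comp (loc_space X (local_primes X)) X Y f (loc_proj X (local_primes X))"
  using assms(3) unfolding lrs_hom_eq_prs_hom
  by (intro loc_proj_loc_map locally_ringed_space.primed_local_primes assms(1,2))

theorem theorem2:
  shows
    "\<comment> \<open>existence and uniqueness of the induced morphism\<close>
     (\<forall>(X :: ('a, 'r) rspace) M (Y :: ('b, 's) rspace) N f.
        primed_ringed_space X M \<and> primed_ringed_space Y N \<and> f \<in> prs_hom X M Y N \<longrightarrow>
        (\<exists>!h. h \<in> lrs_hom (loc_space X M) (loc_space Y N) \<and>
              rs_comp (loc_space X M) (loc_space Y N) Y (loc_proj Y N) h =
              rs_comp (loc_space X M) X Y f (loc_proj X M))) \<and>
     \<comment> \<open>functoriality\<close>
     (\<forall>(X :: ('a, 'r) rspace) M. primed_ringed_space X M \<longrightarrow>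
        locally_ringed_space (loc_space X M) \<and>
        loc_map X M X M (rs_id X) = rs_id (loc_space X M)) \<and>
     (\<forall>(X :: ('a, 'r) rspace) M (Y :: ('b, 's) rspace) N f.
        primed_ringed_space X M \<and> primed_ringed_space Y N \<and> f \<in> prs_hom X M Y N \<longrightarrow>
        loc_map X M Y N f \<in> lrs_hom (loc_space X M) (loc_space Y N)) \<and>
     (\<forall>(X :: ('a, 'r) rspace) M (Y :: ('b, 's) rspace) N (Z :: ('c, 't) rspace) P f g.
        primed_ringed_space X M \<and> primed_ringed_space Y N \<and> primed_ringed_space Z P \<and>
        f \<in> prs_hom X M Y N \<and> g \<in> prs_hom Y N Z P \<longrightarrow>
        loc_map X M Z P (rs_comp X Y Z g f) =
        rs_comp (loc_space X M) (loc_space Y N) (loc_space Z P)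
          (loc_map Y N Z P g) (loc_map X M Y N f)) \<and>
     \<comment> \<open>localization retracts the inclusion: the projections form a natural isomorphism\<close>
     (\<forall>X :: ('a, 'r) rspace. locally_ringed_space X \<longrightarrow>
        lrs_iso (loc_space X (local_primes X)) X (loc_proj X (local_primes X))) \<and>
     (\<forall>(X :: ('a, 'r) rspace) (Y :: ('b, 's) rspace) f.
        locally_ringed_space X \<and> locally_ringed_space Y \<and> f \<in> lrs_hom X Y \<longrightarrow>
        rs_comp (loc_space X (local_primes X)) (loc_space Y (local_primes Y)) Y
          (loc_proj Y (local_primes Y)) (loc_map X (local_primes X) Y (local_primes Y) f) =
        rs_comp (loc_space X (local_primes X)) X Y f (loc_proj X (local_primes X))) \<and>
     \<comment> \<open>localization is right adjoint to the inclusion: bijection of hom sets,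
         natural in the locally ringed space and in the primed ringed space\<close>
     (\<forall>(Y :: ('b, 's) rspace) (X :: ('a, 'r) rspace) M.
        locally_ringed_space Y \<and> primed_ringed_space X M \<longrightarrow>
        bij_betw (loc_adj Y X M) (lrs_hom Y (loc_space X M)) (prs_hom Y (local_primes Y) X M)) \<and>
     (\<forall>(Y :: ('b, 's) rspace) (Y' :: ('c, 't) rspace) (X :: ('a, 'r) rspace) M h g.
        locally_ringed_space Y \<and> locally_ringed_space Y' \<and> primed_ringed_space X M \<and>
        h \<in> lrs_hom Y' Y \<and> g \<in> lrs_hom Y (loc_space X M) \<longrightarrow>
        loc_adj Y' X M (rs_comp Y' Y (loc_space X M) g h) =
        rs_comp Y' Y X (loc_adj Y X M g) h) \<and>
     (\<forall>(Y :: ('b, 's) rspace) (X :: ('a, 'r) rspace) M (X' :: ('c, 't) rspace) M' k g.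
        locally_ringed_space Y \<and> primed_ringed_space X M \<and> primed_ringed_space X' M' \<and>
        k \<in> prs_hom X M X' M' \<and> g \<in> lrs_hom Y (loc_space X M) \<longrightarrow>
        loc_adj Y X' M' (rs_comp Y (loc_space X M) (loc_space X' M') (loc_map X M X' M' k) g) =
        rs_comp Y X X' k (loc_adj Y X M g))"
  by (intro conjI allI impI; (elim conjE)?;
      (rule loc_map_ex1 locally_ringed_space_loc_space loc_map_id loc_map_lrs_hom loc_map_comp
        lrs_iso_loc_proj loc_proj_loc_map_local_primes bij_betw_loc_adj loc_adj_natural_left
        loc_adj_natural_right); assumption)

end
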